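(* Let $(M^n, g, X, \rho)$ be a complete non-compact almost Yamabe soliton with $n \ge 3$. If ${\rm Ric} \le 0$ and $|X| \in L^2(M)$, then $X$ is a parallel Killing vector field.
   Context: An almost Yamabe soliton $(M^n,g,X,\rho)$ is a (smooth) Riemannian $n$-manifold $(M^n,g)$ together with a smooth vector field $X$ and a smooth function $\rho$ on $M$ such that $\frac12 \mathcal{L}_X g = (R-\rho)\, g$, where $\mathcal{L}$ is the Lie derivative and $R$ is the scalar curvature of $g$. $X$ is Killing if $\mathcal{L}_X g=0$, i.e. $R-\rho\equiv 0$. $X$ is parallel if $\nabla X = 0$. ${\rm Ric}$ is the Ricci tensor of $g$. *)

theory Defs
  imports "HOL-Analysis.Analysis"
begin

section \<open>Smooth maps on open subsets of Euclidean space\<close>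

definition partial_deriv ::
  "'n::finite \<Rightarrow> (real^'n \<Rightarrow> 'b::real_normed_vector) \<Rightarrow> real^'n \<Rightarrow> 'b" where
  "partial_deriv i f x = frechet_derivative f (at x) (axis i 1)"

primrec Ck_on ::
  "nat \<Rightarrow> (real^'n::finite) set \<Rightarrow> (real^'n \<Rightarrow> 'b::real_normed_vector) \<Rightarrow> bool" where
  "Ck_on 0 S f \<longleftrightarrow> continuous_on S f"
| "Ck_on (Suc k) S f \<longleftrightarrow>
     (\<forall>x\<in>S. f differentiable (at x)) \<and> (\<forall>i. Ck_on k S (partial_deriv i f))"

definition smooth_on ::
  "(real^'n::finite) set \<Rightarrow> (real^'n \<Rightarrow> 'b::real_normed_vector) \<Rightarrow> bool" where
  "smooth_on S f \<longleftrightarrow> open S \<and> (\<forall>k. Ck_on k S f)"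


section \<open>Smooth manifolds\<close>

text \<open>
  The underlying topological space of a manifold is a Hausdorff, second countable type
  \<open>'m\<close>; its smooth structure is given by a smooth atlas \<open>A\<close>, which need not be maximal.
  A chart is a pair of an open domain and a coordinate map, whose values outside
  the domain are irrelevant. The dimension is \<open>CARD('n)\<close>.
\<close>

type_synonym ('m, 'n) chart = "'m set \<times> ('m \<Rightarrow> real^'n)"

abbreviation chart_dom :: "('m, 'n) chart \<Rightarrow> 'm set" where
  "chart_dom c \<equiv> fst c"

abbreviation coords :: "('m, 'n) chart \<Rightarrow> 'm \<Rightarrow> real^'n" where
  "coords c \<equiv> snd c"

definition chart_img :: "('m, 'n) chart \<Rightarrow> (real^'n) set" where
  "chart_img c = coords c ` chart_dom c"

definition chart_inv :: "('m, 'n) chart \<Rightarrow> real^'n \<Rightarrow> 'm" where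
  "chart_inv c = inv_into (chart_dom c) (coords c)"

definition is_chart :: "('m::topological_space, 'n::finite) chart \<Rightarrow> bool" where
  "is_chart c \<longleftrightarrow> open (chart_dom c) \<and> open (chart_img c) \<and>
     homeomorphism (chart_dom c) (chart_img c) (coords c) (chart_inv c)"

definition transition :: "('m, 'n) chart \<Rightarrow> ('m, 'n) chart \<Rightarrow> real^'n \<Rightarrow> real^'n" where
  "transition c d = coords d \<circ> chart_inv c"

definition smooth_atlas ::
  "('m::{t2_space,second_countable_topology}, 'n::finite) chart set \<Rightarrow> bool" where
  "smooth_atlas A \<longleftrightarrow>
     (\<forall>c\<in>A. is_chart c) \<and> (\<Union>c\<in>A. chart_dom c) = UNIV \<and>
     (\<forall>c\<in>A. \<forall>d\<in>A. smooth_on (coords c ` (chart_dom c \<inter> chart_dom d)) (transition c d))"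

definition smooth_function ::
  "('m, 'n::finite) chart set \<Rightarrow> ('m \<Rightarrow> real) \<Rightarrow> bool" where
  "smooth_function A f \<longleftrightarrow> (\<forall>c\<in>A. smooth_on (chart_img c) (f \<circ> chart_inv c))"

text \<open>An arbitrary chart around a point; only used for chart-independent quantities.\<close>

definition chart_at :: "('m, 'n) chart set \<Rightarrow> 'm \<Rightarrow> ('m, 'n) chart" where
  "chart_at A p = (SOME c. c \<in> A \<and> p \<in> chart_dom c)"


section \<open>Vector fields and Riemannian metrics\<close>

text \<open>
  Tensor fields are given by their components in every chart of the atlas, as functions of the
  coordinates on the image of the chart, subject to the tensor transformation law:
  \<open>X c x $ i\<close> is the component \<open>X\<^sup>i\<close>, and \<open>g c x $ i $ j\<close> the component
  \<open>g\<^sub>i\<^sub>j\<close>, in the chart \<open>c\<close> at the point with coordinates \<open>x\<close>.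
\<close>

type_synonym ('m, 'n) vfield = "('m, 'n) chart \<Rightarrow> real^'n \<Rightarrow> real^'n"
type_synonym ('m, 'n) tensor2 = "('m, 'n) chart \<Rightarrow> real^'n \<Rightarrow> real^'n^'n"

definition smooth_vector_field ::
  "('m, 'n::finite) chart set \<Rightarrow> ('m, 'n) vfield \<Rightarrow> bool" where
  "smooth_vector_field A X \<longleftrightarrow>
     (\<forall>c\<in>A. smooth_on (chart_img c) (X c)) \<and>
     (\<forall>c\<in>A. \<forall>d\<in>A. \<forall>p\<in>chart_dom c \<inter> chart_dom d.
        X d (coords d p) = jacobian (transition c d) (at (coords c p)) *v X c (coords c p))"

definition riemannian_metric ::
  "('m, 'n::finite) chart set \<Rightarrow> ('m, 'n) tensor2 \<Rightarrow> bool" where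
  "riemannian_metric A g \<longleftrightarrow>
     (\<forall>c\<in>A. smooth_on (chart_img c) (g c)) \<and>
     (\<forall>c\<in>A. \<forall>x\<in>chart_img c. transpose (g c x) = g c x \<and> (\<forall>v. v \<noteq> 0 \<longrightarrow> 0 < v \<bullet> (g c x *v v))) \<and>
     (\<forall>c\<in>A. \<forall>d\<in>A. \<forall>p\<in>chart_dom c \<inter> chart_dom d.
        let J = jacobian (transition c d) (at (coords c p))
        in g c (coords c p) = transpose J ** g d (coords d p) ** J)"

definition riemannian_manifold ::
  "('m::{t2_space,second_countable_topology}, 'n::finite) chart set \<Rightarrow> ('m, 'n) tensor2 \<Rightarrow> bool" where
  "riemannian_manifold A g \<longleftrightarrow> smooth_atlas A \<and> riemannian_metric A g"


section \<open>Coordinate expressions\<close>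

text \<open>
  In this section \<open>G\<close> and \<open>V\<close> are the components of a metric and of a vector field
  in one fixed chart.
\<close>

definition christoffel ::
  "(real^'n::finite \<Rightarrow> real^'n^'n) \<Rightarrow> 'n \<Rightarrow> 'n \<Rightarrow> 'n \<Rightarrow> real^'n \<Rightarrow> real" where
  "christoffel G k i j x =
     1/2 * (\<Sum>l\<in>UNIV. matrix_inv (G x) $ k $ l *
        (partial_deriv i (\<lambda>y. G y $ j $ l) x + partial_deriv j (\<lambda>y. G y $ i $ l) x
         - partial_deriv l (\<lambda>y. G y $ i $ j) x))"

text \<open>
  \<open>riemann G l k i j\<close> is the coefficient of \<open>\<partial>\<^sub>l\<close> in \<open>R(\<partial>\<^sub>i, \<partial>\<^sub>j)\<partial>\<^sub>k\<close>, where
  \<open>R(Y,Z) = [\<nabla>\<^sub>Y, \<nabla>\<^sub>Z] - \<nabla>\<^bsub>[Y,Z]\<^esub>\<close>, and \<open>Ric(Y,Z)\<close> is the trace of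
  \<open>W \<mapsto> R(W,Y)Z\<close>; round spheres have positive Ricci curvature.
\<close>

definition riemann ::
  "(real^'n::finite \<Rightarrow> real^'n^'n) \<Rightarrow> 'n \<Rightarrow> 'n \<Rightarrow> 'n \<Rightarrow> 'n \<Rightarrow> real^'n \<Rightarrow> real" where
  "riemann G l k i j x =
     partial_deriv i (christoffel G l j k) x - partial_deriv j (christoffel G l i k) x
     + (\<Sum>p\<in>UNIV. christoffel G l i p x * christoffel G p j k x
                 - christoffel G l j p x * christoffel G p i k x)"

definition ricci :: "(real^'n::finite \<Rightarrow> real^'n^'n) \<Rightarrow> real^'n \<Rightarrow> real^'n^'n" where
  "ricci G x = (\<chi> j k. \<Sum>i\<in>UNIV. riemann G i k i j x)"

definition scalar_curvature :: "(real^'n::finite \<Rightarrow> real^'n^'n) \<Rightarrow> real^'n \<Rightarrow> real" where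
  "scalar_curvature G x = (\<Sum>j\<in>UNIV. \<Sum>k\<in>UNIV. matrix_inv (G x) $ j $ k * ricci G x $ j $ k)"

definition lie_derivative ::
  "(real^'n::finite \<Rightarrow> real^'n) \<Rightarrow> (real^'n \<Rightarrow> real^'n^'n) \<Rightarrow> real^'n \<Rightarrow> real^'n^'n" where
  "lie_derivative V G x = (\<chi> i j. \<Sum>k\<in>UNIV.
     V x $ k * partial_deriv k (\<lambda>y. G y $ i $ j) x
     + G x $ k $ j * partial_deriv i (\<lambda>y. V y $ k) x
     + G x $ i $ k * partial_deriv j (\<lambda>y. V y $ k) x)"

text \<open>The \<open>(k, i)\<close> entry is the coefficient of \<open>\<partial>\<^sub>k\<close> in \<open>\<nabla>\<^sub>i V\<close>.\<close>

definition covariant_derivative ::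
  "(real^'n::finite \<Rightarrow> real^'n^'n) \<Rightarrow> (real^'n \<Rightarrow> real^'n) \<Rightarrow> real^'n \<Rightarrow> real^'n^'n" where
  "covariant_derivative G V x = (\<chi> k i.
     partial_deriv i (\<lambda>y. V y $ k) x + (\<Sum>j\<in>UNIV. christoffel G k i j x * V x $ j))"


section \<open>Geometric notions on a Riemannian manifold\<close>

definition almost_yamabe_soliton ::
  "('m::{t2_space,second_countable_topology}, 'n::finite) chart set \<Rightarrow> ('m, 'n) tensor2 \<Rightarrow>
   ('m, 'n) vfield \<Rightarrow> ('m \<Rightarrow> real) \<Rightarrow> bool" where
  "almost_yamabe_soliton A g X \<rho> \<longleftrightarrow>
     riemannian_manifold A g \<and> smooth_vector_field A X \<and> smooth_function A \<rho> \<and>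
     (\<forall>c\<in>A. \<forall>x\<in>chart_img c.
        (1/2) *\<^sub>R lie_derivative (X c) (g c) x =
        (scalar_curvature (g c) x - \<rho> (chart_inv c x)) *\<^sub>R g c x)"

definition ricci_nonpositive ::
  "('m, 'n::finite) chart set \<Rightarrow> ('m, 'n) tensor2 \<Rightarrow> bool" where
  "ricci_nonpositive A g \<longleftrightarrow>
     (\<forall>c\<in>A. \<forall>x\<in>chart_img c. \<forall>v. v \<bullet> (ricci (g c) x *v v) \<le> 0)"

definition killing_field ::
  "('m, 'n::finite) chart set \<Rightarrow> ('m, 'n) tensor2 \<Rightarrow> ('m, 'n) vfield \<Rightarrow> bool" where
  "killing_field A g X \<longleftrightarrow> (\<forall>c\<in>A. \<forall>x\<in>chart_img c. lie_derivative (X c) (g c) x = 0)"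

definition parallel_field ::
  "('m, 'n::finite) chart set \<Rightarrow> ('m, 'n) tensor2 \<Rightarrow> ('m, 'n) vfield \<Rightarrow> bool" where
  "parallel_field A g X \<longleftrightarrow> (\<forall>c\<in>A. \<forall>x\<in>chart_img c. covariant_derivative (g c) (X c) x = 0)"


subsection \<open>Riemannian distance and completeness\<close>

definition C1_curve_on ::
  "('m::topological_space, 'n::finite) chart set \<Rightarrow> real \<Rightarrow> real \<Rightarrow> (real \<Rightarrow> 'm) \<Rightarrow> bool" where
  "C1_curve_on A a b \<gamma> \<longleftrightarrow> continuous_on {a..b} \<gamma> \<and>
     (\<forall>c\<in>A. \<exists>D. continuous_on {t\<in>{a..b}. \<gamma> t \<in> chart_dom c} D \<and>
        (\<forall>t\<in>{a..b}. \<gamma> t \<in> chart_dom c \<longrightarrow>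
           ((coords c \<circ> \<gamma>) has_vector_derivative D t) (at t within {a..b})))"

text \<open>
  Piecewise \<open>C\<^sup>1\<close> on the unit interval: there is a finite set \<open>P\<close> of break points such that
  the curve is \<open>C\<^sup>1\<close>, up to the end points, on each closed subinterval without
  break points in its interior.
\<close>

definition piecewise_C1_curve ::
  "('m::topological_space, 'n::finite) chart set \<Rightarrow> (real \<Rightarrow> 'm) \<Rightarrow> bool" where
  "piecewise_C1_curve A \<gamma> \<longleftrightarrow>
     (\<exists>P. finite P \<and> (\<forall>a b. 0 \<le> a \<and> a < b \<and> b \<le> 1 \<and> {a<..<b} \<inter> P = {} \<longrightarrow> C1_curve_on A a b \<gamma>))"

definition curve_speed ::
  "('m, 'n::finite) chart set \<Rightarrow> ('m, 'n) tensor2 \<Rightarrow> (real \<Rightarrow> 'm) \<Rightarrow> real \<Rightarrow> real" where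
  "curve_speed A g \<gamma> t =
     (let c = chart_at A (\<gamma> t); v = vector_derivative (coords c \<circ> \<gamma>) (at t)
      in sqrt (v \<bullet> (g c (coords c (\<gamma> t)) *v v)))"

definition curve_length ::
  "('m, 'n::finite) chart set \<Rightarrow> ('m, 'n) tensor2 \<Rightarrow> (real \<Rightarrow> 'm) \<Rightarrow> ennreal" where
  "curve_length A g \<gamma> = (\<integral>\<^sup>+ t\<in>{0..1}. ennreal (curve_speed A g \<gamma> t) \<partial>lborel)"

text \<open>The distance of points in different connected components is \<open>\<infinity>\<close>.\<close>

definition riemannian_dist ::
  "('m::topological_space, 'n::finite) chart set \<Rightarrow> ('m, 'n) tensor2 \<Rightarrow> 'm \<Rightarrow> 'm \<Rightarrow> ennreal" where
  "riemannian_dist A g p q =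
     (INF \<gamma>\<in>{\<gamma>. piecewise_C1_curve A \<gamma> \<and> \<gamma> 0 = p \<and> \<gamma> 1 = q}. curve_length A g \<gamma>)"

definition riemannian_complete ::
  "('m::topological_space, 'n::finite) chart set \<Rightarrow> ('m, 'n) tensor2 \<Rightarrow> bool" where
  "riemannian_complete A g \<longleftrightarrow>
     (\<forall>\<sigma> :: nat \<Rightarrow> 'm.
        (\<forall>\<epsilon>>0. \<exists>N. \<forall>m\<ge>N. \<forall>n\<ge>N. riemannian_dist A g (\<sigma> m) (\<sigma> n) < \<epsilon>) \<longrightarrow>
        (\<exists>p. (\<lambda>n. riemannian_dist A g (\<sigma> n) p) \<longlonglongrightarrow> 0))"


subsection \<open>Riemannian volume and square integrability\<close>

text \<open>
  The Riemannian volume is the unique Borel measure which in each chart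
  has density \<open>sqrt (det g\<^sub>i\<^sub>j)\<close> with respect to Lebesgue measure. It exists because these
  local measures agree on overlaps, by the change of variables formula, and countably many
  charts cover the manifold.
\<close>

definition riemannian_volume ::
  "('m::topological_space, 'n::finite) chart set \<Rightarrow> ('m, 'n) tensor2 \<Rightarrow> 'm measure" where
  "riemannian_volume A g = (THE \<mu>. sets \<mu> = sets borel \<and>
     (\<forall>c\<in>A. \<forall>E\<in>sets borel. E \<subseteq> chart_dom c \<longrightarrow>
        emeasure \<mu> E = (\<integral>\<^sup>+ x\<in>coords c ` E. ennreal (sqrt (det (g c x))) \<partial>lborel)))"

definition vfield_norm ::
  "('m, 'n::finite) chart set \<Rightarrow> ('m, 'n) tensor2 \<Rightarrow> ('m, 'n) vfield \<Rightarrow> 'm \<Rightarrow> real" where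
  "vfield_norm A g X p =
     (let c = chart_at A p; x = coords c p in sqrt (X c x \<bullet> (g c x *v X c x)))"

definition norm_in_L2 ::
  "('m::topological_space, 'n::finite) chart set \<Rightarrow> ('m, 'n) tensor2 \<Rightarrow> ('m, 'n) vfield \<Rightarrow> bool" where
  "norm_in_L2 A g X \<longleftrightarrow> vfield_norm A g X \<in> borel_measurable (riemannian_volume A g) \<and>
     integrable (riemannian_volume A g) (\<lambda>p. (vfield_norm A g X p)\<^sup>2)"

end

theory Submission
  imports Defs
begin

text \<open>
  Let \<open>Y = \<nabla>\<^sub>X X - (div X) X\<close>. Then \<open>div Y = tr((\<nabla>X)\<^sup>2) - (div X)\<^sup>2 + Ric(X, X)\<close>. Since \<open>X\<close> is
  conformal, \<open>|\<nabla>X|\<^sup>2 = (2/n) (div X)\<^sup>2 - tr((\<nabla>X)\<^sup>2)\<close>, so for \<open>n \<ge> 2\<close> and \<open>Ric \<le> 0\<close> we get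
  \<open>div Y \<le> - |\<nabla>X|\<^sup>2\<close>, while \<open>|Y|\<^sup>2 \<le> C |\<nabla>X|\<^sup>2 |X|\<^sup>2\<close>. Testing with \<open>\<eta>\<^sup>2\<close>, where
  \<open>\<eta> = max 0 (1 - d(p, -)/R)\<close> has compact support by completeness, and absorbing the cross term gives
  \<open>\<integral>\<eta>\<^sup>2 |\<nabla>X|\<^sup>2 \<le> C R\<^sup>-\<^sup>2 \<integral>|X|\<^sup>2\<close>, which tends to \<open>0\<close> as \<open>R \<rightarrow> \<infinity>\<close>. As \<open>\<eta>\<close> is only Lipschitz,
  the integration by parts is done in charts with a partition of unity of class \<open>C\<^sup>1\<close>, and
  the derivative of \<open>\<eta>\<^sup>2\<close> is replaced by difference quotients.
\<close>

section \<open>Partial derivatives and maps of class \<open>C\<^sup>k\<close>\<close>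

text \<open>The constant C must not depend on R, although the covering of the ball of radius R does.
  Hence each chart ball is so small that the metric is within a factor 2 of its value at the centre,
  and difference quotients are taken along a frame orthonormal there: lengths, fluxes and Lipschitz
  constants then compare with factors depending on n only. The cross term is absorbed ball by ball
  with a weight psi_i; the terms with the derivative of psi_i, over which there is no uniform
  control, cancel in the sum because the weights add up to 1 on a neighbourhood of the ball outside
  which \<eta> vanishes. The weights are differentiated once, so C^1 bumps made from squares of
  positive parts suffice. Two notions yield nothing directly: the volume, given by
  \<open>THE\<close>, is obtained by gluing chart measures, and completeness, stated for Cauchy
  sequences, yields compact balls by a covering argument without geodesics.\<close>

lemma partial_deriv_eqI:
  assumes "(f has_derivative f') (at x)"
  shows "partial_deriv i f x = f' (axis i 1)"
  using frechet_derivative_at[OF assms] by (simp add: partial_deriv_def)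

lemma has_derivative_partials:
  fixes f :: "real^'n::finite \<Rightarrow> 'b::real_normed_vector"
  assumes "f differentiable (at x)"
  shows "(f has_derivative (\<lambda>h. \<Sum>i\<in>UNIV. h $ i *\<^sub>R partial_deriv i f x)) (at x)"
proof -
  let ?d = "frechet_derivative f (at x)"
  have d: "(f has_derivative ?d) (at x)"
    using assms frechet_derivative_works by blast
  then interpret bounded_linear ?d by (rule has_derivative_bounded_linear)
  have "?d h = (\<Sum>i\<in>UNIV. h $ i *\<^sub>R partial_deriv i f x)" for h
  proof -
    have "?d h = ?d (\<Sum>i\<in>UNIV. h $ i *\<^sub>R axis i 1)"
      by (simp add: vector_scaleR_component basis_expansion[of h, unfolded scalar_mult_eq_scaleR] )
    then show ?thesis by (simp add: sum scaleR partial_deriv_def)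
  qed
  then show ?thesis using d by (metis (no_types, lifting) ext)
qed

lemma Ck_on_subset: "Ck_on k S f \<Longrightarrow> T \<subseteq> S \<Longrightarrow> Ck_on k T f"
  by (induction k arbitrary: f) (auto intro: continuous_on_subset)

lemma Ck_on_Suc_imp: "Ck_on (Suc k) S f \<Longrightarrow> Ck_on k S f"
proof (induction k arbitrary: f)
  case 0
  then show ?case
    by (auto simp: continuous_on_eq_continuous_within intro: differentiable_imp_continuous_within
        differentiable_at_withinI)
qed auto

lemma Ck_on_imp_continuous_on: "Ck_on k S f \<Longrightarrow> continuous_on S f"
  by (induction k) (auto dest: Ck_on_Suc_imp simp del: Ck_on.simps(2))

text \<open>\<open>frechet_derivative\<close> is a choice among all derivatives. Functions that
  agree near x have the same derivatives, hence the same choice, even where there is none.\<close>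

lemma partial_deriv_cong:
  assumes "open S" "x \<in> S" "\<And>y. y \<in> S \<Longrightarrow> f y = h y"
  shows "partial_deriv i f x = partial_deriv i h x"
proof -
  have "(f has_derivative D) (at x) = (h has_derivative D) (at x)" for D
    using assms has_derivative_transform_within_open by (metis (no_types, lifting))
  then show ?thesis by (simp add: partial_deriv_def frechet_derivative_def)
qed

lemma differentiable_cong_open:
  assumes "open S" "x \<in> S" "\<And>y. y \<in> S \<Longrightarrow> f y = h y" "f differentiable (at x)"
  shows "h differentiable (at x)"
  using assms has_derivative_transform_within_open unfolding differentiable_def by metis

text \<open>The rules for derivatives hold only on S, while \<open>partial_deriv\<close> is a total
  function; the induction steps below work with a formula valid on S and return through this
  lemma.\<close>

lemma Ck_on_cong:
  assumes "open S" "Ck_on k S f" "\<And>y. y \<in> S \<Longrightarrow> f y = h y"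
  shows "Ck_on k S h"
  using assms(2,3)
proof (induction k arbitrary: f h)
  case 0
  then show ?case by (auto cong: continuous_on_cong)
next
  case (Suc k)
  have "Ck_on k S (partial_deriv i h)" for i
    using Suc.IH[of "partial_deriv i f"] Suc.prems partial_deriv_cong[OF assms(1) _ Suc.prems(2)]
    by simp
  moreover have "h differentiable (at x)" if "x \<in> S" for x
    by (rule differentiable_cong_open[OF assms(1) that Suc.prems(2)]) (use Suc.prems that in auto)
  ultimately show ?case by simp
qed

lemma Ck_on_const: "Ck_on k S (\<lambda>x. c)"
proof (induction k arbitrary: c)
  case (Suc k)
  have "partial_deriv i (\<lambda>x. c) = (\<lambda>x. 0)" for i :: 'a
    using partial_deriv_eqI[OF has_derivative_const] by fast
  then show ?case using Suc by simp
qed simp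

lemma Ck_on_add:
  assumes "open S" "Ck_on k S f" "Ck_on k S h"
  shows "Ck_on k S (\<lambda>x. f x + h x)"
  using assms(2,3)
proof (induction k arbitrary: f h)
  case 0
  then show ?case by (auto intro: continuous_intros)
next
  case (Suc k)
  have "partial_deriv i f x + partial_deriv i h x = partial_deriv i (\<lambda>x. f x + h x) x"
    if "x \<in> S" for x i
  proof -
    have "(f has_derivative frechet_derivative f (at x)) (at x)"
      "(h has_derivative frechet_derivative h (at x)) (at x)"
      using Suc.prems that by (auto simp: frechet_derivative_works[symmetric])
    from partial_deriv_eqI[OF has_derivative_add[OF this]] show ?thesis
      by (simp add: partial_deriv_def)
  qed
  then have "Ck_on k S (partial_deriv i (\<lambda>x. f x + h x))" for i
    by (rule Ck_on_cong[OF assms(1) Suc.IH, rotated -1]) (use Suc.prems in auto)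
  then show ?case using Suc.prems by auto
qed

lemma partial_deriv_mult:
  fixes f h :: "real^'n::finite \<Rightarrow> real"
  assumes "f differentiable (at x)" "h differentiable (at x)"
  shows "partial_deriv i (\<lambda>x. f x * h x) x = f x * partial_deriv i h x + partial_deriv i f x * h x"
proof -
  have "(f has_derivative frechet_derivative f (at x)) (at x)"
    "(h has_derivative frechet_derivative h (at x)) (at x)"
    using assms by (auto simp: frechet_derivative_works[symmetric])
  from partial_deriv_eqI[OF has_derivative_mult[OF this]] show ?thesis
    by (simp add: partial_deriv_def)
qed

lemma Ck_on_mult:
  fixes f h :: "real^'n::finite \<Rightarrow> real"
  assumes "open S" "Ck_on k S f" "Ck_on k S h"
  shows "Ck_on k S (\<lambda>x. f x * h x)"
  using assms(2,3)
proof (induction k arbitrary: f h)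
  case 0
  then show ?case by (auto intro: continuous_intros)
next
  case (Suc k)
  have "Ck_on k S (partial_deriv i (\<lambda>x. f x * h x))" for i
  proof (rule Ck_on_cong[OF assms(1)])
    show "Ck_on k S (\<lambda>x. f x * partial_deriv i h x + partial_deriv i f x * h x)"
      by (intro Ck_on_add[OF assms(1)] Suc.IH)
        (use Suc.prems Ck_on_Suc_imp[OF Suc.prems(1)] Ck_on_Suc_imp[OF Suc.prems(2)] in auto)
    show "f y * partial_deriv i h y + partial_deriv i f y * h y = partial_deriv i (\<lambda>x. f x * h x) y"
      if "y \<in> S" for y
      using Suc.prems that by (intro partial_deriv_mult[symmetric]) auto
  qed
  then show ?case using Suc.prems by auto
qed

lemma Ck_on_cmult:
  fixes f :: "real^'n::finite \<Rightarrow> real"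
  shows "open S \<Longrightarrow> Ck_on k S f \<Longrightarrow> Ck_on k S (\<lambda>x. c * f x)"
  by (rule Ck_on_mult) (auto intro: Ck_on_const)

lemma Ck_on_diff:
  fixes f h :: "real^'n::finite \<Rightarrow> real"
  assumes "open S" "Ck_on k S f" "Ck_on k S h"
  shows "Ck_on k S (\<lambda>x. f x - h x)"
  using Ck_on_add[OF assms(1,2) Ck_on_cmult[OF assms(1,3), of "-1"]] by simp

lemma Ck_on_sum:
  assumes "open S" "\<And>a. a \<in> I \<Longrightarrow> Ck_on k S (f a)"
  shows "Ck_on k S (\<lambda>x. \<Sum>a\<in>I. f a x)"
  using assms(2)
proof (induction I rule: infinite_finite_induct)
  case (insert a F)
  then show ?case by (simp add: Ck_on_add[OF assms(1)])
qed (simp_all add: Ck_on_const)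

lemma Ck_on_prod:
  fixes f :: "'a \<Rightarrow> real^'n::finite \<Rightarrow> real"
  assumes "open S" "\<And>a. a \<in> I \<Longrightarrow> Ck_on k S (f a)"
  shows "Ck_on k S (\<lambda>x. \<Prod>a\<in>I. f a x)"
  using assms(2)
proof (induction I rule: infinite_finite_induct)
  case (insert a F)
  then show ?case by (simp add: Ck_on_mult[OF assms(1)])
qed (simp_all add: Ck_on_const)

text \<open>The derivative of 1/f is -(1/f) f' (1/f), so the claim at order k + 1 rests on the claim
  for the same f at order k, and the induction keeps f fixed.\<close>

lemma Ck_on_inverse:
  fixes f :: "real^'n::finite \<Rightarrow> real"
  assumes "open S" "Ck_on k S f" "\<And>x. x \<in> S \<Longrightarrow> f x \<noteq> 0"
  shows "Ck_on k S (\<lambda>x. inverse (f x))"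
  using assms(2)
proof (induction k)
  case 0
  then show ?case using assms(3) by (auto intro!: continuous_intros)
next
  case (Suc k)
  have df: "f differentiable (at x)" if "x \<in> S" for x using Suc.prems that by auto
  have di: "((\<lambda>x. inverse (f x)) has_derivative
     (\<lambda>h. - (inverse (f x) * frechet_derivative f (at x) h * inverse (f x)))) (at x)" if "x \<in> S" for x
    using Deriv.has_derivative_inverse[where f = f and x = x and S = UNIV] assms(3)[OF that] df[OF that]
      frechet_derivative_works by blast
  have "Ck_on k S (partial_deriv i (\<lambda>x. inverse (f x)))" for i
  proof (rule Ck_on_cong[OF assms(1)])
    show "Ck_on k S (\<lambda>x. (-1) * (inverse (f x) * partial_deriv i f x * inverse (f x)))"
      by (intro Ck_on_mult[OF assms(1)] Ck_on_const Suc.IH Ck_on_Suc_imp[OF Suc.prems])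
        (use Suc.prems in auto)
    show "(-1) * (inverse (f y) * partial_deriv i f y * inverse (f y)) = partial_deriv i (\<lambda>x. inverse (f x)) y"
      if "y \<in> S" for y
      using partial_deriv_eqI[OF di[OF that]] by (simp add: partial_deriv_def)
  qed
  moreover have "(\<lambda>x. inverse (f x)) differentiable (at x)" if "x \<in> S" for x
    using di[OF that] unfolding differentiable_def by blast
  ultimately show ?case by simp
qed

lemma partial_deriv_nth:
  assumes "f differentiable (at x)"
  shows "partial_deriv i (\<lambda>y. f y $ j) x = partial_deriv i f x $ j"
proof -
  have "(f has_derivative frechet_derivative f (at x)) (at x)"
    using assms frechet_derivative_works by blast
  from partial_deriv_eqI[OF bounded_linear.has_derivative[OF bounded_linear_vec_nth this]]
  show ?thesis by (simp add: partial_deriv_def)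
qed

lemma Ck_on_nth:
  fixes f :: "real^'n::finite \<Rightarrow> 'b::real_normed_vector^'m::finite"
  assumes "open S" "Ck_on k S f"
  shows "Ck_on k S (\<lambda>x. f x $ j)"
  using assms(2)
proof (induction k arbitrary: f)
  case 0
  then show ?case by (auto intro: continuous_intros)
next
  case (Suc k)
  have "Ck_on k S (partial_deriv i (\<lambda>x. f x $ j))" for i
    by (rule Ck_on_cong[OF assms(1), where f="\<lambda>x. partial_deriv i f x $ j"])
      (use Suc in \<open>auto simp: partial_deriv_nth\<close>)
  moreover have "(\<lambda>x. f x $ j) differentiable (at x)" if "x \<in> S" for x
    using Suc.prems that bounded_linear.has_derivative[OF bounded_linear_vec_nth]
    unfolding differentiable_def Ck_on.simps by blast
  ultimately show ?case by simp
qed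

section \<open>Symmetry of second partial derivatives\<close>

lemma partial_deriv_line:
  fixes f :: "real^'n::finite \<Rightarrow> real"
  assumes "f differentiable (at (y + s *\<^sub>R axis i 1))"
  shows "((\<lambda>s. f (y + s *\<^sub>R axis i 1)) has_real_derivative
           partial_deriv i f (y + s *\<^sub>R axis i 1)) (at s)"
proof -
  let ?z = "y + s *\<^sub>R axis i 1" let ?d = "frechet_derivative f (at ?z)"
  have d: "(f has_derivative ?d) (at ?z)" using assms frechet_derivative_works by blast
  then interpret bounded_linear ?d by (rule has_derivative_bounded_linear)
  have "((\<lambda>s. y + s *\<^sub>R axis i 1) has_derivative (\<lambda>h. h *\<^sub>R axis i 1)) (at s)"
    by (auto intro!: derivative_eq_intros)
  from has_derivative_compose[OF this d]
  show ?thesis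
    by (simp add: has_field_derivative_def scaleR partial_deriv_def mult_commute_abs)
qed

text \<open>Schwarz's theorem: the second difference of f over a small square is symmetric in the
  two directions, and two mean value steps turn it into h^2 times either mixed derivative at some
  point of the square; continuity does the rest.\<close>

lemma partial_deriv_commute:
  fixes f :: "real^'n::finite \<Rightarrow> real"
  assumes S: "open S" "x \<in> S" and f: "Ck_on 2 S f"
  shows "partial_deriv i (partial_deriv j f) x = partial_deriv j (partial_deriv i f) x"
proof -
  have f1: "\<And>y. y \<in> S \<Longrightarrow> f differentiable (at y)"
    and f2: "\<And>y i. y \<in> S \<Longrightarrow> partial_deriv i f differentiable (at y)"
    and f3: "\<And>i j. continuous_on S (partial_deriv i (partial_deriv j f))"
    using f by (auto simp: numeral_2_eq_2)
  obtain r where r: "r > 0" "ball x r \<subseteq> S" using S openE by blast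
  let ?p = "\<lambda>i j a b. x + a *\<^sub>R axis i (1::real) + b *\<^sub>R axis j 1"
  \<comment> \<open>The directions i and j may coincide, so the distance is bounded by the triangle
    inequality; one strict side keeps the point in the open ball.\<close>
  have pin: "?p i j a b \<in> ball x (2 * h) " if "0 \<le> a" "a \<le> h" "0 \<le> b" "b \<le> h" "h > 0" "a < h \<or> b < h"
    for a b h i j
  proof -
    have "norm (a *\<^sub>R axis i (1::real) + b *\<^sub>R axis j 1) \<le> a + b"
      using that by (intro norm_triangle_le) (simp add: norm_axis_1)
    moreover have "dist x (?p i j a b) = norm (a *\<^sub>R axis i (1::real) + b *\<^sub>R axis j 1)"
      by (simp add: dist_norm norm_minus_commute algebra_simps)
    ultimately show ?thesis using that by auto
  qed
  have key: "\<exists>a b. 0 < a \<and> a < h \<and> 0 < b \<and> b < h \<and>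
     f (?p i j h h) - f (?p i j h 0) - f (?p i j 0 h) + f x
       = h * h * partial_deriv j (partial_deriv i f) (?p i j a b)"
    if h: "0 < h" "2 * h < r" for h i j
  proof -
    have inS: "?p i j a b \<in> S" if "0 \<le> a" "a \<le> h" "0 \<le> b" "b \<le> h" for a b
    proof -
      have "?p i j a b \<in> ball x (2 * (r/2))"
        using that h by (intro pin) auto
      then show ?thesis using r by auto
    qed
    let ?u = "\<lambda>s. f ((x + h *\<^sub>R axis j 1) + s *\<^sub>R axis i 1) - f (x + s *\<^sub>R axis i 1)"
    have "\<exists>z>0. z < h \<and> ?u h - ?u 0 = (h - 0) *
        (partial_deriv i f ((x + h *\<^sub>R axis j 1) + z *\<^sub>R axis i 1) - partial_deriv i f (x + z *\<^sub>R axis i 1))"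
    proof (rule MVT2[OF h(1)])
      fix s assume s: "0 \<le> s" "s \<le> h"
      show "(?u has_real_derivative partial_deriv i f ((x + h *\<^sub>R axis j 1) + s *\<^sub>R axis i 1)
          - partial_deriv i f (x + s *\<^sub>R axis i 1)) (at s)"
        by (intro DERIV_diff partial_deriv_line f1)
          (use inS[of s h] inS[of s 0] s h in \<open>auto simp: algebra_simps\<close>)
    qed
    then obtain a where a: "0 < a" "a < h" and ea: "?u h - ?u 0 = h *
        (partial_deriv i f ((x + h *\<^sub>R axis j 1) + a *\<^sub>R axis i 1) - partial_deriv i f (x + a *\<^sub>R axis i 1))"
      by auto
    let ?v = "\<lambda>t. partial_deriv i f ((x + a *\<^sub>R axis i 1) + t *\<^sub>R axis j 1)"
    have "\<exists>z>0. z < h \<and> ?v h - ?v 0 = (h - 0) *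
        partial_deriv j (partial_deriv i f) ((x + a *\<^sub>R axis i 1) + z *\<^sub>R axis j 1)"
    proof (rule MVT2[OF h(1)])
      fix s assume s: "0 \<le> s" "s \<le> h"
      show "(?v has_real_derivative partial_deriv j (partial_deriv i f) ((x + a *\<^sub>R axis i 1) + s *\<^sub>R axis j 1)) (at s)"
        by (intro partial_deriv_line f2) (use inS[of a s] s a in auto)
    qed
    then obtain b where b: "0 < b" "b < h" and eb: "?v h - ?v 0 = h *
        partial_deriv j (partial_deriv i f) ((x + a *\<^sub>R axis i 1) + b *\<^sub>R axis j 1)"
      by auto
    have "?u h - ?u 0 = h * (?v h - ?v 0)" unfolding ea by (simp add: algebra_simps)
    also have "\<dots> = h * h * partial_deriv j (partial_deriv i f) (?p i j a b)" unfolding eb by simp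
    finally have "f (?p i j h h) - f (?p i j h 0) - f (?p i j 0 h) + f x
       = h * h * partial_deriv j (partial_deriv i f) (?p i j a b)" by (simp add: algebra_simps)
    then show ?thesis using a b by blast
  qed
  show ?thesis
  proof (rule ccontr)
    let ?A = "partial_deriv i (partial_deriv j f)" let ?B = "partial_deriv j (partial_deriv i f)"
    assume ne: "?A x \<noteq> ?B x"
    define e where "e = dist (?A x) (?B x) / 2"
    have e: "e > 0" using ne by (simp add: e_def)
    have "isCont ?A x" "isCont ?B x"
      using f3 S by (auto simp: continuous_on_eq_continuous_at)
    then obtain d1 d2 where d: "d1 > 0" "d2 > 0" "\<And>y. dist y x < d1 \<Longrightarrow> dist (?A y) (?A x) < e"
      "\<And>y. dist y x < d2 \<Longrightarrow> dist (?B y) (?B x) < e"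
      using e unfolding continuous_at_eps_delta by blast
    \<comment> \<open>A third of each bound leaves 2 h strictly below it, and the sampled points lie
      within 2 h of x.\<close>
    define h where "h = Min {d1, d2, r} / 3"
    have h: "0 < h" "2 * h < r" "2 * h < d1" "2 * h < d2" using d r by (auto simp: h_def min_def)
    obtain a b where ab: "0 < a" "a < h" "0 < b" "b < h"
      "f (?p i j h h) - f (?p i j h 0) - f (?p i j 0 h) + f x = h * h * ?B (?p i j a b)"
      using key[OF h(1,2)] by blast
    obtain a' b' where ab': "0 < a'" "a' < h" "0 < b'" "b' < h"
      "f (?p j i h h) - f (?p j i h 0) - f (?p j i 0 h) + f x = h * h * ?A (?p j i a' b')"
      using key[OF h(1,2)] by blast
    have "h * h * ?B (?p i j a b) = h * h * ?A (?p j i a' b')"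
      using ab(5) ab'(5) by (simp add: algebra_simps)
    then have "?B (?p i j a b) = ?A (?p j i a' b')" using h by simp
    moreover have "dist (?B (?p i j a b)) (?B x) < e"
      using pin[of a h b i j] ab h by (intro d) (auto simp: dist_commute)
    moreover have "dist (?A (?p j i a' b')) (?A x) < e"
      using pin[of a' h b' j i] ab' h by (intro d) (auto simp: dist_commute)
    ultimately show False unfolding e_def
      by (metis dist_commute dist_triangle_half_r order_less_irrefl)
  qed
qed
lemma Ck_on_det:
  fixes G :: "real^'n::finite \<Rightarrow> real^'m^'m::finite"
  assumes "open S" "\<And>i j. Ck_on k S (\<lambda>x. G x $ i $ j)"
  shows "Ck_on k S (\<lambda>x. det (G x))"
  unfolding det_def by (intro Ck_on_sum Ck_on_mult Ck_on_prod Ck_on_const assms)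

section \<open>Linear algebra of conformal fields\<close>

text \<open>The divergence of Y as a polynomial identity at one point: \<open>dv\<close>,
  \<open>ddv\<close>, \<open>d\<Gamma>\<close> and \<open>dD\<close> stand for partial derivatives
  of components. Symmetry of \<open>ddv\<close> removes the second derivatives of v, the derivatives
  of \<Gamma> assemble to the Ricci form, and the remaining products with \<Gamma> complete
  \<open>dv\<close> to \<open>D\<close>.\<close>

lemma ricci_divergence_identity:
  fixes v :: "'n::finite \<Rightarrow> real" and dv :: "'n \<Rightarrow> 'n \<Rightarrow> real" and ddv dD \<Gamma> :: "'n \<Rightarrow> 'n \<Rightarrow> 'n \<Rightarrow> real"
    and d\<Gamma> :: "'n \<Rightarrow> 'n \<Rightarrow> 'n \<Rightarrow> 'n \<Rightarrow> real"
  assumes ddv: "\<And>k i l. ddv k i l = ddv k l i"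
    and \<Gamma>: "\<And>k i l. \<Gamma> k i l = \<Gamma> k l i"
    and D: "\<And>k i. D k i = dv k i + (\<Sum>m\<in>UNIV. \<Gamma> k i m * v m)"
    and dD: "\<And>k i l. dD k i l = ddv k i l + (\<Sum>m\<in>UNIV. d\<Gamma> k i m l * v m + \<Gamma> k i m * dv m l)"
  shows "(\<Sum>i\<in>UNIV. (\<Sum>j\<in>UNIV. dv j i * D i j + v j * dD i j i)
             - (dv i i * (\<Sum>j\<in>UNIV. D j j) + v i * (\<Sum>j\<in>UNIV. dD j j i)))
         + (\<Sum>i\<in>UNIV. \<Sum>k\<in>UNIV. \<Gamma> k k i * ((\<Sum>j\<in>UNIV. v j * D i j) - v i * (\<Sum>j\<in>UNIV. D j j)))
       = (\<Sum>i\<in>UNIV. \<Sum>j\<in>UNIV. D i j * D j i) - (\<Sum>i\<in>UNIV. D i i)^2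
         + (\<Sum>j\<in>UNIV. \<Sum>k\<in>UNIV. v j * v k * (\<Sum>i\<in>UNIV. d\<Gamma> i j k i - d\<Gamma> i i k j
              + (\<Sum>p\<in>UNIV. \<Gamma> i i p * \<Gamma> p j k - \<Gamma> i j p * \<Gamma> p i k)))"
    (is "?A + ?B = ?C - ?T^2 + ?R")
proof -
  \<comment> \<open>Both sides are expanded into the same few sums of monomials: P and Q with
    derivatives of \<Gamma>, U and W with \<Gamma> and \<open>dv\<close>, K and L quadratic in
    \<Gamma>. The contraction g is the logarithmic derivative of the volume density.\<close>
  define g where "g i = (\<Sum>k\<in>UNIV. \<Gamma> k k i)" for i
  define P where "P = (\<Sum>i\<in>UNIV. \<Sum>j\<in>UNIV. \<Sum>m\<in>UNIV. d\<Gamma> i j m i * v m * v j)"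
  define Q where "Q = (\<Sum>i\<in>UNIV. \<Sum>j\<in>UNIV. \<Sum>m\<in>UNIV. d\<Gamma> i i m j * v m * v j)"
  define U where "U = (\<Sum>i\<in>UNIV. \<Sum>j\<in>UNIV. \<Sum>m\<in>UNIV. \<Gamma> i j m * dv m i * v j)"
  define W where "W = (\<Sum>j\<in>UNIV. \<Sum>m\<in>UNIV. g m * dv m j * v j)"
  define S where "S = (\<Sum>i\<in>UNIV. dv i i)"
  define g1 where "g1 = (\<Sum>i\<in>UNIV. g i * v i)"
  define N where "N = (\<Sum>i\<in>UNIV. \<Sum>j\<in>UNIV. dv j i * D i j)"
  define K where "K = (\<Sum>i\<in>UNIV. \<Sum>j\<in>UNIV. \<Sum>m\<in>UNIV. g i * \<Gamma> i j m * v m * v j)"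
  define L where "L = (\<Sum>i\<in>UNIV. \<Sum>j\<in>UNIV. \<Sum>k\<in>UNIV. \<Sum>p\<in>UNIV. \<Gamma> i j p * \<Gamma> p i k * v j * v k)"
  have T: "?T = S + g1"
  proof -
    have "(\<Sum>i\<in>UNIV. \<Sum>m\<in>UNIV. \<Gamma> i i m * v m) = (\<Sum>m\<in>UNIV. \<Sum>i\<in>UNIV. \<Gamma> i i m * v m)"
      by (rule sum.swap)
    then show ?thesis by (simp add: D S_def g1_def g_def sum.distrib sum_distrib_right)
  qed
  have Wg: "(\<Sum>i\<in>UNIV. \<Sum>j\<in>UNIV. \<Sum>m\<in>UNIV. \<Gamma> i i m * dv m j * v j) = W"
  proof -
    have "(\<Sum>i\<in>UNIV. \<Sum>j\<in>UNIV. \<Sum>m\<in>UNIV. \<Gamma> i i m * dv m j * v j)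
       = (\<Sum>j\<in>UNIV. \<Sum>i\<in>UNIV. \<Sum>m\<in>UNIV. \<Gamma> i i m * dv m j * v j)" by (rule sum.swap)
    also have "\<dots> = (\<Sum>j\<in>UNIV. \<Sum>m\<in>UNIV. \<Sum>i\<in>UNIV. \<Gamma> i i m * dv m j * v j)"
      by (intro sum.cong refl sum.swap)
    finally show ?thesis by (simp add: W_def g_def sum_distrib_right)
  qed
  have A1: "(\<Sum>i\<in>UNIV. \<Sum>j\<in>UNIV. v j * dD i j i) - (\<Sum>i\<in>UNIV. v i * (\<Sum>j\<in>UNIV. dD j j i)) = P - Q + U - W"
  proof -
    have a: "(\<Sum>i\<in>UNIV. \<Sum>j\<in>UNIV. v j * dD i j i)
        = (\<Sum>i\<in>UNIV. \<Sum>j\<in>UNIV. v j * ddv i j i) + P + U"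
      by (simp add: dD P_def U_def sum_distrib_left sum.distrib algebra_simps)
    have "(\<Sum>i\<in>UNIV. v i * (\<Sum>j\<in>UNIV. dD j j i)) = (\<Sum>j\<in>UNIV. \<Sum>i\<in>UNIV. v i * dD j j i)"
      unfolding sum_distrib_left by (rule sum.swap)
    also have "\<dots> = (\<Sum>j\<in>UNIV. \<Sum>i\<in>UNIV. v i * ddv j j i) + Q + W"
      unfolding Wg[symmetric] by (simp add: dD Q_def sum_distrib_left sum.distrib algebra_simps)
    also have "(\<Sum>j\<in>UNIV. \<Sum>i\<in>UNIV. v i * ddv j j i) = (\<Sum>i\<in>UNIV. \<Sum>j\<in>UNIV. v j * ddv i j i)"
      by (intro sum.cong refl) (simp add: ddv)
    finally show ?thesis using a by simp
  qed
  have A: "?A = N - S * ?T + (P - Q + U - W)"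
    unfolding A1[symmetric] N_def S_def by (simp add: sum.distrib sum_subtractf sum_distrib_right)
  have B: "?B = W + K - g1 * ?T"
  proof -
    have "?B = (\<Sum>i\<in>UNIV. g i * ((\<Sum>j\<in>UNIV. v j * D i j) - v i * ?T))"
      by (simp add: g_def sum_distrib_right)
    also have "\<dots> = (\<Sum>i\<in>UNIV. \<Sum>j\<in>UNIV. g i * (v j * D i j)) - g1 * ?T"
      by (simp add: g1_def right_diff_distrib sum_subtractf flip: sum_distrib_right mult.assoc)
        (simp add: sum_distrib_left mult.assoc)
    also have "(\<Sum>i\<in>UNIV. \<Sum>j\<in>UNIV. g i * (v j * D i j)) = (\<Sum>i\<in>UNIV. \<Sum>j\<in>UNIV. g i * dv i j * v j) + K"
      by (simp add: D K_def sum.distrib sum_distrib_left algebra_simps)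
    also have "(\<Sum>i\<in>UNIV. \<Sum>j\<in>UNIV. g i * dv i j * v j) = W"
      unfolding W_def by (rule sum.swap)
    finally show ?thesis by simp
  qed
  \<comment> \<open>Relabelling, together with the symmetry of \<Gamma> in its lower indices, gives
    U the shape of a cross term in the trace of the square of D.\<close>
  have U': "U = (\<Sum>i\<in>UNIV. \<Sum>j\<in>UNIV. \<Sum>m\<in>UNIV. dv i j * \<Gamma> j i m * v m)"
  proof -
    have "U = (\<Sum>i\<in>UNIV. \<Sum>m\<in>UNIV. \<Sum>j\<in>UNIV. \<Gamma> i j m * dv m i * v j)"
      unfolding U_def by (intro sum.cong refl sum.swap)
    also have "\<dots> = (\<Sum>m\<in>UNIV. \<Sum>i\<in>UNIV. \<Sum>j\<in>UNIV. \<Gamma> i j m * dv m i * v j)"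
      by (rule sum.swap)
    also have "\<dots> = (\<Sum>i\<in>UNIV. \<Sum>j\<in>UNIV. \<Sum>m\<in>UNIV. dv i j * \<Gamma> j i m * v m)"
    proof (intro sum.cong refl)
      show "\<Gamma> i j m * dv m i * v j = dv m i * \<Gamma> i m j * v j" for m i j
        using \<Gamma>[of i j m] by simp
    qed
    finally show ?thesis .
  qed
  have L': "L = (\<Sum>i\<in>UNIV. \<Sum>j\<in>UNIV. \<Sum>m\<in>UNIV. \<Sum>l\<in>UNIV. \<Gamma> i j l * v l * \<Gamma> j i m * v m)"
  proof -
    have "L = (\<Sum>i\<in>UNIV. \<Sum>j\<in>UNIV. \<Sum>p\<in>UNIV. \<Sum>k\<in>UNIV. \<Gamma> i j p * \<Gamma> p i k * v j * v k)"
      unfolding L_def by (intro sum.cong refl sum.swap)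
    also have "\<dots> = (\<Sum>i\<in>UNIV. \<Sum>p\<in>UNIV. \<Sum>j\<in>UNIV. \<Sum>k\<in>UNIV. \<Gamma> i j p * \<Gamma> p i k * v j * v k)"
      by (intro sum.cong refl sum.swap)
    also have "\<dots> = (\<Sum>i\<in>UNIV. \<Sum>p\<in>UNIV. \<Sum>k\<in>UNIV. \<Sum>j\<in>UNIV. \<Gamma> i p j * v j * \<Gamma> p i k * v k)"
    proof (rule sum.cong[OF refl], rule sum.cong[OF refl])
      fix i p
      have "(\<Sum>j\<in>UNIV. \<Sum>k\<in>UNIV. \<Gamma> i j p * \<Gamma> p i k * v j * v k)
        = (\<Sum>j\<in>UNIV. \<Sum>k\<in>UNIV. \<Gamma> i p j * v j * \<Gamma> p i k * v k)"
      proof (intro sum.cong refl)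
        fix j k
        show "\<Gamma> i j p * \<Gamma> p i k * v j * v k = \<Gamma> i p j * v j * \<Gamma> p i k * v k"
          using \<Gamma>[of i j p] by simp
      qed
      then show "(\<Sum>j\<in>UNIV. \<Sum>k\<in>UNIV. \<Gamma> i j p * \<Gamma> p i k * v j * v k)
        = (\<Sum>k\<in>UNIV. \<Sum>j\<in>UNIV. \<Gamma> i p j * v j * \<Gamma> p i k * v k)"
        using sum.swap[of "\<lambda>j k. \<Gamma> i p j * v j * \<Gamma> p i k * v k" UNIV UNIV] by simp
    qed
    finally show ?thesis .
  qed
  have C: "?C = N + U + L"
  proof -
    have "?C = (\<Sum>i\<in>UNIV. \<Sum>j\<in>UNIV. D i j * dv j i + D i j * (\<Sum>m\<in>UNIV. \<Gamma> j i m * v m))"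
      by (subst (2) D) (simp add: algebra_simps)
    also have "\<dots> = N + (\<Sum>i\<in>UNIV. \<Sum>j\<in>UNIV. D i j * (\<Sum>m\<in>UNIV. \<Gamma> j i m * v m))"
      by (simp add: N_def sum.distrib mult.commute)
    also have "(\<Sum>i\<in>UNIV. \<Sum>j\<in>UNIV. D i j * (\<Sum>m\<in>UNIV. \<Gamma> j i m * v m)) = U + L"
      unfolding U' L' D by (simp add: sum.distrib sum_distrib_left sum_distrib_right algebra_simps)
    finally show ?thesis by simp
  qed
  have R: "?R = P - Q + K - L"
  proof -
    have r: "?R = (\<Sum>j\<in>UNIV. \<Sum>k\<in>UNIV. \<Sum>i\<in>UNIV. d\<Gamma> i j k i * v k * v j) - (\<Sum>j\<in>UNIV. \<Sum>k\<in>UNIV. \<Sum>i\<in>UNIV. d\<Gamma> i i k j * v k * v j)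
       + (\<Sum>j\<in>UNIV. \<Sum>k\<in>UNIV. \<Sum>i\<in>UNIV. \<Sum>p\<in>UNIV. \<Gamma> i i p * \<Gamma> p j k * v k * v j)
       - (\<Sum>j\<in>UNIV. \<Sum>k\<in>UNIV. \<Sum>i\<in>UNIV. \<Sum>p\<in>UNIV. \<Gamma> i j p * \<Gamma> p i k * v j * v k)"
      by (simp add: sum_distrib_left sum.distrib sum_subtractf algebra_simps)
    have sw: "(\<Sum>j\<in>UNIV. \<Sum>k\<in>UNIV. \<Sum>i\<in>UNIV. F i j k) = (\<Sum>i\<in>UNIV. \<Sum>j\<in>UNIV. \<Sum>k\<in>UNIV. F i j k)"
      for F :: "'n \<Rightarrow> 'n \<Rightarrow> 'n \<Rightarrow> real"
    proof -
      have "(\<Sum>j\<in>UNIV. \<Sum>k\<in>UNIV. \<Sum>i\<in>UNIV. F i j k) = (\<Sum>j\<in>UNIV. \<Sum>i\<in>UNIV. \<Sum>k\<in>UNIV. F i j k)"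
        by (intro sum.cong refl sum.swap)
      then show ?thesis by (simp add: sum.swap[of "\<lambda>j i. \<Sum>k\<in>UNIV. F i j k"])
    qed
    have K: "(\<Sum>i\<in>UNIV. \<Sum>j\<in>UNIV. \<Sum>k\<in>UNIV. \<Sum>p\<in>UNIV. \<Gamma> i i p * \<Gamma> p j k * v k * v j) = K"
    proof -
      have "(\<Sum>i\<in>UNIV. \<Sum>j\<in>UNIV. \<Sum>k\<in>UNIV. \<Sum>p\<in>UNIV. \<Gamma> i i p * \<Gamma> p j k * v k * v j)
         = (\<Sum>j\<in>UNIV. \<Sum>k\<in>UNIV. \<Sum>i\<in>UNIV. \<Sum>p\<in>UNIV. \<Gamma> i i p * \<Gamma> p j k * v k * v j)"
        by (rule sw[symmetric])
      also have "\<dots> = (\<Sum>j\<in>UNIV. \<Sum>k\<in>UNIV. \<Sum>p\<in>UNIV. \<Sum>i\<in>UNIV. \<Gamma> i i p * \<Gamma> p j k * v k * v j)"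
        by (intro sum.cong refl sum.swap)
      also have "\<dots> = (\<Sum>j\<in>UNIV. \<Sum>k\<in>UNIV. \<Sum>p\<in>UNIV. g p * \<Gamma> p j k * v k * v j)"
        by (simp add: g_def sum_distrib_right)
      finally show ?thesis
        unfolding K_def sw[of "\<lambda>i j k. g i * \<Gamma> i j k * v k * v j"] .
    qed
    show ?thesis
      unfolding r sw[of "\<lambda>i j k. d\<Gamma> i j k i * v k * v j"] sw[of "\<lambda>i j k. d\<Gamma> i i k j * v k * v j"]
        sw[of "\<lambda>i j k. \<Sum>p\<in>UNIV. \<Gamma> i i p * \<Gamma> p j k * v k * v j"] K
        sw[of "\<lambda>i j k. \<Sum>p\<in>UNIV. \<Gamma> i j p * \<Gamma> p i k * v j * v k"] P_def Q_def L_def by (rule refl)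
  qed
  show ?thesis unfolding A B C R unfolding T by (simp add: power2_eq_square algebra_simps)
qed

section \<open>Positive definite forms and orthonormal frames\<close>

definition pos_def :: "real^'n^'n::finite \<Rightarrow> bool" where
  "pos_def G \<longleftrightarrow> transpose G = G \<and> (\<forall>v. v \<noteq> 0 \<longrightarrow> 0 < v \<bullet> (G *v v))"

lemma inner_matrix_transpose: "(A *v x) \<bullet> y = x \<bullet> (transpose A *v y)" for A :: "real^'n^'m"
  using dot_lmul_matrix[of x "transpose A" y] transpose_matrix_vector[of "transpose A" x] by simp

lemma pos_def_inner_commute: "pos_def G \<Longrightarrow> u \<bullet> (G *v v) = v \<bullet> (G *v u)"
  by (metis inner_commute inner_matrix_transpose pos_def_def)

lemma pos_def_nonneg: "pos_def G \<Longrightarrow> 0 \<le> v \<bullet> (G *v v)"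
  by (cases "v = 0") (auto simp: pos_def_def intro: less_imp_le)

lemma matrix_inv_works:
  fixes A :: "real^'n^'n::finite"
  assumes "invertible A"
  shows matrix_inv_left: "matrix_inv A ** A = mat 1"
    and matrix_inv_right: "A ** matrix_inv A = mat 1"
proof -
  have "A ** matrix_inv A = mat 1 \<and> matrix_inv A ** A = mat 1"
    unfolding matrix_inv_def by (rule someI_ex) (use assms in \<open>auto simp: invertible_def\<close>)
  then show "matrix_inv A ** A = mat 1" "A ** matrix_inv A = mat 1" by blast+
qed

text \<open>Gram-Schmidt by induction over the index set. Before an index is added, fewer vectors
  than the dimension have been chosen, so some vector lies outside their span and its orthogonal
  remainder can be normalised.\<close>

lemma exists_orthonormal_family:
  fixes G :: "real^'n^'n::finite" and S :: "'n set"
  assumes G: "pos_def G"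
  shows "\<exists>e. \<forall>i\<in>S. \<forall>j\<in>S. e i \<bullet> (G *v e j) = (if i = j then 1 else 0)"
  using finite[of S]
proof (induction S rule: finite_induct)
  case (insert a F)
  then obtain e where e: "\<And>i j. i \<in> F \<Longrightarrow> j \<in> F \<Longrightarrow> e i \<bullet> (G *v e j) = (if i = j then 1 else 0)"
    by blast
  have "card F < CARD('n)"
    using insert.hyps by (metis card_mono card_insert_disjoint finite less_eq_Suc_le subset_UNIV)
  moreover have "dim (e ` F) \<le> card F"
    using dim_le_card'[of "e ` F"] card_image_le[of F e] by simp
  ultimately have "span (e ` F) \<noteq> UNIV"
    by (metis DIM_cart DIM_real dim_span dim_UNIV less_le_not_le mult.right_neutral order_le_less_trans)
  then obtain v where v: "v \<notin> span (e ` F)" by blast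
  define u where "u = v - (\<Sum>i\<in>F. (e i \<bullet> (G *v v)) *\<^sub>R e i)"
  have "(\<Sum>i\<in>F. (e i \<bullet> (G *v v)) *\<^sub>R e i) \<in> span (e ` F)"
    by (intro span_sum span_scale span_base) auto
  then have "u \<noteq> 0" using v unfolding u_def by auto
  then have c: "u \<bullet> (G *v u) > 0" (is "?c > 0") using G by (auto simp: pos_def_def)
  have ue: "e j \<bullet> (G *v u) = 0" if "j \<in> F" for j
  proof -
    have "e j \<bullet> (G *v u) = e j \<bullet> (G *v v) - (\<Sum>i\<in>F. (e i \<bullet> (G *v v)) * (e j \<bullet> (G *v e i)))"
      by (simp add: u_def matrix_vector_mult_diff_distrib inner_diff_right
          matrix_vector_mult_scaleR linear_sum[OF matrix_vector_mul_linear] inner_sum_right)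
    also have "(\<Sum>i\<in>F. (e i \<bullet> (G *v v)) * (e j \<bullet> (G *v e i))) = (\<Sum>i\<in>F. if j = i then e i \<bullet> (G *v v) else 0)"
      using e that by (intro sum.cong) auto
    finally show ?thesis using that insert.hyps by (simp add: sum.delta)
  qed
  have ue': "u \<bullet> (G *v e j) = 0" if "j \<in> F" for j
    using ue[OF that] pos_def_inner_commute[OF G, of u "e j"] by simp
  define f where "f = e(a := (1 / sqrt ?c) *\<^sub>R u)"
  have "\<forall>i\<in>insert a F. \<forall>j\<in>insert a F. f i \<bullet> (G *v f j) = (if i = j then 1 else 0)"
    using e ue ue' insert.hyps(2) c by (auto simp: f_def matrix_vector_mult_scaleR)
  then show ?case by blast
qed simp

lemma exists_orthonormal_frame:
  fixes G :: "real^'n^'n::finite"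
  assumes G: "pos_def G"
  obtains E :: "real^'n^'n" where "transpose E ** G ** E = mat 1"
proof -
  obtain e :: "'n \<Rightarrow> real^'n" where e: "\<And>i j. e i \<bullet> (G *v e j) = (if i = j then 1 else 0)"
    using exists_orthonormal_family[OF G, of UNIV] by auto
  define E :: "real^'n^'n" where "E = (\<chi> r a. e a $ r)"
  have "(transpose E ** G ** E) $ i $ j = e i \<bullet> (G *v e j)" for i j
  proof -
    have "(transpose E ** G ** E) = transpose E ** (G ** E)" by (simp add: matrix_mul_assoc)
    then show ?thesis
      by (simp add: E_def matrix_matrix_mult_def matrix_vector_mult_def transpose_def inner_vec_def)
  qed
  then have "transpose E ** G ** E = mat 1" by (simp add: vec_eq_iff e mat_def)
  then show thesis by (rule that)
qed

text \<open>One-sided inverses of square matrices are two-sided, so the factors of the frame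
  equation can be moved around freely; this expresses the inverse metric through the frame.\<close>

lemma frame_inverse:
  fixes E G :: "real^'n^'n::finite"
  assumes "transpose E ** G ** E = mat 1"
  shows "E ** (transpose E ** G) = mat 1" "matrix_inv G = E ** transpose E" "invertible G"
    "matrix_inv G ** G = mat 1" "G ** matrix_inv G = mat 1"
proof -
  show a: "E ** (transpose E ** G) = mat 1"
    using assms matrix_left_right_inverse by blast
  then have b: "(E ** transpose E) ** G = mat 1" by (simp add: matrix_mul_assoc)
  then have c: "G ** (E ** transpose E) = mat 1" using matrix_left_right_inverse by blast
  then show i: "invertible G" using b unfolding invertible_def by blast
  show d: "matrix_inv G ** G = mat 1" by (rule matrix_inv_left[OF i])
  show "G ** matrix_inv G = mat 1" by (rule matrix_inv_right[OF i])
  show "matrix_inv G = E ** transpose E"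
    by (metis c d matrix_mul_assoc matrix_mul_lid matrix_mul_rid)
qed

lemma pos_def_invertible: "pos_def G \<Longrightarrow> invertible G" for G :: "real^'n^'n::finite"
  by (metis exists_orthonormal_frame frame_inverse(3))

lemma pos_def_det:
  fixes G :: "real^'n^'n::finite"
  assumes "pos_def G" shows "det G > 0"
proof -
  obtain E :: "real^'n^'n" where E: "transpose E ** G ** E = mat 1" using exists_orthonormal_frame[OF assms] .
  then have "det E * det G * det E = 1" by (metis det_I det_mul det_transpose)
  then have e: "(det E)^2 * det G = 1" by (simp add: power2_eq_square mult_ac)
  show ?thesis
  proof (rule ccontr)
    assume "\<not> det G > 0"
    then have "(det E)^2 * det G \<le> 0" by (simp add: mult_nonneg_nonpos)
    then show False using e by simp
  qed
qed

text \<open>For the covariant derivative \<open>D\<close> of a conformal field this is \<open>|D|\<^sup>2\<close>: there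
  the adjoint of \<open>D\<close> is \<open>2 \<phi> - D\<close> with \<open>n \<phi> = trace D\<close>.\<close>

definition conformal_norm_sq :: "real^'n^'n::finite \<Rightarrow> real" where
  "conformal_norm_sq D = 2 / real CARD('n) * (trace D)^2 - trace (D ** D)"

text \<open>In a G-orthonormal frame D becomes a matrix B whose symmetric part is \<phi> times the
  identity, and \<open>conformal_norm_sq D\<close> becomes the sum h of the squared entries of B.
  All five claims are then elementary facts about h, the trace n \<phi> and the diagonal entries
  \<phi>.\<close>

lemma conformal_matrix:
  fixes G D :: "real^'n^'n::finite"
  assumes G: "pos_def G" and D: "G ** D + transpose (G ** D) = (2 * \<phi>) *\<^sub>R G"
  shows "trace D = real CARD('n) * \<phi>"
    and "conformal_norm_sq D \<ge> 0"
    and "conformal_norm_sq D = 0 \<Longrightarrow> D = 0"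
    and "CARD('n) \<ge> 2 \<Longrightarrow> trace (D ** D) - (trace D)^2 \<le> - conformal_norm_sq D"
    and "Y = D *v v - trace D *\<^sub>R v \<Longrightarrow>
      Y \<bullet> (G *v Y) \<le> 2 * (1 + real CARD('n)) * conformal_norm_sq D * (v \<bullet> (G *v v))"
proof -
  obtain E :: "real^'n^'n" where E: "transpose E ** G ** E = mat 1" using exists_orthonormal_frame[OF G] .
  note EG = frame_inverse(1)[OF E]
  let ?n = "real CARD('n)"
  define B where "B = transpose E ** G ** D ** E"
  have sG: "transpose G = G" using G by (simp add: pos_def_def)
  have madd_r: "(P + Q) ** R = P ** R + Q ** R" for P Q R :: "real^'n^'n"
    by (simp add: matrix_matrix_mult_def vec_eq_iff sum.distrib distrib_right)
  have "B + transpose B = transpose E ** (G ** D + transpose (G ** D)) ** E"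
    unfolding B_def by (simp add: matrix_transpose_mul matrix_add_ldistrib madd_r sG matrix_mul_assoc)
  also have "\<dots> = (2 * \<phi>) *\<^sub>R mat 1"
    unfolding D E[symmetric] by (simp add: matrix_scalar_ac scalar_matrix_assoc)
  finally have BB: "B + transpose B = (2 * \<phi>) *\<^sub>R mat 1" .
  have Bij: "B $ i $ j + B $ j $ i = (if i = j then 2 * \<phi> else 0)" for i j
    using arg_cong[OF BB, of "\<lambda>M. M $ i $ j"] by (auto simp: transpose_def mat_def)
  have Bii: "B $ i $ i = \<phi>" for i using Bij[of i i] by simp
  have DE: "D ** E = E ** B"
  proof -
    have "E ** B = (E ** (transpose E ** G)) ** (D ** E)" unfolding B_def by (simp add: matrix_mul_assoc)
    then show ?thesis unfolding EG by simp
  qed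
  have Dsim: "D = E ** B ** (transpose E ** G)"
    by (metis DE EG matrix_mul_assoc matrix_mul_rid)
  have tr: "trace D = trace B"
    using trace_mul_sym[of "transpose E ** G" "D ** E"] EG
    unfolding B_def by (metis DE Dsim E matrix_mul_assoc matrix_mul_lid trace_mul_sym)
  have tr2: "trace (D ** D) = trace (B ** B)"
  proof -
    have "trace (D ** D) = trace (D ** E ** B ** (transpose E ** G))"
      by (metis Dsim matrix_mul_assoc)
    also have "\<dots> = trace ((transpose E ** G) ** (D ** E ** B))" by (rule trace_mul_sym)
    also have "\<dots> = trace (B ** B)" by (simp add: B_def matrix_mul_assoc)
    finally show ?thesis .
  qed
  have trB: "trace B = ?n * \<phi>" by (simp add: trace_def Bii)
  then show trD: "trace D = ?n * \<phi>" using tr by simp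
  define h where "h = (\<Sum>i\<in>UNIV. \<Sum>j\<in>UNIV. (B $ i $ j)^2)"
  have h0: "h \<ge> 0" by (simp add: h_def sum_nonneg)
  \<comment> \<open>Off the diagonal B is skew, so products of opposite entries are negative
    squares; on the diagonal 2 \<phi> B_ii - B_ii^2 is again \<phi>^2.\<close>
  have "trace (B ** B) = (\<Sum>i\<in>UNIV. \<Sum>j\<in>UNIV. (if i = j then 2 * \<phi> * B $ i $ j else 0) - (B $ i $ j)^2)"
    unfolding trace_def matrix_matrix_mult_def
  proof (simp, intro sum.cong refl)
    fix i j
    show "B $ i $ j * B $ j $ i = (if i = j then 2 * \<phi> * B $ i $ j else 0) - (B $ i $ j)^2"
    proof (cases "i = j")
      case False
      then have "B $ j $ i = - B $ i $ j" using Bij[of i j] by simp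
      then show ?thesis using False by (simp add: power2_eq_square)
    qed (simp add: Bii power2_eq_square)
  qed
  also have "\<dots> = 2 * \<phi> * trace B - h"
    by (simp add: sum_subtractf h_def trace_def sum_distrib_left sum.delta)
  finally have t2: "trace (B ** B) = 2 * ?n * \<phi>^2 - h" unfolding trB by (simp add: power2_eq_square)
  have hs: "conformal_norm_sq D = h"
    by (simp add: conformal_norm_sq_def tr2 t2 trD power_mult_distrib power2_eq_square)
  show "conformal_norm_sq D \<ge> 0" using hs h0 by simp
  show "D = 0" if "conformal_norm_sq D = 0"
  proof -
    have "B = 0" using that h0 unfolding hs h_def
      by (simp add: sum_nonneg_eq_0_iff sum_nonneg vec_eq_iff)
    then show ?thesis using Dsim by (simp add: matrix_matrix_mult_def vec_eq_iff)
  qed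
  show "trace (D ** D) - (trace D)^2 \<le> - conformal_norm_sq D" if "CARD('n) \<ge> 2"
  proof -
    \<comment> \<open>This is where n \<ge> 2 enters: the trace of D D is 2 n \<phi>^2 - h, against
      (trace D)^2 = n^2 \<phi>^2.\<close>
    have "2 * ?n * \<phi>^2 \<le> ?n^2 * \<phi>^2"
      using that by (intro mult_right_mono) (auto simp: power2_eq_square)
    then show ?thesis unfolding hs tr2 t2 trD by (simp add: power_mult_distrib)
  qed
  assume Y: "Y = D *v v - trace D *\<^sub>R v"
  define w where "w = (transpose E ** G) *v v"
  have v: "v = E *v w" unfolding w_def by (simp add: matrix_vector_mul_assoc EG)
  have nE: "(E *v z) \<bullet> (G *v (E *v z)) = z \<bullet> z" for z
    unfolding inner_matrix_transpose by (simp add: matrix_vector_mul_assoc E matrix_mul_assoc)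
  define y where "y = B *v w - (?n * \<phi>) *\<^sub>R w"
  have "Y = E *v y"
    unfolding Y y_def v trD by (simp add: matrix_vector_mul_assoc DE matrix_vector_mult_diff_distrib matrix_vector_mult_scaleR)
  then have Yn: "Y \<bullet> (G *v Y) = (norm y)^2" by (simp add: nE power2_norm_eq_inner)
  have vn: "v \<bullet> (G *v v) = (norm w)^2" by (simp add: v nE power2_norm_eq_inner)
  have "(norm (B *v w))^2 = (\<Sum>i\<in>UNIV. (B $ i \<bullet> w)^2)"
    by (subst power2_norm_eq_inner) (simp add: inner_vec_def matrix_vector_mult_def power2_eq_square)
  also have "\<dots> \<le> (\<Sum>i\<in>UNIV. (norm (B $ i))^2 * (norm w)^2)"
    by (intro sum_mono) (metis Cauchy_Schwarz_ineq2 abs_ge_zero power2_abs power_mono power_mult_distrib)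
  also have "\<dots> = h * (norm w)^2"
    by (simp add: h_def sum_distrib_right power2_norm_eq_inner[of "B $ i" for i] inner_vec_def)
      (simp add: power2_eq_square)
  finally have b1: "(norm (B *v w))^2 \<le> h * (norm w)^2" .
  \<comment> \<open>The diagonal alone contributes n \<phi>^2 to h, so the trace term of Y costs a
    factor n; with the doubling from the square of a sum this is the origin of 2 (1 + n).\<close>
  have "(\<Sum>i\<in>(UNIV::'n set). \<phi>^2) \<le> h" unfolding h_def
  proof (rule sum_mono)
    fix i :: 'n
    have "(B $ i $ i)^2 \<le> (\<Sum>j\<in>UNIV. (B $ i $ j)^2)" by (intro member_le_sum) auto
    then show "\<phi>^2 \<le> (\<Sum>j\<in>UNIV. (B $ i $ j)^2)" by (simp add: Bii)
  qed
  then have "?n * \<phi>^2 \<le> h" by simp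
  then have "?n * (?n * \<phi>^2) \<le> ?n * h" by (intro mult_left_mono) auto
  then have b2: "(norm ((?n * \<phi>) *\<^sub>R w))^2 \<le> ?n * h * (norm w)^2"
  proof -
    have "(norm ((?n * \<phi>) *\<^sub>R w))^2 = (?n * (?n * \<phi>^2)) * (norm w)^2"
      by (simp add: power_mult_distrib power2_eq_square mult_ac)
    also have "\<dots> \<le> (?n * h) * (norm w)^2"
      using \<open>?n * (?n * \<phi>^2) \<le> ?n * h\<close> by (intro mult_right_mono) auto
    finally show ?thesis .
  qed
  have "norm y \<le> norm (B *v w) + norm ((?n * \<phi>) *\<^sub>R w)" unfolding y_def by (rule norm_triangle_ineq4)
  then have "(norm y)^2 \<le> (norm (B *v w) + norm ((?n * \<phi>) *\<^sub>R w))^2" by (intro power_mono) auto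
  also have "\<dots> \<le> 2 * ((norm (B *v w))^2 + (norm ((?n * \<phi>) *\<^sub>R w))^2)"
    using sum_squares_bound[of "norm (B *v w)" "norm ((?n * \<phi>) *\<^sub>R w)"]
    by (simp add: power2_eq_square algebra_simps)
  finally show "Y \<bullet> (G *v Y) \<le> 2 * (1 + ?n) * conformal_norm_sq D * (v \<bullet> (G *v v))"
    unfolding Yn vn hs using b1 b2 by (simp add: algebra_simps)
qed

text \<open>Jacobi's formula. Differentiating the Leibniz expansion row by row gives determinants in
  which row i is replaced by its derivative; Cramer's rule for rows evaluates each of them through
  the inverse matrix.\<close>

lemma has_derivative_det:
  fixes A :: "'a::real_normed_vector \<Rightarrow> real^'n^'n::finite"
  assumes A: "\<And>i j. ((\<lambda>y. A y $ i $ j) has_derivative dA i j) (at x)" and inv: "invertible (A x)"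
  shows "((\<lambda>y. det (A y)) has_derivative
    (\<lambda>h. det (A x) * (\<Sum>k\<in>UNIV. \<Sum>l\<in>UNIV. matrix_inv (A x) $ l $ k * dA k l h))) (at x)"
proof -
  have "((\<lambda>y. det (A y)) has_derivative (\<lambda>h. \<Sum>p | p permutes UNIV. of_int (sign p) *
      (\<Sum>i\<in>UNIV. dA i (p i) h * (\<Prod>j\<in>UNIV - {i}. A x $ j $ p j)))) (at x)"
    unfolding det_def by (intro derivative_eq_intros has_derivative_prod) (auto intro!: A)
  moreover have "(\<Sum>p | p permutes UNIV. of_int (sign p) *
      (\<Sum>i\<in>UNIV. dA i (p i) h * (\<Prod>j\<in>UNIV - {i}. A x $ j $ p j)))
     = det (A x) * (\<Sum>k\<in>UNIV. \<Sum>l\<in>UNIV. matrix_inv (A x) $ l $ k * dA k l h)" for h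
  proof -
    have "(\<Sum>p | p permutes UNIV. of_int (sign p) *
      (\<Sum>i\<in>UNIV. dA i (p i) h * (\<Prod>j\<in>UNIV - {i}. A x $ j $ p j)))
      = (\<Sum>i\<in>UNIV. \<Sum>p | p permutes UNIV. of_int (sign p) * (dA i (p i) h * (\<Prod>j\<in>UNIV - {i}. A x $ j $ p j)))"
      unfolding sum_distrib_left by (rule sum.swap)
    also have "\<dots> = (\<Sum>i\<in>UNIV. det (A x) * (\<Sum>l\<in>UNIV. matrix_inv (A x) $ l $ i * dA i l h))"
    proof (rule sum.cong[OF refl])
      fix i :: 'n
      \<comment> \<open>r is the differentiated row, and z holds its coefficients in the basis
        formed by the rows of A.\<close>
      define r :: "real^'n" where "r = (\<chi> l. dA i l h)"
      define z where "z = r v* matrix_inv (A x)"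
      have zA: "z v* A x = r" unfolding z_def
        by (metis inv matrix_inv_left vector_matrix_mul_assoc vector_matrix_mul_rid)
      have "(\<Sum>k\<in>UNIV. z $ k *s row k (A x)) = r"
        unfolding zA[symmetric] by (simp add: vec_eq_iff vector_matrix_mult_def row_def mult.commute)
      then have "det (\<chi> k. if k = i then r else row k (A x)) = z $ i * det (A x)"
        using cramer_lemma_transpose[of i z "A x"] by (metis (no_types))
      moreover have "det (\<chi> k. if k = i then r else row k (A x)) =
         (\<Sum>p | p permutes UNIV. of_int (sign p) * (dA i (p i) h * (\<Prod>j\<in>UNIV - {i}. A x $ j $ p j)))"
        unfolding det_def
      proof (intro sum.cong refl arg_cong2[where f="(*)"])
        fix p :: "'n \<Rightarrow> 'n"
        show "(\<Prod>j\<in>UNIV. (\<chi> k. if k = i then r else row k (A x)) $ j $ p j)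
          = dA i (p i) h * (\<Prod>j\<in>UNIV - {i}. A x $ j $ p j)"
          by (subst prod.remove[of _ i]) (auto simp: r_def row_def intro!: prod.cong)
      qed
      moreover have "z $ i = (\<Sum>l\<in>UNIV. matrix_inv (A x) $ l $ i * dA i l h)"
        by (simp add: z_def r_def vector_matrix_mult_def mult.commute)
      ultimately show "(\<Sum>p | p permutes UNIV. of_int (sign p) * (dA i (p i) h * (\<Prod>j\<in>UNIV - {i}. A x $ j $ p j)))
         = det (A x) * (\<Sum>l\<in>UNIV. matrix_inv (A x) $ l $ i * dA i l h)" by (simp add: mult.commute)
    qed
    finally show ?thesis by (simp add: sum_distrib_left)
  qed
  ultimately show ?thesis by simp
qed

section \<open>Change of variables\<close>

text \<open>The change of variables theorem of the library needs a well-ordered index type.\<close>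

typedef 'n::finite idx = "{..<CARD('n)}" by (rule exI[of _ 0]) simp
instantiation idx :: (finite) "{finite,wellorder}" begin
definition less_eq_idx :: "'a idx \<Rightarrow> 'a idx \<Rightarrow> bool" where "less_eq_idx a b = (Rep_idx a \<le> Rep_idx b)"
definition less_idx :: "'a idx \<Rightarrow> 'a idx \<Rightarrow> bool" where "less_idx a b = (Rep_idx a < Rep_idx b)"
instance
proof
  have "UNIV = (Abs_idx :: nat \<Rightarrow> 'a idx) ` {..<CARD('a)}"
    using type_definition.Abs_image[OF type_definition_idx] by blast
  then show "finite (UNIV :: 'a idx set)" by (metis finite_imageI finite_lessThan)
  fix P :: "'a idx \<Rightarrow> bool" and a
  assume IH: "\<And>x. (\<And>y. y < x \<Longrightarrow> P y) \<Longrightarrow> P x"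
  show "P a"
  proof (induction a rule: measure_induct_rule[where f = Rep_idx])
    case (less x)
    show ?case by (rule IH) (rule less, simp add: less_idx_def)
  qed
qed (auto simp: less_eq_idx_def less_idx_def Rep_idx_inject)
end

section \<open>Determinants and Lebesgue measure under renaming of coordinates\<close>

lemma CARD_idx: "CARD('n idx) = CARD('n::finite)"
  using type_definition.card[OF type_definition_idx] by simp

lemma exists_idx_bij: "\<exists>\<pi> :: 'n::finite idx \<Rightarrow> 'n. bij \<pi>"
  by (intro finite_same_card_bij) (simp_all add: CARD_idx)

text \<open>Conjugation by a bijection, even between different types, carries transpositions to
  transpositions, so the number of swaps and with it the sign is kept.\<close>

lemma swapidseq_conj:
  assumes "bij \<pi>" "swapidseq n p"
  shows "swapidseq n (\<pi> \<circ> p \<circ> inv \<pi>)"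
  using assms(2)
proof (induction rule: swapidseq.induct)
  case id
  have "\<pi> \<circ> id \<circ> inv \<pi> = id" using assms(1) by (simp add: fun_eq_iff bij_inv_eq_iff surj_f_inv_f bij_is_surj)
  then show ?case by (metis swapidseq.id)
next
  case (comp_Suc n p a b)
  have "\<pi> \<circ> (Transposition.transpose a b \<circ> p) \<circ> inv \<pi>
      = Transposition.transpose (\<pi> a) (\<pi> b) \<circ> (\<pi> \<circ> p \<circ> inv \<pi>)"
    using bij_is_inj[OF assms(1)] by (auto simp: fun_eq_iff Transposition.transpose_def inj_eq)
  moreover have "\<pi> a \<noteq> \<pi> b" using comp_Suc.hyps bij_is_inj[OF assms(1)] by (simp add: inj_eq)
  ultimately show ?case using swapidseq.comp_Suc[OF comp_Suc.IH \<open>\<pi> a \<noteq> \<pi> b\<close>] by (simp only:)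
qed

text \<open>Conjugation with \<pi> matches the permutations of the two index types and preserves the
  sign and the product in each term of the Leibniz expansion.\<close>

lemma det_reindex:
  fixes \<pi> :: "'k::finite \<Rightarrow> 'n::finite" and B :: "real^'n^'n"
  assumes "bij \<pi>"
  shows "det ((\<chi> a b. B $ \<pi> a $ \<pi> b) :: real^'k^'k) = det B"
proof -
  have inv_pi: "inv \<pi> (\<pi> a) = a" "\<pi> (inv \<pi> i) = i" for a i
    using assms by (simp_all add: bij_is_inj bij_is_surj surj_f_inv_f)
  have "det B = (\<Sum>q | q permutes (UNIV::'k set).
      of_int (sign (\<pi> \<circ> q \<circ> inv \<pi>)) * (\<Prod>i\<in>UNIV. B $ i $ (\<pi> \<circ> q \<circ> inv \<pi>) i))"
    unfolding det_def
  proof (rule sum.reindex_bij_witness[of _ "\<lambda>q. \<pi> \<circ> q \<circ> inv \<pi>" "\<lambda>p. inv \<pi> \<circ> p \<circ> \<pi>"])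
    fix p :: "'n \<Rightarrow> 'n" assume "p \<in> {p. p permutes UNIV}"
    then have "bij p" by (simp add: permutes_bij)
    then have "bij (inv \<pi> \<circ> p \<circ> \<pi>)" by (rule bij_comp[OF assms bij_comp[OF _ bij_imp_bij_inv[OF assms]]])
    then show "inv \<pi> \<circ> p \<circ> \<pi> \<in> {q. q permutes UNIV}" by (auto intro: bij_imp_permutes)
  next
    fix q :: "'k \<Rightarrow> 'k" assume "q \<in> {p. p permutes UNIV}"
    then have "bij q" by (simp add: permutes_bij)
    then have "bij (\<pi> \<circ> q \<circ> inv \<pi>)" by (rule bij_comp[OF bij_imp_bij_inv[OF assms] bij_comp[OF _ assms]])
    then show "\<pi> \<circ> q \<circ> inv \<pi> \<in> {q. q permutes UNIV}" by (auto intro: bij_imp_permutes)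
  qed (simp_all add: comp_def fun_eq_iff inv_pi)
  also have "\<dots> = (\<Sum>q | q permutes (UNIV::'k set).
      of_int (sign q) * (\<Prod>a\<in>UNIV. B $ \<pi> a $ \<pi> (q a)))"
  proof (rule sum.cong[OF refl])
    fix q :: "'k \<Rightarrow> 'k" assume "q \<in> {p. p permutes UNIV}"
    then have "permutation q" by (auto intro: permutes_imp_permutation)
    then obtain n where n: "swapidseq n q" unfolding permutation_def by blast
    have "evenperm (\<pi> \<circ> q \<circ> inv \<pi>) = evenperm q"
      using evenperm_unique[OF n refl] evenperm_unique[OF swapidseq_conj[OF assms n] refl] by simp
    then have "sign (\<pi> \<circ> q \<circ> inv \<pi>) = sign q" by (simp add: sign_def)
    moreover have "(\<Prod>i\<in>UNIV. B $ i $ (\<pi> \<circ> q \<circ> inv \<pi>) i) = (\<Prod>a\<in>UNIV. B $ \<pi> a $ \<pi> (q a))"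
      by (rule prod.reindex_bij_witness[of _ \<pi> "inv \<pi>"]) (simp_all add: inv_pi)
    ultimately show "of_int (sign (\<pi> \<circ> q \<circ> inv \<pi>)) * (\<Prod>i\<in>UNIV. B $ i $ (\<pi> \<circ> q \<circ> inv \<pi>) i)
       = of_int (sign q) * (\<Prod>a\<in>UNIV. B $ \<pi> a $ \<pi> (q a))" by simp
  qed
  finally show ?thesis by (simp add: det_def)
qed

lemma continuous_reindex: "continuous_on S (\<lambda>x :: 'a::topological_space^'n. (\<chi> k. x $ \<pi> k) :: 'a^'k)"
  by (intro continuous_intros)

text \<open>Lebesgue measure is determined by its values on boxes, and the preimage of a box is the
  box with permuted sides.\<close>

lemma distr_lborel_reindex:
  fixes \<pi> :: "'k::finite \<Rightarrow> 'n::finite"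
  assumes "bij \<pi>"
  shows "distr lborel borel (\<lambda>x :: real^'n. (\<chi> k. x $ \<pi> k) :: real^'k) = lborel"
proof (rule lborel_eqI[symmetric])
  let ?R = "\<lambda>x :: real^'n. (\<chi> k. x $ \<pi> k) :: real^'k"
  have inv_pi: "inv \<pi> (\<pi> a) = a" "\<pi> (inv \<pi> i) = i" for a i
    using assms by (simp_all add: bij_is_inj bij_is_surj surj_f_inv_f)
  have prod_vec: "(\<Prod>b\<in>Basis. z \<bullet> b) = (\<Prod>i\<in>UNIV. z $ i)" for z :: "real^'d::finite"
  proof -
    have "(Basis :: (real^'d) set) = range (\<lambda>i. axis i 1)" by (auto simp: Basis_vec_def)
    moreover have "inj (\<lambda>i::'d. axis i (1::real))" by (simp add: inj_on_def axis_eq_axis)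
    ultimately show ?thesis by (subst \<open>Basis = _\<close>, subst prod.reindex) (simp_all add: inner_axis)
  qed
  have meas: "?R \<in> borel_measurable borel" by (intro borel_measurable_continuous_onI continuous_reindex)
  fix l u :: "real^'k" assume lu: "\<And>b. b \<in> Basis \<Longrightarrow> l \<bullet> b \<le> u \<bullet> b"
  have lu': "l $ k \<le> u $ k" for k using lu[of "axis k 1"] by (simp add: inner_axis)
  have "?R -` box l u = box (\<chi> i. l $ inv \<pi> i) (\<chi> i. u $ inv \<pi> i)"
  proof (intro set_eqI iffI)
    fix x assume "x \<in> ?R -` box l u"
    then have "l $ inv \<pi> i < x $ \<pi> (inv \<pi> i) \<and> x $ \<pi> (inv \<pi> i) < u $ inv \<pi> i" for i
      by (simp add: mem_box_cart)
    then show "x \<in> box (\<chi> i. l $ inv \<pi> i) (\<chi> i. u $ inv \<pi> i)" by (simp add: mem_box_cart inv_pi)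
  next
    fix x assume "x \<in> box (\<chi> i. l $ inv \<pi> i) (\<chi> i. u $ inv \<pi> i)"
    then have "l $ inv \<pi> (\<pi> k) < x $ \<pi> k \<and> x $ \<pi> k < u $ inv \<pi> (\<pi> k)" for k
      by (simp only: mem_box_cart vec_lambda_beta)
    then show "x \<in> ?R -` box l u" by (simp add: mem_box_cart inv_pi)
  qed
  then have "emeasure (distr lborel borel ?R) (box l u)
     = emeasure lborel (box (\<chi> i. l $ inv \<pi> i) (\<chi> i. u $ inv \<pi> i) :: (real^'n) set)"
    using meas by (simp add: emeasure_distr)
  also have "\<dots> = (\<Prod>b\<in>Basis. ((\<chi> i. u $ inv \<pi> i) - (\<chi> i. l $ inv \<pi> i) :: real^'n) \<bullet> b)"
    by (rule emeasure_lborel_box) (auto simp: Basis_vec_def inner_axis lu')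
  also have "\<dots> = (\<Prod>i\<in>UNIV. (u - l) $ inv \<pi> i)" unfolding prod_vec by simp
  also have "\<dots> = (\<Prod>k\<in>UNIV. (u - l) $ k)"
    by (intro arg_cong[where f = ennreal] prod.reindex_bij_witness[of _ \<pi> "inv \<pi>"]) (simp_all add: inv_pi)
  finally show "emeasure (distr lborel borel ?R) (box l u) = (\<Prod>b\<in>Basis. (u - l) \<bullet> b)"
    unfolding prod_vec .
qed simp

lemma has_integral_nn_integral_on:
  fixes f :: "'a::euclidean_space \<Rightarrow> real"
  assumes "(\<lambda>x. indicator S x * f x) \<in> borel_measurable borel" "\<And>x. x \<in> S \<Longrightarrow> 0 \<le> f x"
    and "(\<integral>\<^sup>+x. ennreal (indicator S x * f x) \<partial>lborel) = ennreal r" "0 \<le> r"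
  shows "(f has_integral r) S"
proof -
  have "((\<lambda>x. indicator S x * f x) has_integral r) UNIV"
    using assms by (intro nn_integral_has_integral) (auto simp: indicator_def)
  moreover have "(\<lambda>x. indicator S x * f x) = (\<lambda>x. if x \<in> S then f x else 0)" by auto
  ultimately show ?thesis by (simp add: has_integral_restrict_UNIV)
qed

text \<open>The theorem on absolutely integrable functions is stated for vector values, so h is
  multiplied by the unit vector of \<open>real^1\<close>. Finiteness of either side makes both
  functions integrable with equal integrals; otherwise both sides are infinite.\<close>

lemma nn_integral_change_of_variables_wellorder:
  fixes T :: "real^'m::{finite,wellorder} \<Rightarrow> real^'m::_" and h :: "real^'m::_ \<Rightarrow> real"
  assumes S: "S \<in> sets borel" and der: "\<And>x. x \<in> S \<Longrightarrow> (T has_derivative T' x) (at x within S)"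
    and inj: "inj_on T S" and h: "\<And>y. y \<in> T ` S \<Longrightarrow> 0 \<le> h y"
    and mh: "(\<lambda>y. indicator (T ` S) y * h y) \<in> borel_measurable borel"
    and mF: "(\<lambda>x. indicator S x * (\<bar>det (matrix (T' x))\<bar> * h (T x))) \<in> borel_measurable borel"
  shows "(\<integral>\<^sup>+y. ennreal (indicator (T ` S) y * h y) \<partial>lborel)
       = (\<integral>\<^sup>+x. ennreal (indicator S x * (\<bar>det (matrix (T' x))\<bar> * h (T x))) \<partial>lborel)" (is "?L = ?R")
proof -
  let ?F = "\<lambda>x. \<bar>det (matrix (T' x))\<bar> * h (T x)"
  let ?v = "axis 1 1 :: real^1"
  have vv: "?v \<bullet> ?v = 1" by (simp add: inner_axis)
  have Sl: "S \<in> sets lebesgue" using S by simp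
  note cov = has_absolute_integral_change_of_variables[OF Sl der inj, where f = "\<lambda>y. h y *\<^sub>R ?v"]
  have scale: "(\<lambda>x. f x *\<^sub>R ?v) absolutely_integrable_on W \<and> integral W (\<lambda>x. f x *\<^sub>R ?v) = r *\<^sub>R ?v"
    if "(f has_integral r) W" "\<And>x. x \<in> W \<Longrightarrow> 0 \<le> f x" for f :: "real^'m::_ \<Rightarrow> real" and r W
  proof -
    have "f absolutely_integrable_on W" using that by (intro nonnegative_absolutely_integrable_1) auto
    then have "(\<lambda>x. f x *\<^sub>R ?v) absolutely_integrable_on W"
      unfolding set_integrable_def
      by (metis (mono_tags, lifting) Bochner_Integration.integrable_cong integrable_scaleR_left scaleR_scaleR real_scaleR_def)
    then show ?thesis using has_integral_scaleR_left[OF that(1), of ?v] by (simp add: integral_unique)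
  qed
  have unscale: "(f has_integral r) W"
    if "(\<lambda>x. f x *\<^sub>R ?v) absolutely_integrable_on W" "integral W (\<lambda>x. f x *\<^sub>R ?v) = r *\<^sub>R ?v"
    for f :: "real^'m::_ \<Rightarrow> real" and r W
  proof -
    have "((\<lambda>x. f x *\<^sub>R ?v) has_integral r *\<^sub>R ?v) W"
      using that by (metis has_integral_integral set_lebesgue_integral_eq_integral(1))
    from has_integral_linear[OF this bounded_linear_inner_left[of ?v]] show ?thesis
      by (simp add: o_def vv)
  qed
  show ?thesis
  proof (cases "?R")
    case (real r)
    have "(?F has_integral r) S" using real h by (intro has_integral_nn_integral_on[OF mF]) auto
    then have "(h has_integral r) (T ` S)"
      using cov[of "r *\<^sub>R ?v"] scale[of ?F r S] unscale[of "T ` S" h r] h by simp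
    from nn_integral_has_integral_lebesgue[OF h this] show ?thesis using real by simp
  next
    \<comment> \<open>Against an infinite right side, a finite left side is impossible: the
      equivalence read backwards would make the right side finite.\<close>
    case top
    show ?thesis
    proof (cases "?L")
      case (real r)
      have "(h has_integral r) (T ` S)" using real h by (intro has_integral_nn_integral_on[OF mh]) auto
      then have "(?F has_integral r) S"
        using cov[of "r *\<^sub>R ?v"] scale[of h r "T ` S"] unscale[of S ?F r] h by simp
      from nn_integral_has_integral_lebesgue[OF _ this] h show ?thesis using real by simp
    qed (use top in simp)
  qed
qed

text \<open>Renaming coordinates reduces this to a well-ordered index type: the maps R and Q are
  mutually inverse, Q preserves Lebesgue measure, and the conjugated derivative has the same
  determinant.\<close>

lemma nn_integral_change_of_variables:
  fixes T :: "real^'n::finite \<Rightarrow> real^'n" and h :: "real^'n \<Rightarrow> real"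
  assumes S: "S \<in> sets borel" and der: "\<And>x. x \<in> S \<Longrightarrow> (T has_derivative T' x) (at x within S)"
    and inj: "inj_on T S" and h: "\<And>y. y \<in> T ` S \<Longrightarrow> 0 \<le> h y"
    and mh: "(\<lambda>y. indicator (T ` S) y * h y) \<in> borel_measurable borel"
    and mF: "(\<lambda>x. indicator S x * (\<bar>det (matrix (T' x))\<bar> * h (T x))) \<in> borel_measurable borel"
  shows "(\<integral>\<^sup>+y. ennreal (indicator (T ` S) y * h y) \<partial>lborel)
       = (\<integral>\<^sup>+x. ennreal (indicator S x * (\<bar>det (matrix (T' x))\<bar> * h (T x))) \<partial>lborel)"
proof -
  obtain \<pi> :: "'n idx \<Rightarrow> 'n" where pi: "bij \<pi>" using exists_idx_bij by blast
  have inv_pi: "inv \<pi> (\<pi> a) = a" "\<pi> (inv \<pi> i) = i" for a i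
    using pi by (simp_all add: bij_is_inj bij_is_surj surj_f_inv_f)
  define R :: "real^'n \<Rightarrow> real^('n idx)" where "R x = (\<chi> k. x $ \<pi> k)" for x
  define Q :: "real^('n idx) \<Rightarrow> real^'n" where "Q y = (\<chi> i. y $ inv \<pi> i)" for y
  have QR: "Q (R x) = x" for x by (simp add: Q_def R_def vec_eq_iff inv_pi)
  have RQ: "R (Q x) = x" for x by (simp add: Q_def R_def vec_eq_iff inv_pi)
  have linR: "bounded_linear R" unfolding R_def
    by (intro linear_conv_bounded_linear[THEN iffD1] linearI) (auto simp: vec_eq_iff)
  have linQ: "bounded_linear Q" unfolding Q_def
    by (intro linear_conv_bounded_linear[THEN iffD1] linearI) (auto simp: vec_eq_iff)
  have mQ: "Q \<in> borel_measurable borel"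
    by (auto intro!: borel_measurable_continuous_onI linear_continuous_on linQ)
  have "distr lborel borel Q = lborel"
    unfolding Q_def using pi by (intro distr_lborel_reindex bij_imp_bij_inv)
  then have tr: "(\<integral>\<^sup>+y. ennreal (f y) \<partial>lborel) = (\<integral>\<^sup>+z. ennreal (f (Q z)) \<partial>lborel)"
    if "f \<in> borel_measurable borel" for f :: "real^'n \<Rightarrow> real"
    using nn_integral_distr[of Q lborel borel "\<lambda>y. ennreal (f y)"] mQ that by simp
  define S1 where "S1 = R ` S"
  have S1: "S1 = Q -` S" unfolding S1_def using QR RQ by (auto simp: image_iff) metis
  define T1 where "T1 = R \<circ> T \<circ> Q"
  define T1' where "T1' y = R \<circ> T' (Q y) \<circ> Q" for y
  have TS1: "T1 ` S1 = Q -` (T ` S)"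
    unfolding S1_def T1_def using QR RQ by (auto simp: image_iff) metis
  have det1: "det (matrix (T1' y)) = det (matrix (T' (Q y)))" for y
  proof -
    have Qa: "Q (axis b 1) = axis (\<pi> b) 1" for b
      by (auto simp: Q_def axis_def vec_eq_iff inv_pi)
    have "matrix (T1' y) = (\<chi> a b. matrix (T' (Q y)) $ \<pi> a $ \<pi> b)"
      by (simp add: matrix_def T1'_def vec_eq_iff R_def Qa)
    then show ?thesis using det_reindex[OF pi, of "matrix (T' (Q y))"] by simp
  qed
  have "(\<integral>\<^sup>+y. ennreal (indicator (T1 ` S1) y * h (Q y)) \<partial>lborel)
       = (\<integral>\<^sup>+x. ennreal (indicator S1 x * (\<bar>det (matrix (T1' x))\<bar> * h (Q (T1 x)))) \<partial>lborel)"
  proof (rule nn_integral_change_of_variables_wellorder)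
    show "S1 \<in> sets borel" unfolding S1 using measurable_sets_borel[OF mQ S] by simp
    show "inj_on T1 S1" unfolding inj_on_def T1_def S1 using inj QR RQ by (auto simp: inj_on_def) metis
    show "0 \<le> h (Q y)" if "y \<in> T1 ` S1" for y using that h unfolding TS1 by auto
    show "(\<lambda>y. indicator (T1 ` S1) y * h (Q y)) \<in> borel_measurable borel"
      using measurable_compose[OF mQ mh] by (simp add: TS1 indicator_def)
    show "(\<lambda>x. indicator S1 x * (\<bar>det (matrix (T1' x))\<bar> * h (Q (T1 x)))) \<in> borel_measurable borel"
      using measurable_compose[OF mQ mF] by (simp add: det1 T1_def QR S1 indicator_def)
    fix x assume x: "x \<in> S1"
    have "(T \<circ> Q has_derivative T' (Q x) \<circ> Q) (at x within S1)"
      by (rule diff_chain_within[OF bounded_linear_imp_has_derivative[OF linQ]])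
        (use x der[of "Q x"] in \<open>auto simp: S1 intro: has_derivative_subset\<close>)
    from diff_chain_within[OF this bounded_linear_imp_has_derivative[OF linR]]
    show "(T1 has_derivative T1' x) (at x within S1)"
      unfolding T1_def T1'_def by (simp add: comp_assoc)
  qed
  then show ?thesis
    unfolding tr[OF mh] tr[OF mF] TS1 unfolding S1 det1 by (simp add: T1_def QR indicator_def)
qed

section \<open>The Riemannian volume\<close>

locale riemannian =
  fixes A :: "('m::{t2_space,second_countable_topology}, 'n::finite) chart set"
    and g :: "('m, 'n) tensor2"
  assumes riem: "riemannian_manifold A g"
begin

section \<open>Charts, overlaps and the metric in coordinates\<close>

lemma is_chart: "c \<in> A \<Longrightarrow> is_chart c"
  using riem by (auto simp: riemannian_manifold_def smooth_atlas_def)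

lemma chart_homeo: "c \<in> A \<Longrightarrow> homeomorphism (chart_dom c) (chart_img c) (coords c) (chart_inv c)"
  using is_chart by (auto simp: is_chart_def)

lemma open_dom: "c \<in> A \<Longrightarrow> open (chart_dom c)"
  and open_img: "c \<in> A \<Longrightarrow> open (chart_img c)"
  using is_chart by (auto simp: is_chart_def)

lemma inv_coords: "c \<in> A \<Longrightarrow> p \<in> chart_dom c \<Longrightarrow> chart_inv c (coords c p) = p"
  and coords_inv: "c \<in> A \<Longrightarrow> x \<in> chart_img c \<Longrightarrow> coords c (chart_inv c x) = x"
  and inv_in: "c \<in> A \<Longrightarrow> x \<in> chart_img c \<Longrightarrow> chart_inv c x \<in> chart_dom c"
  and coords_in: "c \<in> A \<Longrightarrow> p \<in> chart_dom c \<Longrightarrow> coords c p \<in> chart_img c"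
  and cont_coords: "c \<in> A \<Longrightarrow> continuous_on (chart_dom c) (coords c)"
  and cont_inv: "c \<in> A \<Longrightarrow> continuous_on (chart_img c) (chart_inv c)"
proof -
  assume "c \<in> A"
  note h = chart_homeo[OF this]
  show "p \<in> chart_dom c \<Longrightarrow> chart_inv c (coords c p) = p" by (rule homeomorphism_apply1[OF h])
  show "x \<in> chart_img c \<Longrightarrow> coords c (chart_inv c x) = x" by (rule homeomorphism_apply2[OF h])
  show "x \<in> chart_img c \<Longrightarrow> chart_inv c x \<in> chart_dom c" using homeomorphism_image2[OF h] by blast
  show "p \<in> chart_dom c \<Longrightarrow> coords c p \<in> chart_img c" unfolding chart_img_def by (rule imageI)
  show "continuous_on (chart_dom c) (coords c)" by (rule homeomorphism_cont1[OF h])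
  show "continuous_on (chart_img c) (chart_inv c)" by (rule homeomorphism_cont2[OF h])
qed

lemma charts_cover: "\<exists>c\<in>A. p \<in> chart_dom c"
  using riem by (auto simp: riemannian_manifold_def smooth_atlas_def)

lemma chart_at: "chart_at A p \<in> A" "p \<in> chart_dom (chart_at A p)"
  using someI_ex[of "\<lambda>c. c \<in> A \<and> p \<in> chart_dom c"] charts_cover[of p] unfolding chart_at_def by blast+

lemma coords_image_eq: "c \<in> A \<Longrightarrow> E \<subseteq> chart_dom c \<Longrightarrow> coords c ` E = {x \<in> chart_img c. chart_inv c x \<in> E}"
proof -
  assume c: "c \<in> A" and E: "E \<subseteq> chart_dom c"
  show ?thesis
  proof (intro set_eqI iffI)
    fix x assume "x \<in> coords c ` E"
    then obtain p where "p \<in> E" "x = coords c p" by blast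
    then show "x \<in> {x \<in> chart_img c. chart_inv c x \<in> E}"
      using inv_coords[OF c, of p] coords_in[OF c, of p] E by auto
  next
    fix x assume "x \<in> {x \<in> chart_img c. chart_inv c x \<in> E}"
    then show "x \<in> coords c ` E" using coords_inv[OF c, of x] by (intro image_eqI[of x _ "chart_inv c x"]) auto
  qed
qed

lemma open_coords_image:
  assumes "c \<in> A" "open U" "U \<subseteq> chart_dom c"
  shows "open (coords c ` U)"
proof -
  have "coords c ` U = chart_img c \<inter> chart_inv c -` U" using coords_image_eq[OF assms(1,3)] by auto
  then show ?thesis using continuous_open_preimage[OF cont_inv open_img assms(2)] assms(1) by simp
qed

lemma open_inv_image:
  assumes "c \<in> A" "open V" "V \<subseteq> chart_img c"
  shows "open (chart_inv c ` V)"
proof -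
  have "chart_inv c ` V = chart_dom c \<inter> coords c -` V"
  proof (intro set_eqI iffI)
    fix p assume "p \<in> chart_inv c ` V"
    then show "p \<in> chart_dom c \<inter> coords c -` V"
      using assms(3) coords_inv[OF assms(1)] inv_in[OF assms(1)] by auto
  next
    fix p assume "p \<in> chart_dom c \<inter> coords c -` V"
    then show "p \<in> chart_inv c ` V"
      using inv_coords[OF assms(1), of p] by (intro image_eqI[of p _ "coords c p"]) auto
  qed
  then show ?thesis using continuous_open_preimage[OF cont_coords open_dom assms(2)] assms(1) by simp
qed

abbreviation overlap :: "('m, 'n) chart \<Rightarrow> ('m, 'n) chart \<Rightarrow> (real^'n) set" where
  "overlap c d \<equiv> coords c ` (chart_dom c \<inter> chart_dom d)"

lemma overlap_open: "c \<in> A \<Longrightarrow> d \<in> A \<Longrightarrow> open (overlap c d)"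
  by (intro open_coords_image) (auto intro: open_dom)

lemma overlap_iff: "c \<in> A \<Longrightarrow> x \<in> overlap c d \<longleftrightarrow> x \<in> chart_img c \<and> chart_inv c x \<in> chart_dom d"
  using coords_image_eq[of c "chart_dom c \<inter> chart_dom d"] inv_in[of c x] by auto

lemma transition_smooth: "c \<in> A \<Longrightarrow> d \<in> A \<Longrightarrow> Ck_on k (overlap c d) (transition c d)"
  using riem by (auto simp: riemannian_manifold_def smooth_atlas_def smooth_on_def)

lemma transition_differentiable:
  "c \<in> A \<Longrightarrow> d \<in> A \<Longrightarrow> x \<in> overlap c d \<Longrightarrow> transition c d differentiable (at x)"
  using transition_smooth[of c d "Suc 0"] by auto

abbreviation jac :: "('m, 'n) chart \<Rightarrow> ('m, 'n) chart \<Rightarrow> real^'n \<Rightarrow> real^'n^'n" where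
  "jac c d x \<equiv> jacobian (transition c d) (at x)"

lemma transition_has_derivative:
  assumes "c \<in> A" "d \<in> A" "x \<in> overlap c d"
  shows "(transition c d has_derivative (\<lambda>h. jac c d x *v h)) (at x)"
  using transition_differentiable[OF assms] jacobian_works by blast

lemma transition_coords: "c \<in> A \<Longrightarrow> p \<in> chart_dom c \<Longrightarrow> transition c d (coords c p) = coords d p"
  by (simp add: transition_def inv_coords)

lemma inv_transition: "c \<in> A \<Longrightarrow> d \<in> A \<Longrightarrow> x \<in> overlap c d \<Longrightarrow> chart_inv d (transition c d x) = chart_inv c x"
  by (auto simp: transition_def inv_coords)

lemma transition_in: "c \<in> A \<Longrightarrow> d \<in> A \<Longrightarrow> x \<in> overlap c d \<Longrightarrow> transition c d x \<in> overlap d c"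
  by (auto simp: transition_def inv_coords)

lemma metric_Ck: "c \<in> A \<Longrightarrow> Ck_on k (chart_img c) (g c)"
  using riem by (auto simp: riemannian_manifold_def riemannian_metric_def smooth_on_def)

lemma metric_entry_Ck: "c \<in> A \<Longrightarrow> Ck_on k (chart_img c) (\<lambda>x. g c x $ i $ j)"
  by (intro Ck_on_nth metric_Ck open_img)

lemma metric_pos_def: "c \<in> A \<Longrightarrow> x \<in> chart_img c \<Longrightarrow> pos_def (g c x)"
  using riem by (auto simp: riemannian_manifold_def riemannian_metric_def pos_def_def)

lemma metric_transform:
  assumes "c \<in> A" "d \<in> A" "p \<in> chart_dom c" "p \<in> chart_dom d"
  shows "g c (coords c p) = transpose (jac c d (coords c p)) ** g d (coords d p) ** jac c d (coords c p)"
proof -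
  have "riemannian_metric A g" using riem by (simp add: riemannian_manifold_def)
  note conjunct2[OF conjunct2[OF this[unfolded riemannian_metric_def Let_def]]]
  from this[rule_format, OF assms(1,2) IntI[OF assms(3,4)]] show ?thesis .
qed

definition vol_density :: "('m, 'n) chart \<Rightarrow> real^'n \<Rightarrow> real" where
  "vol_density c x = sqrt (det (g c x))"

lemma vol_density_pos: "c \<in> A \<Longrightarrow> x \<in> chart_img c \<Longrightarrow> vol_density c x > 0"
  using pos_def_det[OF metric_pos_def] by (simp add: vol_density_def)

lemma vol_density_continuous: "c \<in> A \<Longrightarrow> continuous_on (chart_img c) (vol_density c)"
proof -
  assume c: "c \<in> A"
  show ?thesis unfolding vol_density_def
    by (rule continuous_on_real_sqrt, rule Ck_on_imp_continuous_on[where k = 0],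
        rule Ck_on_det[OF open_img[OF c] metric_entry_Ck[OF c]])
qed

lemma vol_density_transform:
  assumes "c \<in> A" "d \<in> A" "x \<in> overlap c d"
  shows "vol_density c x = \<bar>det (jac c d x)\<bar> * vol_density d (transition c d x)"
proof -
  obtain p where p: "p \<in> chart_dom c" "p \<in> chart_dom d" "x = coords c p" using assms by auto
  have "det (g c x) = (det (jac c d x))^2 * det (g d (transition c d x))"
    using metric_transform[OF assms(1,2) p(1,2)] p transition_coords[OF assms(1) p(1)]
    by (simp add: det_mul det_transpose power2_eq_square)
  then show ?thesis by (simp add: vol_density_def real_sqrt_mult)
qed

text \<open>Outside the chart image \<open>inv_into\<close> chooses from an empty set and so always
  returns the same point; the map is continuous on an open set and constant elsewhere.\<close>

lemma chart_inv_measurable: "c \<in> A \<Longrightarrow> chart_inv c \<in> borel_measurable borel"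
proof -
  assume c: "c \<in> A"
  obtain k where k: "\<And>x. x \<notin> chart_img c \<Longrightarrow> chart_inv c x = k"
  proof
    fix x assume "x \<notin> chart_img c"
    then have "(\<lambda>y. y \<in> chart_dom c \<and> coords c y = x) = (\<lambda>y. False)" by (auto simp: chart_img_def)
    then show "chart_inv c x = (SOME y. False)" by (simp add: chart_inv_def inv_into_def)
  qed
  have "(\<lambda>x. if x \<in> chart_img c then chart_inv c x else k) \<in> borel_measurable borel"
    using open_img[OF c]
    by (subst measurable_If_restrict_space_iff)
      (auto intro: borel_measurable_continuous_on_restrict[OF cont_inv[OF c]])
  moreover have "chart_inv c = (\<lambda>x. if x \<in> chart_img c then chart_inv c x else k)" using k by auto
  ultimately show ?thesis by simp
qed

lemma coords_image_borel:
  assumes "c \<in> A" "E \<in> sets borel" "E \<subseteq> chart_dom c"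
  shows "coords c ` E \<in> sets borel"
proof -
  have "coords c ` E = chart_img c \<inter> (chart_inv c -` E \<inter> space borel)"
    using coords_image_eq[OF assms(1,3)] by auto
  then show ?thesis
    using measurable_sets[OF chart_inv_measurable assms(2)] open_img assms(1) by simp
qed

text \<open>The volume of the chart domain, extended by zero to all Borel sets of the
  manifold.\<close>

definition chart_measure :: "('m, 'n) chart \<Rightarrow> 'm measure" where
  "chart_measure c = distr (density lborel (\<lambda>x. ennreal (indicator (chart_img c) x * vol_density c x)))
     borel (chart_inv c)"

lemma vol_density_measurable:
  "c \<in> A \<Longrightarrow> (\<lambda>x. indicator (chart_img c) x * vol_density c x) \<in> borel_measurable borel"
  using borel_measurable_continuous_on_indicator[OF borel_open[OF open_img] vol_density_continuous, of c]
  by simp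

lemma emeasure_chart_measure:
  assumes "c \<in> A" "E \<in> sets borel"
  shows "emeasure (chart_measure c) E
       = (\<integral>\<^sup>+x\<in>coords c ` (E \<inter> chart_dom c). ennreal (vol_density c x) \<partial>lborel)"
proof -
  have 1: "chart_inv c -` E \<in> sets borel"
    using measurable_sets[OF chart_inv_measurable[OF assms(1)] assms(2)] by simp
  then have "emeasure (chart_measure c) E = (\<integral>\<^sup>+x. ennreal (indicator (chart_img c) x * vol_density c x)
       * indicator (chart_inv c -` E) x \<partial>lborel)"
    using chart_inv_measurable[OF assms(1)] vol_density_measurable[OF assms(1)] assms(2)
    by (simp add: chart_measure_def emeasure_distr emeasure_density)
  also have "\<dots> = (\<integral>\<^sup>+x\<in>coords c ` (E \<inter> chart_dom c). ennreal (vol_density c x) \<partial>lborel)"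
    using coords_image_eq[OF assms(1), of "E \<inter> chart_dom c"] inv_in[OF assms(1)]
    by (intro nn_integral_cong) (auto simp: indicator_def)
  finally show ?thesis .
qed

lemma sets_chart_measure [simp]: "sets (chart_measure c) = sets borel"
  by (simp add: chart_measure_def)

text \<open>Change of variables along the transition map: the absolute value of its Jacobian
  determinant is exactly the ratio of the two densities.\<close>

lemma chart_measure_overlap:
  assumes c: "c \<in> A" and d: "d \<in> A" and E: "E \<in> sets borel" "E \<subseteq> chart_dom c" "E \<subseteq> chart_dom d"
  shows "emeasure (chart_measure c) E = emeasure (chart_measure d) E"
proof -
  let ?S = "coords c ` E" and ?T = "transition c d"
  have sub: "?S \<subseteq> overlap c d" using E by auto
  have TS: "?T ` ?S = coords d ` E"
    unfolding image_image by (rule image_cong[OF refl], rule transition_coords[OF c]) (use E in blast)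
  have mS: "?S \<in> sets borel" "coords d ` E \<in> sets borel" using coords_image_borel E c d by auto
  have mw: "(\<lambda>x. indicator (coords c ` E) x * vol_density c x) \<in> borel_measurable borel"
    if "c \<in> A" "E \<subseteq> chart_dom c" for c
  proof -
    have "(\<lambda>x. indicator (coords c ` E) x * vol_density c x)
       = (\<lambda>x. indicator (coords c ` E) x * (indicator (chart_img c) x * vol_density c x))"
      using that by (auto simp: indicator_def chart_img_def fun_eq_iff)
    then show ?thesis
      using vol_density_measurable[OF that(1)] coords_image_borel[OF that(1) E(1) that(2)] by simp
  qed
  \<comment> \<open>The transition map and its Jacobian are meaningful only on the overlap, so the
    integrands are compared under the indicator; measurability is then inherited from the density of
    c.\<close>
  have eqF: "(\<lambda>x. indicator ?S x * (\<bar>det (matrix (\<lambda>h. jac c d x *v h))\<bar> * vol_density d (?T x)))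
      = (\<lambda>x. indicator ?S x * vol_density c x)"
  proof
    fix x
    show "indicator ?S x * (\<bar>det (matrix (\<lambda>h. jac c d x *v h))\<bar> * vol_density d (?T x))
      = indicator ?S x * vol_density c x"
      using sub vol_density_transform[OF c d, of x] by (cases "x \<in> ?S") auto
  qed
  have "(\<integral>\<^sup>+y. ennreal (indicator (?T ` ?S) y * vol_density d y) \<partial>lborel)
      = (\<integral>\<^sup>+x. ennreal (indicator ?S x * (\<bar>det (matrix (\<lambda>h. jac c d x *v h))\<bar> * vol_density d (?T x))) \<partial>lborel)"
  proof (rule nn_integral_change_of_variables[OF mS(1)])
    show "(?T has_derivative (\<lambda>h. jac c d x *v h)) (at x within ?S)" if "x \<in> ?S" for x
      using transition_has_derivative[OF c d] sub that by (blast intro: has_derivative_at_withinI)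
    show "inj_on ?T ?S"
    proof (rule inj_onI)
      fix x y assume "x \<in> ?S" "y \<in> ?S" "?T x = ?T y"
      then have "chart_inv c x = chart_inv c y"
        using inv_transition[OF c d subsetD[OF sub \<open>x \<in> ?S\<close>]]
          inv_transition[OF c d subsetD[OF sub \<open>y \<in> ?S\<close>]] by simp
      moreover have "x \<in> chart_img c" "y \<in> chart_img c"
        using \<open>x \<in> ?S\<close> \<open>y \<in> ?S\<close> E(2) unfolding chart_img_def by blast+
      ultimately show "x = y" using coords_inv[OF c] by metis
    qed
    show "0 \<le> vol_density d y" if "y \<in> ?T ` ?S" for y
    proof -
      have "y \<in> chart_img d" using that E(3) unfolding TS chart_img_def by blast
      then show ?thesis using vol_density_pos[OF d] by (simp add: less_imp_le)
    qed
    show "(\<lambda>y. indicator (?T ` ?S) y * vol_density d y) \<in> borel_measurable borel"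
      unfolding TS by (rule mw[OF d E(3)])
    show "(\<lambda>x. indicator ?S x * (\<bar>det (matrix (\<lambda>h. jac c d x *v h))\<bar> * vol_density d (?T x))) \<in> borel_measurable borel"
      unfolding eqF by (rule mw[OF c E(2)])
  qed
  then have "(\<integral>\<^sup>+y. ennreal (indicator (coords d ` E) y * vol_density d y) \<partial>lborel)
      = (\<integral>\<^sup>+x. ennreal (indicator ?S x * vol_density c x) \<partial>lborel)"
    unfolding TS fun_cong[OF eqF] .
  moreover have "(\<integral>\<^sup>+y\<in>S. ennreal (f y) \<partial>lborel) = (\<integral>\<^sup>+y. ennreal (indicator S y * f y) \<partial>lborel)"
    for S and f :: "real^'n \<Rightarrow> real"
    by (intro nn_integral_cong) (auto simp: indicator_def)
  ultimately show ?thesis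
    using emeasure_chart_measure[OF c E(1)] emeasure_chart_measure[OF d E(1)] E by (simp add: Int_absorb2)
qed

text \<open>Second countability gives a countable subcover by chart domains, and successive
  differences make it disjoint while the pieces remain Borel.\<close>

lemma countable_disjoint_charts:
  obtains cs :: "nat \<Rightarrow> ('m, 'n) chart" and U :: "nat \<Rightarrow> 'm set"
  where "\<And>n. cs n \<in> A" "\<And>n. U n \<in> sets borel" "\<And>n. U n \<subseteq> chart_dom (cs n)"
    "disjoint_family U" "(\<Union>n. U n) = UNIV"
proof -
  obtain F where F: "F \<subseteq> chart_dom ` A" "countable F" "\<Union>F = \<Union>(chart_dom ` A)"
    using Lindelof[of "chart_dom ` A"] open_dom by (metis (no_types, lifting) imageE)
  have UF: "\<Union>F = UNIV" using F(3) charts_cover by auto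
  then have ne: "F \<noteq> {}" by auto
  define V where "V = from_nat_into F"
  have V: "range V = F" unfolding V_def using ne F(2) by (rule range_from_nat_into)
  have "\<forall>n. \<exists>c\<in>A. V n = chart_dom c" using F(1) V by blast
  then obtain cs where cs: "\<And>n. cs n \<in> A" "\<And>n. V n = chart_dom (cs n)" by metis
  show thesis
  proof (rule that[of cs "disjointed V"])
    show "disjointed V n \<in> sets borel" for n
      unfolding disjointed_def cs(2) using open_dom[OF cs(1)] by (intro sets.Diff sets.finite_UN borel_open) auto
    show "disjointed V n \<subseteq> chart_dom (cs n)" for n using disjointed_subset[of V n] cs by simp
    show "(\<Union>n. disjointed V n) = UNIV" unfolding UN_disjointed_eq using V UF by simp
  qed (use cs in \<open>auto simp: disjoint_family_disjointed\<close>)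
qed

text \<open>\<open>THE\<close> gives nothing before existence and uniqueness are known. The chart
  measures are glued over a countable Borel partition subordinate to the charts; they agree on
  overlaps, and the same partition shows that any other solution takes the same values.\<close>

lemma riemannian_volume:
  shows sets_volume: "sets (riemannian_volume A g) = sets borel"
    and emeasure_volume: "\<And>c E. c \<in> A \<Longrightarrow> E \<in> sets borel \<Longrightarrow> E \<subseteq> chart_dom c \<Longrightarrow>
      emeasure (riemannian_volume A g) E = emeasure (chart_measure c) E"
proof -
  define P where "P \<mu> \<longleftrightarrow> sets \<mu> = sets borel \<and>
     (\<forall>c\<in>A. \<forall>E\<in>sets borel. E \<subseteq> chart_dom c \<longrightarrow>
        emeasure \<mu> E = (\<integral>\<^sup>+ x\<in>coords c ` E. ennreal (sqrt (det (g c x))) \<partial>lborel))" for \<mu>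
  have P: "P \<mu> \<longleftrightarrow> sets \<mu> = sets borel \<and>
     (\<forall>c\<in>A. \<forall>E\<in>sets borel. E \<subseteq> chart_dom c \<longrightarrow> emeasure \<mu> E = emeasure (chart_measure c) E)" for \<mu>
    unfolding P_def using emeasure_chart_measure by (auto simp: vol_density_def Int_absorb2)
  obtain cs :: "nat \<Rightarrow> ('m, 'n) chart" and U :: "nat \<Rightarrow> 'm set"
    where cs: "\<And>n. cs n \<in> A" and U: "\<And>n. U n \<in> sets borel" "\<And>n. U n \<subseteq> chart_dom (cs n)"
      "disjoint_family U" "(\<Union>n. U n) = UNIV"
    using countable_disjoint_charts by metis
  have split: "emeasure \<mu> E = (\<Sum>n. emeasure \<mu> (E \<inter> U n))" if "sets \<mu> = sets borel" "E \<in> sets borel" for \<mu> E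
  proof -
    have "(\<Sum>n. emeasure \<mu> (E \<inter> U n)) = emeasure \<mu> (\<Union>n. E \<inter> U n)"
      by (intro suminf_emeasure disjoint_family_on_bisimulation[OF U(3)]) (use that U(1) in auto)
    moreover have "(\<Union>n. E \<inter> U n) = E" using U(4) by auto
    ultimately show ?thesis by simp
  qed
  define F where "F E = (\<Sum>n. emeasure (chart_measure (cs n)) (E \<inter> U n))" for E
  define M where "M = measure_of UNIV (sets (borel :: 'm measure)) F"
  have setsM: "sets M = sets borel"
    unfolding M_def using sets.sigma_sets_eq[of "borel :: 'm measure"] by simp
  have M: "emeasure M E = F E" if "E \<in> sets borel" for E
  proof (rule emeasure_measure_of[OF M_def])
    show "positive (sets M) F" by (simp add: positive_def F_def)
    show "countably_additive (sets M) F"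
    proof (rule countably_additiveI)
      fix B :: "nat \<Rightarrow> 'm set" assume B: "range B \<subseteq> sets M" "disjoint_family B" "\<Union> (range B) \<in> sets M"
      \<comment> \<open>The two series are exchanged as nonnegative integrals over counting
        measure.\<close>
      have "(\<Sum>i. F (B i)) = (\<Sum>i. \<Sum>n. emeasure (chart_measure (cs n)) (B i \<inter> U n))" by (simp add: F_def)
      also have "\<dots> = (\<integral>\<^sup>+i. (\<Sum>n. emeasure (chart_measure (cs n)) (B i \<inter> U n)) \<partial>count_space UNIV)"
        by (simp add: nn_integral_count_space_nat)
      also have "\<dots> = (\<Sum>n. \<integral>\<^sup>+i. emeasure (chart_measure (cs n)) (B i \<inter> U n) \<partial>count_space UNIV)"
        by (rule nn_integral_suminf) auto
      also have "\<dots> = (\<Sum>n. \<Sum>i. emeasure (chart_measure (cs n)) (B i \<inter> U n))"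
        by (simp add: nn_integral_count_space_nat)
      also have "\<dots> = (\<Sum>n. emeasure (chart_measure (cs n)) (\<Union>i. B i \<inter> U n))"
        using B U(1) setsM
        by (intro suminf_cong suminf_emeasure disjoint_family_on_bisimulation[OF B(2)]) auto
      also have "\<dots> = F (\<Union> (range B))" unfolding F_def by (simp add: Int_UN_distrib2)
      finally show "(\<Sum>i. F (B i)) = F (\<Union> (range B))" .
    qed
  qed (use that setsM in auto)
  have "P M" unfolding P
  proof (intro conjI ballI impI)
    fix d E assume d: "d \<in> A" "E \<in> sets borel" "E \<subseteq> chart_dom d"
    have "emeasure M E = (\<Sum>n. emeasure (chart_measure d) (E \<inter> U n))"
      unfolding M[OF d(2)] F_def
    proof (rule suminf_cong)
      show "emeasure (chart_measure (cs n)) (E \<inter> U n) = emeasure (chart_measure d) (E \<inter> U n)" for n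
        using d U(1,2)[of n] by (intro chart_measure_overlap cs) auto
    qed
    also have "\<dots> = emeasure (chart_measure d) E" using split[of "chart_measure d" E] d by simp
    finally show "emeasure M E = emeasure (chart_measure d) E" .
  qed (rule setsM)
  moreover have uniq: "\<nu> = M" if "P \<nu>" for \<nu>
  proof (rule measure_eqI)
    show "sets \<nu> = sets M" using that \<open>P M\<close> by (simp add: P)
    fix E assume "E \<in> sets \<nu>"
    then have E: "E \<in> sets borel" using that by (simp add: P)
    have "emeasure \<nu> E = (\<Sum>n. emeasure \<nu> (E \<inter> U n))" using split that E by (simp add: P)
    also have "\<dots> = (\<Sum>n. emeasure M (E \<inter> U n))"
    proof (rule suminf_cong)
      fix n
      have "E \<inter> U n \<in> sets borel" "E \<inter> U n \<subseteq> chart_dom (cs n)" using E U by auto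
      then show "emeasure \<nu> (E \<inter> U n) = emeasure M (E \<inter> U n)"
        using that \<open>P M\<close> cs[of n] unfolding P by metis
    qed
    also have "\<dots> = emeasure M E" using split[OF setsM E] by simp
    finally show "emeasure \<nu> E = emeasure M E" .
  qed
  ultimately have "P (THE \<mu>. P \<mu>)" by (rule theI[of P M])
  moreover have "riemannian_volume A g = (THE \<mu>. P \<mu>)" unfolding riemannian_volume_def P_def ..
  ultimately have "P (riemannian_volume A g)" by simp
  then show "sets (riemannian_volume A g) = sets borel"
    "\<And>c E. c \<in> A \<Longrightarrow> E \<in> sets borel \<Longrightarrow> E \<subseteq> chart_dom c \<Longrightarrow>
      emeasure (riemannian_volume A g) E = emeasure (chart_measure c) E"
    unfolding P by blast+
qed

text \<open>Restriction to a chart domain is written as a density because integrals against a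
  density and against a push-forward can both be transformed; together they bring integrals over the
  manifold into coordinate space.\<close>

lemma density_volume_chart:
  assumes c: "c \<in> A"
  shows "density (riemannian_volume A g) (\<lambda>p. ennreal (indicator (chart_dom c) p)) = chart_measure c"
proof (rule measure_eqI)
  show "sets (density (riemannian_volume A g) (\<lambda>p. ennreal (indicator (chart_dom c) p))) = sets (chart_measure c)"
    by (simp add: sets_volume)
  fix E assume "E \<in> sets (density (riemannian_volume A g) (\<lambda>p. ennreal (indicator (chart_dom c) p)))"
  then have E: "E \<in> sets borel" by (simp add: sets_volume)
  have m: "chart_dom c \<in> sets (riemannian_volume A g)" "E \<in> sets (riemannian_volume A g)"
    using open_dom[OF c] E by (auto simp: sets_volume)
  have "emeasure (density (riemannian_volume A g) (\<lambda>p. ennreal (indicator (chart_dom c) p))) E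
     = (\<integral>\<^sup>+p. ennreal (indicator (chart_dom c) p) * indicator E p \<partial>riemannian_volume A g)"
    using m by (subst emeasure_density) auto
  also have "\<dots> = (\<integral>\<^sup>+p. indicator (E \<inter> chart_dom c) p \<partial>riemannian_volume A g)"
    by (intro nn_integral_cong) (auto simp: indicator_def)
  also have "\<dots> = emeasure (riemannian_volume A g) (E \<inter> chart_dom c)" using m by (intro nn_integral_indicator) auto
  also have "\<dots> = emeasure (chart_measure c) (E \<inter> chart_dom c)"
    using E open_dom[OF c] by (intro emeasure_volume[OF c]) auto
  also have "\<dots> = emeasure (chart_measure c) E"
    using emeasure_chart_measure[OF c, of "E \<inter> chart_dom c"] emeasure_chart_measure[OF c E] E open_dom[OF c]
    by (simp add: Int_assoc)
  finally show "emeasure (density (riemannian_volume A g) (\<lambda>p. ennreal (indicator (chart_dom c) p))) E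
     = emeasure (chart_measure c) E" .
qed

lemma borel_measurable_volume: "borel_measurable (riemannian_volume A g) = borel_measurable borel"
  by (rule measurable_cong_sets[OF sets_volume refl])

lemma volume_integral_chart:
  fixes f :: "'m \<Rightarrow> real"
  assumes c: "c \<in> A" and f: "f \<in> borel_measurable borel"
  shows "integrable (riemannian_volume A g) (\<lambda>p. indicator (chart_dom c) p * f p) \<longleftrightarrow>
      integrable lborel (\<lambda>x. indicator (chart_img c) x * vol_density c x * f (chart_inv c x))"
    and "(\<integral>p. indicator (chart_dom c) p * f p \<partial>riemannian_volume A g)
      = (\<integral>x. indicator (chart_img c) x * vol_density c x * f (chart_inv c x) \<partial>lborel)"
proof -
  have m: "chart_dom c \<in> sets (riemannian_volume A g)" using open_dom[OF c] by (auto simp: sets_volume)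
  have f': "f \<in> borel_measurable (riemannian_volume A g)" unfolding borel_measurable_volume by (rule f)
  have fi: "(\<lambda>x. f (chart_inv c x)) \<in> borel_measurable borel"
    using measurable_compose[OF chart_inv_measurable[OF c] f] .
  have nn: "AE x in lborel. 0 \<le> indicator (chart_img c) x * vol_density c x"
    by (rule AE_I2) (use vol_density_pos[OF c] in \<open>simp add: indicator_def less_imp_le\<close>)
  note dv = density_volume_chart[OF c, unfolded chart_measure_def]
  have "integrable (riemannian_volume A g) (\<lambda>p. indicator (chart_dom c) p * f p)
     \<longleftrightarrow> integrable (density (riemannian_volume A g) (\<lambda>p. ennreal (indicator (chart_dom c) p))) f"
    using m f' by (subst integrable_density) auto
  also have "\<dots> \<longleftrightarrow> integrable lborel (\<lambda>x. indicator (chart_img c) x * vol_density c x * f (chart_inv c x))"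
    unfolding dv using chart_inv_measurable[OF c] f fi nn vol_density_measurable[OF c]
    by (simp add: integrable_distr_eq integrable_density)
  finally show "integrable (riemannian_volume A g) (\<lambda>p. indicator (chart_dom c) p * f p) \<longleftrightarrow>
      integrable lborel (\<lambda>x. indicator (chart_img c) x * vol_density c x * f (chart_inv c x))" .
  have "(\<integral>p. indicator (chart_dom c) p * f p \<partial>riemannian_volume A g)
     = (\<integral>p. f p \<partial>density (riemannian_volume A g) (\<lambda>p. ennreal (indicator (chart_dom c) p)))"
    using m f' by (subst integral_density) auto
  also have "\<dots> = (\<integral>x. indicator (chart_img c) x * vol_density c x * f (chart_inv c x) \<partial>lborel)"
    unfolding dv using chart_inv_measurable[OF c] f fi nn vol_density_measurable[OF c]
    by (simp add: integral_distr integral_density)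
  finally show "(\<integral>p. indicator (chart_dom c) p * f p \<partial>riemannian_volume A g)
      = (\<integral>x. indicator (chart_img c) x * vol_density c x * f (chart_inv c x) \<partial>lborel)" .
qed

end

section \<open>Curves and the Riemannian distance\<close>

lemma vector_derivative_eventually_cong:
  assumes "eventually (\<lambda>s. f s = h s) (nhds t)"
  shows "vector_derivative f (at t) = vector_derivative h (at t)"
proof -
  have "f t = h t" using eventually_nhds_x_imp_x[OF assms] .
  moreover have "eventually (\<lambda>s. f s = h s) (at t)" using assms by (simp add: eventually_nhds_conv_at)
  ultimately have "(f has_vector_derivative D) (at t) \<longleftrightarrow> (h has_vector_derivative D) (at t)" for D
    unfolding has_vector_derivative_def
    using has_derivative_transform_eventually[of f _ t UNIV h] has_derivative_transform_eventually[of h _ t UNIV f]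
    by (auto simp: eq_commute)
  then show ?thesis by (simp add: vector_derivative_def)
qed

lemma C1_curve_on_cong:
  assumes "C1_curve_on A a b \<gamma>" "\<And>t. t \<in> {a..b} \<Longrightarrow> \<gamma>' t = \<gamma> t"
  shows "C1_curve_on A a b \<gamma>'"
  unfolding C1_curve_on_def
proof (intro conjI ballI)
  show "continuous_on {a..b} \<gamma>'"
    using assms continuous_on_cong[OF refl, of "{a..b}" \<gamma>' \<gamma>] by (simp add: C1_curve_on_def)
  fix c assume "c \<in> A"
  then obtain D where D: "continuous_on {t\<in>{a..b}. \<gamma> t \<in> chart_dom c} D"
    "\<And>t. t\<in>{a..b} \<Longrightarrow> \<gamma> t \<in> chart_dom c \<Longrightarrow> ((coords c \<circ> \<gamma>) has_vector_derivative D t) (at t within {a..b})"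
    using assms(1) unfolding C1_curve_on_def by blast
  have "{t\<in>{a..b}. \<gamma>' t \<in> chart_dom c} = {t\<in>{a..b}. \<gamma> t \<in> chart_dom c}" using assms(2) by auto
  moreover have "((coords c \<circ> \<gamma>') has_vector_derivative D t) (at t within {a..b})"
    if "t \<in> {a..b}" "\<gamma>' t \<in> chart_dom c" for t
    by (rule has_vector_derivative_transform[OF that(1) _ D(2)]) (use that assms(2) in auto)
  ultimately show "\<exists>D. continuous_on {t\<in>{a..b}. \<gamma>' t \<in> chart_dom c} D \<and>
        (\<forall>t\<in>{a..b}. \<gamma>' t \<in> chart_dom c \<longrightarrow> ((coords c \<circ> \<gamma>') has_vector_derivative D t) (at t within {a..b}))"
    using D(1) by (intro exI[of _ D]) simp
qed

text \<open>One lemma for restriction, translation and reversal of curves; the slope \<beta> may be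
  negative.\<close>

lemma C1_curve_on_affine:
  assumes "C1_curve_on A a b \<gamma>" "(\<lambda>s. \<alpha> + \<beta> * s) ` {a'..b'} \<subseteq> {a..b}"
  shows "C1_curve_on A a' b' (\<lambda>s. \<gamma> (\<alpha> + \<beta> * s))"
  unfolding C1_curve_on_def
proof (intro conjI ballI)
  let ?h = "\<lambda>s. \<alpha> + \<beta> * s"
  have hc: "continuous_on S ?h" for S by (intro continuous_intros)
  show "continuous_on {a'..b'} (\<lambda>s. \<gamma> (?h s))"
    using assms by (intro continuous_on_compose2[OF _ hc]) (auto simp: C1_curve_on_def)
  fix c assume "c \<in> A"
  then obtain D where D: "continuous_on {t\<in>{a..b}. \<gamma> t \<in> chart_dom c} D"
    "\<And>t. t\<in>{a..b} \<Longrightarrow> \<gamma> t \<in> chart_dom c \<Longrightarrow> ((coords c \<circ> \<gamma>) has_vector_derivative D t) (at t within {a..b})"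
    using assms(1) unfolding C1_curve_on_def by blast
  have "continuous_on {t\<in>{a'..b'}. \<gamma> (?h t) \<in> chart_dom c} (\<lambda>s. \<beta> *\<^sub>R D (?h s))"
    using assms(2) by (intro continuous_intros continuous_on_compose2[OF D(1)]) (auto simp: image_subset_iff)
  moreover have "((coords c \<circ> (\<lambda>s. \<gamma> (?h s))) has_vector_derivative \<beta> *\<^sub>R D (?h t)) (at t within {a'..b'})"
    if "t \<in> {a'..b'}" "\<gamma> (?h t) \<in> chart_dom c" for t
  proof -
    have ht: "?h t \<in> {a..b}" using that(1) assms(2) unfolding image_subset_iff by blast
    have "(?h has_vector_derivative \<beta>) (at t within {a'..b'})"
      by (auto intro!: derivative_eq_intros simp: has_real_derivative_iff_has_vector_derivative[symmetric])
    moreover have "((coords c \<circ> \<gamma>) has_vector_derivative D (?h t)) (at (?h t) within ?h ` {a'..b'})"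
      using that ht assms(2) by (intro has_vector_derivative_within_subset[OF D(2)]) auto
    ultimately have "((coords c \<circ> \<gamma>) \<circ> ?h has_vector_derivative \<beta> *\<^sub>R D (?h t)) (at t within {a'..b'})"
      by (rule vector_diff_chain_within)
    then show ?thesis by (simp add: o_def)
  qed
  ultimately show "\<exists>D. continuous_on {t\<in>{a'..b'}. \<gamma> (?h t) \<in> chart_dom c} D \<and>
        (\<forall>t\<in>{a'..b'}. \<gamma> (?h t) \<in> chart_dom c \<longrightarrow>
           ((coords c \<circ> (\<lambda>s. \<gamma> (?h s))) has_vector_derivative D t) (at t within {a'..b'}))"
    by (intro exI[of _ "\<lambda>s. \<beta> *\<^sub>R D (?h s)"]) blast
qed

text \<open>Arbitrary parameter intervals allow curves to be cut and joined without rescaling to the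
  unit interval.\<close>

definition pw_C1 :: "('m::topological_space, 'n::finite) chart set \<Rightarrow> real \<Rightarrow> real \<Rightarrow> (real \<Rightarrow> 'm) \<Rightarrow> bool" where
  "pw_C1 A a b \<gamma> \<longleftrightarrow> (\<exists>P. finite P \<and>
     (\<forall>a' b'. a \<le> a' \<and> a' < b' \<and> b' \<le> b \<and> {a'<..<b'} \<inter> P = {} \<longrightarrow> C1_curve_on A a' b' \<gamma>))"

lemma piecewise_C1_curve_iff: "piecewise_C1_curve A \<gamma> \<longleftrightarrow> pw_C1 A 0 1 \<gamma>"
  by (simp add: piecewise_C1_curve_def pw_C1_def)

lemma pw_C1_cong:
  assumes "pw_C1 A a b \<gamma>" "\<And>t. t \<in> {a..b} \<Longrightarrow> \<gamma>' t = \<gamma> t"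
  shows "pw_C1 A a b \<gamma>'"
proof -
  obtain P where "finite P"
    "\<And>a' b'. a \<le> a' \<Longrightarrow> a' < b' \<Longrightarrow> b' \<le> b \<Longrightarrow> {a'<..<b'} \<inter> P = {} \<Longrightarrow> C1_curve_on A a' b' \<gamma>"
    using assms(1) unfolding pw_C1_def by blast
  moreover have "C1_curve_on A a' b' \<gamma>'" if "C1_curve_on A a' b' \<gamma>" "a \<le> a'" "b' \<le> b" for a' b'
    using assms(2) that by (intro C1_curve_on_cong[OF that(1)]) auto
  ultimately show ?thesis unfolding pw_C1_def by blast
qed

lemma pw_C1_sub: "pw_C1 A a b \<gamma> \<Longrightarrow> a \<le> a' \<Longrightarrow> b' \<le> b \<Longrightarrow> pw_C1 A a' b' \<gamma>"
  unfolding pw_C1_def by (meson order_trans)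

lemma pw_C1_glue:
  assumes "pw_C1 A a b \<gamma>" "pw_C1 A b c \<gamma>"
  shows "pw_C1 A a c \<gamma>"
proof -
  obtain P Q where P: "finite P"
    "\<And>a' b'. a \<le> a' \<Longrightarrow> a' < b' \<Longrightarrow> b' \<le> b \<Longrightarrow> {a'<..<b'} \<inter> P = {} \<Longrightarrow> C1_curve_on A a' b' \<gamma>"
    and Q: "finite Q"
    "\<And>a' b'. b \<le> a' \<Longrightarrow> a' < b' \<Longrightarrow> b' \<le> c \<Longrightarrow> {a'<..<b'} \<inter> Q = {} \<Longrightarrow> C1_curve_on A a' b' \<gamma>"
    using assms unfolding pw_C1_def by metis
  show ?thesis unfolding pw_C1_def
  proof (intro exI[of _ "insert b (P \<union> Q)"] conjI allI impI)
    show "finite (insert b (P \<union> Q))" using P Q by simp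
    fix a' b' assume *: "a \<le> a' \<and> a' < b' \<and> b' \<le> c \<and> {a'<..<b'} \<inter> insert b (P \<union> Q) = {}"
    then have "b \<notin> {a'<..<b'}" by blast
    then have "b' \<le> b \<or> b \<le> a'" by auto
    then show "C1_curve_on A a' b' \<gamma>" using P(2) Q(2) * by blast
  qed
qed

text \<open>Class C^1 on closed pieces gives one-sided continuity at the break points, so the pieces
  can be glued; the induction is on the number of break points inside the interval.\<close>

lemma pw_C1_continuous:
  assumes "pw_C1 A a b \<gamma>"
  shows "continuous_on {a..b} \<gamma>"
proof -
  obtain P where "finite P"
    "\<And>a' b'. a \<le> a' \<Longrightarrow> a' < b' \<Longrightarrow> b' \<le> b \<Longrightarrow> {a'<..<b'} \<inter> P = {} \<Longrightarrow> C1_curve_on A a' b' \<gamma>"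
    using assms unfolding pw_C1_def by blast
  then show ?thesis
  proof (induction "card ({a<..<b} \<inter> P)" arbitrary: a b rule: less_induct)
    case less
    show ?case
    proof (cases "{a<..<b} \<inter> P = {}")
      case True
      show ?thesis
      proof (cases "a < b")
        case True
        then have "C1_curve_on A a b \<gamma>" using less.prems(2)[of a b] \<open>{a<..<b} \<inter> P = {}\<close> by simp
        then show ?thesis by (simp add: C1_curve_on_def)
      next
        case False
        then have "{a..b} = {} \<or> {a..b} = {a}" by auto
        then show ?thesis by auto
      qed
    next
      case False
      then obtain p where p: "p \<in> {a<..<b}" "p \<in> P" by blast
      have fin: "finite ({a<..<b} \<inter> P)" using less.prems(1) by simp
      have "{a<..<p} \<inter> P \<subset> {a<..<b} \<inter> P" "{p<..<b} \<inter> P \<subset> {a<..<b} \<inter> P" using p by auto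
      then have "card ({a<..<p} \<inter> P) < card ({a<..<b} \<inter> P)" "card ({p<..<b} \<inter> P) < card ({a<..<b} \<inter> P)"
        using psubset_card_mono[OF fin] by auto
      then have "continuous_on {a..p} \<gamma>" "continuous_on {p..b} \<gamma>"
        using p less.prems(2) by (auto intro!: less.hyps less.prems(1))
      then have "continuous_on ({a..p} \<union> {p..b}) \<gamma>" by (intro continuous_on_closed_Un) auto
      moreover have "{a..p} \<union> {p..b} = {a..b}" using p by auto
      ultimately show ?thesis by simp
    qed
  qed
qed

lemma pw_C1_affine:
  assumes "pw_C1 A a b \<gamma>" "\<beta> \<noteq> 0" "(\<lambda>s. \<alpha> + \<beta> * s) ` {a'..b'} \<subseteq> {a..b}"
  shows "pw_C1 A a' b' (\<lambda>s. \<gamma> (\<alpha> + \<beta> * s))"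
proof -
  let ?h = "\<lambda>s. \<alpha> + \<beta> * s"
  obtain P where P: "finite P"
    "\<And>a' b'. a \<le> a' \<Longrightarrow> a' < b' \<Longrightarrow> b' \<le> b \<Longrightarrow> {a'<..<b'} \<inter> P = {} \<Longrightarrow> C1_curve_on A a' b' \<gamma>"
    using assms(1) unfolding pw_C1_def by blast
  have inj: "inj ?h" using assms(2) by (simp add: inj_on_def)
  show ?thesis unfolding pw_C1_def
  proof (intro exI[of _ "?h -` P"] conjI allI impI)
    show "finite (?h -` P)" using P(1) inj by (rule finite_vimageI)
    fix u v assume uv: "a' \<le> u \<and> u < v \<and> v \<le> b' \<and> {u<..<v} \<inter> ?h -` P = {}"
    \<comment> \<open>The order of the two endpoint images is not known, since \<beta> may be
      negative.\<close>
    define l where "l = min (?h u) (?h v)"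
    define r where "r = max (?h u) (?h v)"
    have hu: "?h u \<in> {a..b}" "?h v \<in> {a..b}" using assms(3) uv unfolding image_subset_iff by auto
    have lr: "l < r" using uv assms(2) by (auto simp: l_def r_def min_def max_def not_le)
    have img: "?h ` {u..v} \<subseteq> {l..r}"
      by (cases "\<beta> > 0") (auto simp: l_def r_def min_le_iff_disj le_max_iff_disj mult_left_mono mult_left_mono_neg)
    have "{l<..<r} \<subseteq> ?h ` {u<..<v}"
    proof
      fix z assume z: "z \<in> {l<..<r}"
      have e: "?h ((z - \<alpha>) / \<beta>) = z" using assms(2) by simp
      have "u < (z - \<alpha>) / \<beta> \<and> (z - \<alpha>) / \<beta> < v"
      proof (cases "\<beta> > 0")
        case True
        then have "?h u < ?h v" using uv by simp
        then have "?h u < z" "z < ?h v" using z by (auto simp: l_def r_def)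
        then show ?thesis using True by (simp add: pos_less_divide_eq pos_divide_less_eq mult.commute)
      next
        case False
        then have b: "\<beta> < 0" using assms(2) by simp
        then have "?h v < ?h u" using uv by simp
        then have "?h v < z" "z < ?h u" using z by (auto simp: l_def r_def)
        then show ?thesis using b by (simp add: neg_less_divide_eq neg_divide_less_eq mult.commute)
      qed
      then show "z \<in> ?h ` {u<..<v}" using e by (intro image_eqI[of z _ "(z - \<alpha>) / \<beta>"]) auto
    qed
    then have "{l<..<r} \<inter> P = {}" using uv by auto
    then have "C1_curve_on A l r \<gamma>" using hu lr by (intro P(2)) (auto simp: l_def r_def)
    then show "C1_curve_on A u v (\<lambda>s. \<gamma> (?h s))" using img by (rule C1_curve_on_affine)
  qed
qed

context riemannian
begin

lemma curve_speed_nonneg: "0 \<le> curve_speed A g \<gamma> t"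
  unfolding curve_speed_def Let_def
  by (intro real_sqrt_ge_zero pos_def_nonneg metric_pos_def chart_at coords_in)

lemma curve_speed_cong:
  assumes "eventually (\<lambda>s. \<gamma> s = \<gamma>' s) (nhds t)"
  shows "curve_speed A g \<gamma> t = curve_speed A g \<gamma>' t"
proof -
  have "\<gamma> t = \<gamma>' t" using eventually_nhds_x_imp_x[OF assms] .
  moreover have "vector_derivative (coords c \<circ> \<gamma>) (at t) = vector_derivative (coords c \<circ> \<gamma>') (at t)" for c :: "('m, 'n) chart"
    using assms by (intro vector_derivative_eventually_cong) (auto elim: eventually_mono)
  ultimately show ?thesis by (simp add: curve_speed_def Let_def)
qed

lemma coords_change_derivative:
  assumes c: "c \<in> A" and d: "d \<in> A" and t: "\<gamma> t \<in> chart_dom c" "\<gamma> t \<in> chart_dom d"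
    and cont: "isCont \<gamma> t" and v: "((coords c \<circ> \<gamma>) has_vector_derivative v) (at t)"
  shows "((coords d \<circ> \<gamma>) has_vector_derivative (jac c d (coords c (\<gamma> t)) *v v)) (at t)"
proof -
  let ?x = "coords c (\<gamma> t)"
  have "?x \<in> overlap c d" using t by blast
  from transition_has_derivative[OF c d this]
  have "((transition c d \<circ> (coords c \<circ> \<gamma>)) has_derivative ((\<lambda>h. jac c d ?x *v h) \<circ> (\<lambda>h. h *\<^sub>R v))) (at t)"
    using v unfolding has_vector_derivative_def by (intro diff_chain_at) auto
  then have "((transition c d \<circ> (coords c \<circ> \<gamma>)) has_derivative (\<lambda>h. h *\<^sub>R (jac c d ?x *v v))) (at t)"
    by (simp add: o_def matrix_vector_mult_scaleR)
  moreover have "eventually (\<lambda>s. \<gamma> s \<in> chart_dom c) (at t)"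
    using topological_tendstoD[OF cont[unfolded isCont_def] open_dom[OF c] t(1)] .
  then have "eventually (\<lambda>s. (transition c d \<circ> (coords c \<circ> \<gamma>)) s = (coords d \<circ> \<gamma>) s) (at t)"
    by (rule eventually_mono) (simp add: transition_coords[OF c])
  ultimately show ?thesis
    unfolding has_vector_derivative_def
    using has_derivative_transform_eventually[of "transition c d \<circ> (coords c \<circ> \<gamma>)" _ t UNIV "coords d \<circ> \<gamma>"]
      transition_coords[OF c t(1)] by simp
qed

lemma norm_metric_transform:
  assumes "c \<in> A" "d \<in> A" "p \<in> chart_dom c" "p \<in> chart_dom d"
  shows "(jac c d (coords c p) *v u) \<bullet> (g d (coords d p) *v (jac c d (coords c p) *v v))
       = u \<bullet> (g c (coords c p) *v v)"
  unfolding metric_transform[OF assms] inner_matrix_transpose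
  by (simp add: matrix_vector_mul_assoc matrix_mul_assoc)

text \<open>The speed is defined in a chart chosen at each point; the velocity and the metric
  transform so that every chart containing the point gives the same value.\<close>

lemma curve_speed_chart:
  assumes c: "c \<in> A" and t: "\<gamma> t \<in> chart_dom c"
    and cont: "isCont \<gamma> t" and v: "((coords c \<circ> \<gamma>) has_vector_derivative v) (at t)"
  shows "curve_speed A g \<gamma> t = sqrt (v \<bullet> (g c (coords c (\<gamma> t)) *v v))"
proof -
  let ?d = "chart_at A (\<gamma> t)"
  note d = chart_at[of "\<gamma> t"]
  have "vector_derivative (coords ?d \<circ> \<gamma>) (at t) = jac c ?d (coords c (\<gamma> t)) *v v"
    by (rule vector_derivative_at[OF coords_change_derivative[OF c d(1) t d(2) cont v]])
  then show ?thesis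
    using norm_metric_transform[OF c d(1) t d(2)] by (simp add: curve_speed_def Let_def)
qed

lemma C1_curve_interior:
  assumes "C1_curve_on A a b \<gamma>" "t \<in> {a<..<b}"
  shows "isCont \<gamma> t"
    and "c \<in> A \<Longrightarrow> \<gamma> t \<in> chart_dom c \<Longrightarrow> \<exists>D. ((coords c \<circ> \<gamma>) has_vector_derivative D) (at t)"
proof -
  have at: "at t within {a..b} = at t" using assms(2) by (intro at_within_interior) auto
  show "isCont \<gamma> t"
    using assms continuous_on_interior[of "{a..b}" \<gamma> t] by (auto simp: C1_curve_on_def)
  assume "c \<in> A" "\<gamma> t \<in> chart_dom c"
  then show "\<exists>D. ((coords c \<circ> \<gamma>) has_vector_derivative D) (at t)"
    using assms unfolding C1_curve_on_def at[symmetric] by (metis atLeastAtMost_iff greaterThanLessThan_iff less_imp_le)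
qed

text \<open>The chart in the definition of the speed may change with the parameter; near t all
  speeds are computed in the single chart chosen at t.\<close>

lemma curve_speed_isCont:
  assumes \<gamma>: "C1_curve_on A a b \<gamma>" and t: "t \<in> {a<..<b}"
  shows "isCont (curve_speed A g \<gamma>) t"
proof -
  let ?c = "chart_at A (\<gamma> t)"
  note c = chart_at[of "\<gamma> t"]
  obtain D where D: "continuous_on {s\<in>{a..b}. \<gamma> s \<in> chart_dom ?c} D"
    "\<And>s. s\<in>{a..b} \<Longrightarrow> \<gamma> s \<in> chart_dom ?c \<Longrightarrow> ((coords ?c \<circ> \<gamma>) has_vector_derivative D s) (at s within {a..b})"
    using \<gamma> c(1) unfolding C1_curve_on_def by blast
  have cg: "continuous_on {a<..<b} \<gamma>"
    by (rule continuous_on_subset[of "{a..b}"]) (use \<gamma> in \<open>auto simp: C1_curve_on_def\<close>)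
  define V where "V = {a<..<b} \<inter> \<gamma> -` chart_dom ?c"
  have V: "open V" unfolding V_def by (rule continuous_open_preimage[OF cg _ open_dom[OF c(1)]]) simp
  have tV: "t \<in> V" using t c(2) by (simp add: V_def)
  let ?f = "\<lambda>s. sqrt (D s \<bullet> (g ?c (coords ?c (\<gamma> s)) *v D s))"
  have cD: "continuous_on V D" by (rule continuous_on_subset[OF D(1)]) (auto simp: V_def)
  have cx: "continuous_on V (\<lambda>s. coords ?c (\<gamma> s))"
    by (rule continuous_on_compose2[OF cont_coords[OF c(1)] continuous_on_subset[OF cg]]) (auto simp: V_def)
  have ce: "continuous_on V (\<lambda>s. g ?c (coords ?c (\<gamma> s)) $ i $ j)" for i j
    by (rule continuous_on_compose2[OF Ck_on_imp_continuous_on[OF metric_entry_Ck[OF c(1), of 0]] cx])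
      (auto simp: V_def coords_in[OF c(1)])
  have "continuous_on V ?f"
    unfolding inner_vec_def matrix_vector_mult_def
    by (intro continuous_on_real_sqrt continuous_on_sum continuous_on_inner)
      (auto intro!: continuous_intros ce cD)
  then have "isCont ?f t" using V tV by (simp add: continuous_on_eq_continuous_at)
  moreover have "curve_speed A g \<gamma> s = ?f s" if "s \<in> V" for s
  proof (rule curve_speed_chart[OF c(1)])
    show "\<gamma> s \<in> chart_dom ?c" using that by (simp add: V_def)
    have s: "s \<in> {a<..<b}" using that by (simp add: V_def)
    show "isCont \<gamma> s" by (rule C1_curve_interior(1)[OF \<gamma> s])
    show "((coords ?c \<circ> \<gamma>) has_vector_derivative D s) (at s)"
      using D(2)[of s] s that at_within_interior[of s "{a..b}"] by (simp add: V_def)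
  qed
  then have "eventually (\<lambda>s. ?f s = curve_speed A g \<gamma> s) (nhds t)"
    using V tV by (auto simp: eventually_nhds)
  ultimately show ?thesis by (simp add: isCont_cong)
qed

section \<open>Length of curves\<close>

definition len :: "(real \<Rightarrow> 'm) \<Rightarrow> real \<Rightarrow> real \<Rightarrow> ennreal" where
  "len \<gamma> a b = (\<integral>\<^sup>+t\<in>{a..b}. ennreal (curve_speed A g \<gamma> t) \<partial>lborel)"

lemma curve_length_eq_len: "curve_length A g \<gamma> = len \<gamma> 0 1"
  by (simp add: curve_length_def len_def)

lemma pw_C1_regular:
  assumes "pw_C1 A a b \<gamma>"
  obtains P where "finite P" "\<And>t. t \<in> {a<..<b} - P \<Longrightarrow> \<exists>a' b'. t \<in> {a'<..<b'} \<and> a \<le> a' \<and> b' \<le> b \<and> C1_curve_on A a' b' \<gamma>"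
proof -
  obtain P where P: "finite P"
    "\<And>a' b'. a \<le> a' \<Longrightarrow> a' < b' \<Longrightarrow> b' \<le> b \<Longrightarrow> {a'<..<b'} \<inter> P = {} \<Longrightarrow> C1_curve_on A a' b' \<gamma>"
    using assms unfolding pw_C1_def by blast
  show thesis
  proof (rule that[OF P(1)])
    fix t assume t: "t \<in> {a<..<b} - P"
    have "open ({a<..<b} - P)" using P(1) by (intro open_Diff finite_imp_closed) auto
    then obtain e where e: "e > 0" "ball t e \<subseteq> {a<..<b} - P" using t by (meson openE)
    have sub: "{t - e<..<t + e} \<subseteq> {a<..<b} - P" using e(2) by (simp add: ball_eq_greaterThanLessThan)
    define a' b' where "a' = t - e / 2" and "b' = t + e / 2"
    have "a' \<in> {t - e<..<t + e}" "b' \<in> {t - e<..<t + e}" using e by (auto simp: a'_def b'_def)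
    then have ab: "a \<le> a'" "b' \<le> b" using sub by (auto intro: less_imp_le)
    have "{a'<..<b'} \<subseteq> {t - e<..<t + e}" using e by (auto simp: a'_def b'_def)
    then have "{a'<..<b'} \<inter> P = {}" using sub by blast
    then have "C1_curve_on A a' b' \<gamma>" using ab e by (intro P(2)) (auto simp: a'_def b'_def)
    then show "\<exists>a' b'. t \<in> {a'<..<b'} \<and> a \<le> a' \<and> b' \<le> b \<and> C1_curve_on A a' b' \<gamma>"
      using ab e by (intro exI[of _ a'] exI[of _ b']) (auto simp: a'_def b'_def)
  qed
qed

text \<open>The speed is continuous away from finitely many parameters, and a change at countably
  many points preserves measurability.\<close>

lemma curve_speed_measurable:
  assumes "pw_C1 A a b \<gamma>"
  shows "(\<lambda>t. indicator {a..b} t * curve_speed A g \<gamma> t) \<in> borel_measurable borel"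
proof -
  obtain P where P: "finite P"
    "\<And>t. t \<in> {a<..<b} - P \<Longrightarrow> \<exists>a' b'. t \<in> {a'<..<b'} \<and> a \<le> a' \<and> b' \<le> b \<and> C1_curve_on A a' b' \<gamma>"
    using pw_C1_regular[OF assms] by metis
  let ?U = "{a<..<b} - P"
  have U: "open ?U" using P(1) by (intro open_Diff finite_imp_closed) auto
  have "continuous_on ?U (curve_speed A g \<gamma>)"
    using P(2) curve_speed_isCont by (intro continuous_at_imp_continuous_on ballI) blast
  then have "(\<lambda>t. indicator ?U t * curve_speed A g \<gamma> t) \<in> borel_measurable borel"
    using borel_measurable_continuous_on_indicator[OF borel_open[OF U]] by fastforce
  then show ?thesis
    by (rule measurable_discrete_difference[where X = "insert a (insert b P)"])
      (use P(1) in \<open>auto simp: countable_finite indicator_def\<close>)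
qed

lemma len_eq: "len \<gamma> a b = (\<integral>\<^sup>+t. ennreal (indicator {a..b} t * curve_speed A g \<gamma> t) \<partial>lborel)"
  unfolding len_def by (intro nn_integral_cong) (auto simp: indicator_def)

text \<open>Speeds are two-sided derivatives, so at the endpoints they depend on the curve outside
  the interval; the endpoints form a null set.\<close>

lemma len_cong:
  assumes "\<And>t. t \<in> {a..b} \<Longrightarrow> \<gamma>' t = \<gamma> t"
  shows "len \<gamma>' a b = len \<gamma> a b"
  unfolding len_eq
proof (rule nn_integral_cong_AE)
  have "AE t in lborel. t \<notin> {a, b}" by (intro AE_not_in countable_imp_null_set_lborel) auto
  then show "AE t in lborel. ennreal (indicator {a..b} t * curve_speed A g \<gamma>' t)
      = ennreal (indicator {a..b} t * curve_speed A g \<gamma> t)"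
  proof eventually_elim
    case (elim t)
    show ?case
    proof (cases "t \<in> {a<..<b}")
      case True
      have "eventually (\<lambda>s. s \<in> {a<..<b}) (nhds t)" using True by (intro eventually_nhds_in_open) auto
      then have "eventually (\<lambda>s. \<gamma>' s = \<gamma> s) (nhds t)" by (rule eventually_mono) (use assms in auto)
      then show ?thesis using curve_speed_cong by simp
    qed (use elim in \<open>auto simp: indicator_def\<close>)
  qed
qed

lemma len_glue:
  assumes "pw_C1 A a c \<gamma>" "a \<le> b" "b \<le> c"
  shows "len \<gamma> a c = len \<gamma> a b + len \<gamma> b c"
proof -
  let ?F = "\<lambda>t. ennreal (indicator {a..c} t * curve_speed A g \<gamma> t)"
  have F: "?F \<in> borel_measurable lborel" using curve_speed_measurable[OF assms(1)] by simp
  have "len \<gamma> a c = (\<integral>\<^sup>+t\<in>{a..b} \<union> {b<..c}. ?F t \<partial>lborel)"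
    unfolding len_eq using assms by (intro nn_integral_cong) (auto simp: indicator_def)
  also have "\<dots> = (\<integral>\<^sup>+t\<in>{a..b}. ?F t \<partial>lborel) + (\<integral>\<^sup>+t\<in>{b<..c}. ?F t \<partial>lborel)"
    using F by (intro nn_integral_disjoint_pair) auto
  also have "(\<integral>\<^sup>+t\<in>{a..b}. ?F t \<partial>lborel) = len \<gamma> a b"
    unfolding len_eq using assms by (intro nn_integral_cong) (auto simp: indicator_def)
  also have "(\<integral>\<^sup>+t\<in>{b<..c}. ?F t \<partial>lborel) = len \<gamma> b c"
    unfolding len_eq
  proof (rule nn_integral_cong_AE)
    have "AE t in lborel. t \<notin> {b}" by (intro AE_not_in countable_imp_null_set_lborel) auto
    then show "AE t in lborel. ?F t * indicator {b<..c} t = ennreal (indicator {b..c} t * curve_speed A g \<gamma> t)"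
      by eventually_elim (use assms in \<open>auto simp: indicator_def\<close>)
  qed
  finally show ?thesis .
qed

lemma curve_speed_affine:
  assumes "C1_curve_on A a b \<gamma>" "\<alpha> + \<beta> * s \<in> {a<..<b}"
  shows "curve_speed A g (\<lambda>s. \<gamma> (\<alpha> + \<beta> * s)) s = \<bar>\<beta>\<bar> * curve_speed A g \<gamma> (\<alpha> + \<beta> * s)"
proof -
  let ?h = "\<lambda>s. \<alpha> + \<beta> * s" let ?c = "chart_at A (\<gamma> (?h s))"
  note c = chart_at[of "\<gamma> (?h s)"]
  have cont: "isCont \<gamma> (?h s)" by (rule C1_curve_interior(1)[OF assms])
  obtain v where v: "((coords ?c \<circ> \<gamma>) has_vector_derivative v) (at (?h s))"
    using C1_curve_interior(2)[OF assms c] by blast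
  have "(?h has_vector_derivative \<beta>) (at s)"
    by (auto intro!: derivative_eq_intros simp: has_real_derivative_iff_has_vector_derivative[symmetric])
  from vector_diff_chain_at[OF this v]
  have v': "((coords ?c \<circ> (\<lambda>s. \<gamma> (?h s))) has_vector_derivative \<beta> *\<^sub>R v) (at s)" by (simp add: o_def)
  have "isCont (\<lambda>s. \<gamma> (?h s)) s"
    by (rule continuous_at_compose[of s ?h \<gamma>, unfolded o_def]) (auto intro!: continuous_intros cont)
  from curve_speed_chart[OF c(1) c(2) this v'] curve_speed_chart[OF c cont v]
  show ?thesis
    by (simp add: matrix_vector_mult_scaleR real_sqrt_mult mult.assoc[symmetric])
qed

text \<open>The affine substitution rule for nonnegative integrals, as the speed scales by the
  absolute value of \<beta> at all but finitely many parameters of the interval.\<close>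

lemma len_affine:
  assumes "pw_C1 A a b \<gamma>" "\<beta> \<noteq> 0" "\<And>s. s \<in> {a'..b'} \<longleftrightarrow> \<alpha> + \<beta> * s \<in> {a..b}"
  shows "len (\<lambda>s. \<gamma> (\<alpha> + \<beta> * s)) a' b' = len \<gamma> a b"
proof -
  let ?h = "\<lambda>s. \<alpha> + \<beta> * s"
  obtain P where P: "finite P"
    "\<And>t. t \<in> {a<..<b} - P \<Longrightarrow> \<exists>a' b'. t \<in> {a'<..<b'} \<and> a \<le> a' \<and> b' \<le> b \<and> C1_curve_on A a' b' \<gamma>"
    using pw_C1_regular[OF assms(1)] by metis
  have inj: "inj ?h" using assms(2) by (simp add: inj_on_def)
  have "len \<gamma> a b = ennreal \<bar>\<beta>\<bar> * (\<integral>\<^sup>+s. ennreal (indicator {a..b} (?h s) * curve_speed A g \<gamma> (?h s)) \<partial>lborel)"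
    unfolding len_eq using curve_speed_measurable[OF assms(1)] assms(2)
    by (intro nn_integral_real_affine) auto
  also have "\<dots> = (\<integral>\<^sup>+s. ennreal \<bar>\<beta>\<bar> * ennreal (indicator {a..b} (?h s) * curve_speed A g \<gamma> (?h s)) \<partial>lborel)"
  proof (rule nn_integral_cmult[symmetric])
    have "?h \<in> borel_measurable borel" by measurable
    from measurable_compose[OF this curve_speed_measurable[OF assms(1)]]
    show "(\<lambda>s. ennreal (indicator {a..b} (?h s) * curve_speed A g \<gamma> (?h s))) \<in> borel_measurable lborel"
      by simp
  qed
  also have "\<dots> = len (\<lambda>s. \<gamma> (?h s)) a' b'"
    unfolding len_eq
  proof (rule nn_integral_cong_AE)
    have "finite (?h -` insert a (insert b P))" using P(1) inj by (intro finite_vimageI) auto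
    then have "AE s in lborel. s \<notin> ?h -` insert a (insert b P)"
      by (intro AE_not_in countable_imp_null_set_lborel countable_finite)
    then show "AE s in lborel. ennreal \<bar>\<beta>\<bar> * ennreal (indicator {a..b} (?h s) * curve_speed A g \<gamma> (?h s))
       = ennreal (indicator {a'..b'} s * curve_speed A g (\<lambda>s. \<gamma> (?h s)) s)"
    proof eventually_elim
      case (elim s)
      show ?case
      proof (cases "?h s \<in> {a..b}")
        case True
        then have "?h s \<in> {a<..<b} - P" using elim by auto
        then obtain l r where lr: "?h s \<in> {l<..<r}" "C1_curve_on A l r \<gamma>" using P(2) by blast
        have "s \<in> {a'..b'}" using assms(3) True by blast
        then show ?thesis using curve_speed_affine[OF lr(2,1)] True curve_speed_nonneg
          by (simp add: ennreal_mult)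
      next
        case False
        then have "s \<notin> {a'..b'}" using assms(3) by blast
        then show ?thesis using False by simp
      qed
    qed
  qed
  finally show ?thesis by simp
qed

section \<open>The distance as an extended pseudometric\<close>

abbreviation rdist :: "'m \<Rightarrow> 'm \<Rightarrow> ennreal" where "rdist \<equiv> riemannian_dist A g"

lemma rdist_le_len:
  assumes "pw_C1 A a b \<gamma>" "a < b"
  shows "rdist (\<gamma> a) (\<gamma> b) \<le> len \<gamma> a b"
proof -
  let ?\<sigma> = "\<lambda>s. \<gamma> (a + (b - a) * s)"
  have iff: "s \<in> {0..1} \<longleftrightarrow> a + (b - a) * s \<in> {a..b}" for s
  proof -
    have "a + (b - a) * s \<le> b \<longleftrightarrow> (b - a) * s \<le> (b - a) * 1" by (simp add: algebra_simps)
    also have "\<dots> \<longleftrightarrow> s \<le> 1" using assms(2) by (subst mult_le_cancel_left_pos) auto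
    finally show ?thesis using assms(2) by (auto simp: zero_le_mult_iff)
  qed
  have "pw_C1 A 0 1 ?\<sigma>" using assms iff by (intro pw_C1_affine[OF assms(1)]) auto
  then have "rdist (\<gamma> a) (\<gamma> b) \<le> len ?\<sigma> 0 1"
    unfolding riemannian_dist_def curve_length_eq_len piecewise_C1_curve_iff
    by (intro INF_lower) auto
  also have "\<dots> = len \<gamma> a b" using assms iff by (intro len_affine) auto
  finally show ?thesis .
qed

lemma rdist_lessE:
  assumes "rdist p q < r"
  obtains \<gamma> where "pw_C1 A 0 1 \<gamma>" "\<gamma> 0 = p" "\<gamma> 1 = q" "len \<gamma> 0 1 < r"
  using assms unfolding riemannian_dist_def curve_length_eq_len piecewise_C1_curve_iff INF_less_iff by blast

lemma rdist_triangle: "rdist p r \<le> rdist p q + rdist q r"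
proof (rule ccontr)
  assume "\<not> ?thesis"
  then have lt: "rdist p q + rdist q r < rdist p r" by simp
  obtain e1 where "rdist p q + rdist q r < e1" "e1 < rdist p r" using dense[OF lt] by blast
  \<comment> \<open>Distances may be infinite: the gap below \<open>rdist p r\<close> first forces
    both summands to be finite and is then divided equally between x and y.\<close>
  have "\<exists>x y. rdist p q < x \<and> rdist q r < y \<and> x + y < rdist p r"
  proof -
    have fin: "rdist p q < top" "rdist q r < top" using order_less_le_trans[OF lt, of top] by (auto simp: less_top[symmetric] ennreal_add_eq_top)
    obtain a b where ab: "rdist p q = ennreal a" "rdist q r = ennreal b" "0 \<le> a" "0 \<le> b"
      using fin by (cases "rdist p q"; cases "rdist q r") auto
    obtain e where e: "ennreal (a + b) < ennreal e" "ennreal e < rdist p r" "0 \<le> e"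
    proof -
      obtain e' where "ennreal (a + b) < e'" "e' < rdist p r" using dense[OF lt] ab by (auto simp: ennreal_plus)
      then show thesis using that[of "enn2real e'"] by (cases e') auto
    qed
    then have "a + b < e" using ab by (simp add: ennreal_less_iff del: ennreal_plus)
    define d where "d = (e - a - b) / 2"
    have "d > 0" using \<open>a + b < e\<close> by (simp add: d_def)
    moreover have "ennreal (a + d) + ennreal (b + d) = ennreal e"
      using ab \<open>d > 0\<close> by (subst ennreal_plus[symmetric]) (auto simp: d_def field_simps)
    ultimately show ?thesis
      using ab e by (intro exI[of _ "ennreal (a + d)"] exI[of _ "ennreal (b + d)"]) (auto simp: ennreal_less_iff)
  qed
  then obtain x y where xy: "rdist p q < x" "rdist q r < y" "x + y < rdist p r" by blast
  obtain \<gamma> where \<gamma>: "pw_C1 A 0 1 \<gamma>" "\<gamma> 0 = p" "\<gamma> 1 = q" "len \<gamma> 0 1 < x" using rdist_lessE[OF xy(1)] .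
  obtain \<sigma> where \<sigma>: "pw_C1 A 0 1 \<sigma>" "\<sigma> 0 = q" "\<sigma> 1 = r" "len \<sigma> 0 1 < y" using rdist_lessE[OF xy(2)] .
  \<comment> \<open>The second curve is shifted to the interval from 1 to 2, so that the
    concatenation runs from 0 to 2.\<close>
  define \<sigma>' where "\<sigma>' = (\<lambda>s. \<sigma> (-1 + 1 * s))"
  have \<sigma>': "pw_C1 A 1 2 \<sigma>'" unfolding \<sigma>'_def by (intro pw_C1_affine[OF \<sigma>(1)]) auto
  have l\<sigma>': "len \<sigma>' 1 2 = len \<sigma> 0 1" unfolding \<sigma>'_def by (intro len_affine[OF \<sigma>(1)]) auto
  define \<tau> where "\<tau> t = (if t \<le> 1 then \<gamma> t else \<sigma>' t)" for t
  have t1: "\<tau> t = \<gamma> t" if "t \<in> {0..1}" for t using that by (simp add: \<tau>_def)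
  have t2: "\<tau> t = \<sigma>' t" if "t \<in> {1..2}" for t using that \<gamma>(3) \<sigma>(2) by (auto simp: \<tau>_def \<sigma>'_def)
  have pw: "pw_C1 A 0 2 \<tau>"
    by (rule pw_C1_glue[OF pw_C1_cong[OF \<gamma>(1) t1] pw_C1_cong[OF \<sigma>' t2]])
  have "rdist p r \<le> len \<tau> 0 2"
    using rdist_le_len[OF pw] \<gamma>(2) \<sigma>(3) by (simp add: \<tau>_def \<sigma>'_def)
  also have "\<dots> = len \<tau> 0 1 + len \<tau> 1 2" by (intro len_glue[OF pw]) auto
  also have "\<dots> = len \<gamma> 0 1 + len \<sigma> 0 1"
    using len_cong[of 0 1 \<tau> \<gamma>] len_cong[of 1 2 \<tau> \<sigma>'] t1 t2 l\<sigma>' by simp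
  also have "\<dots> \<le> x + y" using \<gamma>(4) \<sigma>(4) by (intro add_mono) auto
  finally show False using xy(3) by simp
qed

lemma rdist_sym_le: "rdist q p \<le> rdist p q"
proof (rule ccontr)
  assume "\<not> ?thesis"
  then have "rdist p q < rdist q p" by simp
  then obtain \<gamma> where \<gamma>: "pw_C1 A 0 1 \<gamma>" "\<gamma> 0 = p" "\<gamma> 1 = q" "len \<gamma> 0 1 < rdist q p"
    using rdist_lessE by metis
  let ?\<sigma> = "\<lambda>s. \<gamma> (1 + (-1) * s)"
  have "pw_C1 A 0 1 ?\<sigma>" by (intro pw_C1_affine[OF \<gamma>(1)]) auto
  from rdist_le_len[OF this] have "rdist q p \<le> len ?\<sigma> 0 1" using \<gamma> by simp
  also have "\<dots> = len \<gamma> 0 1" by (intro len_affine[OF \<gamma>(1)]) auto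
  finally show False using \<gamma>(4) by simp
qed

lemma rdist_sym: "rdist p q = rdist q p"
  using rdist_sym_le by (intro antisym)

end

section \<open>The Hopf--Rinow theorem\<close>

lemma frame_norm:
  fixes E G :: "real^'n^'n::finite"
  assumes "transpose E ** G ** E = mat 1"
  shows "(E *v z) \<bullet> (G *v (E *v z)) = z \<bullet> z"
  unfolding inner_matrix_transpose by (simp add: matrix_vector_mul_assoc assms matrix_mul_assoc)

text \<open>The lower bound comes from an orthonormal frame E: v is the image under E of a vector
  whose Euclidean square is \<open>v \<bullet> (G *v v)\<close>, and E is bounded.\<close>

lemma pos_def_bounds:
  fixes G :: "real^'n^'n::finite"
  assumes "pos_def G"
  obtains m M where "m > 0" "M > 0" "\<And>v. m * (v \<bullet> v) \<le> v \<bullet> (G *v v)" "\<And>v. v \<bullet> (G *v v) \<le> M * (v \<bullet> v)"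
proof -
  obtain E :: "real^'n^'n" where E: "transpose E ** G ** E = mat 1" using exists_orthonormal_frame[OF assms] .
  obtain K where K: "K > 0" "\<And>x. norm (E *v x) \<le> norm x * K"
    using bounded_linear.pos_bounded[OF matrix_vector_mul_bounded_linear[of E]] by blast
  obtain L where L: "L > 0" "\<And>x. norm (G *v x) \<le> norm x * L"
    using bounded_linear.pos_bounded[OF matrix_vector_mul_bounded_linear[of G]] by blast
  show thesis
  proof (rule that[of "1 / K^2" L])
    fix v
    define w where "w = (transpose E ** G) *v v"
    have v: "v = E *v w" unfolding w_def by (simp add: matrix_vector_mul_assoc frame_inverse(1)[OF E])
    have "v \<bullet> v = (norm v)^2" by (simp add: power2_norm_eq_inner)
    also have "\<dots> \<le> (norm w * K)^2" using K(2)[of w] v by (intro power_mono) auto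
    also have "\<dots> = K^2 * (w \<bullet> w)" by (simp add: power_mult_distrib power2_norm_eq_inner)
    also have "w \<bullet> w = v \<bullet> (G *v v)" using frame_norm[OF E, of w] v by simp
    finally show "1 / K^2 * (v \<bullet> v) \<le> v \<bullet> (G *v v)"
      using K(1) by (simp add: divide_simps mult.commute)
    have "v \<bullet> (G *v v) \<le> norm v * norm (G *v v)" by (rule norm_cauchy_schwarz)
    also have "\<dots> \<le> norm v * (norm v * L)" using L(2) by (intro mult_left_mono) auto
    also have "\<dots> = L * (v \<bullet> v)" by (simp add: dot_square_norm power2_eq_square)
    finally show "v \<bullet> (G *v v) \<le> L * (v \<bullet> v)" .
  qed (use K L in auto)
qed

lemma quadratic_form_bound:
  fixes M :: "real^'n^'n::finite"
  shows "\<bar>v \<bullet> (M *v v)\<bar> \<le> (\<Sum>i\<in>UNIV. \<Sum>j\<in>UNIV. \<bar>M $ i $ j\<bar>) * (v \<bullet> v)"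
proof -
  have "\<bar>v \<bullet> (M *v v)\<bar> = \<bar>\<Sum>i\<in>UNIV. \<Sum>j\<in>UNIV. v $ i * (M $ i $ j * v $ j)\<bar>"
    by (simp add: inner_vec_def matrix_vector_mult_def sum_distrib_left)
  also have "\<dots> \<le> (\<Sum>i\<in>UNIV. \<Sum>j\<in>UNIV. \<bar>v $ i * (M $ i $ j * v $ j)\<bar>)"
    by (intro order_trans[OF sum_abs] sum_mono sum_abs)
  also have "\<dots> \<le> (\<Sum>i\<in>UNIV. \<Sum>j\<in>UNIV. \<bar>M $ i $ j\<bar> * (v \<bullet> v))"
  proof (intro sum_mono)
    fix i j
    have "\<bar>v $ i\<bar> * \<bar>v $ j\<bar> \<le> norm v * norm v" by (intro mult_mono component_le_norm_cart) auto
    then have "\<bar>M $ i $ j\<bar> * (\<bar>v $ i\<bar> * \<bar>v $ j\<bar>) \<le> \<bar>M $ i $ j\<bar> * (v \<bullet> v)"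
      by (intro mult_left_mono) (auto simp: dot_square_norm power2_eq_square)
    then show "\<bar>v $ i * (M $ i $ j * v $ j)\<bar> \<le> \<bar>M $ i $ j\<bar> * (v \<bullet> v)"
      by (simp add: abs_mult mult_ac)
  qed
  finally show ?thesis by (simp add: sum_distrib_right)
qed

lemma ennreal_gap:
  fixes a b :: ennreal
  assumes "a < b"
  obtains e :: real where "e > 0" "a + ennreal e < b"
proof -
  obtain c where c: "a < c" "c < b" using dense[OF assms] by blast
  obtain x where x: "a = ennreal x" "x \<ge> 0" using c by (cases a) auto
  obtain y where y: "c = ennreal y" "y \<ge> 0" using c by (cases c) auto
  have "x < y" using c x y by (simp add: ennreal_less_iff)
  then show thesis using that[of "y - x"] c x y by (simp add: ennreal_plus[symmetric] del: ennreal_plus)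
qed

context riemannian
begin

text \<open>Where the entries of the metric differ in sum by at most m/2 from those at
  \<open>x0\<close>, the quadratic forms differ by at most half the form at \<open>x0\<close>; their
  ratio then lies between 1/2 and 3/2.\<close>

lemma metric_local_bounds:
  assumes c: "c \<in> A" and x0: "x0 \<in> chart_img c"
  obtains r where "r > 0" "cball x0 r \<subseteq> chart_img c"
    "\<And>z v. z \<in> cball x0 r \<Longrightarrow> v \<bullet> (g c x0 *v v) \<le> 2 * (v \<bullet> (g c z *v v))"
    "\<And>z v. z \<in> cball x0 r \<Longrightarrow> v \<bullet> (g c z *v v) \<le> 2 * (v \<bullet> (g c x0 *v v))"
proof -
  obtain m M where m: "m > 0" "\<And>v. m * (v \<bullet> v) \<le> v \<bullet> (g c x0 *v v)"
    using pos_def_bounds[OF metric_pos_def[OF c x0]] by metis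
  define N where "N z = (\<Sum>i\<in>UNIV. \<Sum>j\<in>UNIV. \<bar>(g c z - g c x0) $ i $ j\<bar>)" for z
  have "continuous_on (chart_img c) N"
    unfolding N_def vector_minus_component
    by (intro continuous_on_sum continuous_on_rabs continuous_on_diff continuous_on_const
        Ck_on_imp_continuous_on[OF metric_entry_Ck[OF c, of 0]])
  then have "isCont N x0" using x0 open_img[OF c] by (simp add: continuous_on_eq_continuous_at)
  moreover have "N x0 = 0" by (simp add: N_def)
  ultimately obtain d where d: "d > 0" "\<And>z. dist z x0 < d \<Longrightarrow> \<bar>N z\<bar> < m / 2"
    using m(1) unfolding continuous_at_eps_delta by (metis diff_zero dist_real_def half_gt_zero)
  obtain e where e: "e > 0" "cball x0 e \<subseteq> chart_img c"
    using open_img[OF c] x0 open_contains_cball by blast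
  define r where "r = min (d / 2) e"
  show thesis
  proof (rule that[of r])
    show "r > 0" using d e by (simp add: r_def)
    show "cball x0 r \<subseteq> chart_img c" using e by (auto simp: r_def)
    fix z v assume "z \<in> cball x0 r"
    then have "N z \<le> m / 2" using d(2)[of z] d(1) by (auto simp: r_def dist_commute)
    have "\<bar>v \<bullet> ((g c z - g c x0) *v v)\<bar> \<le> N z * (v \<bullet> v)"
      unfolding N_def by (rule quadratic_form_bound)
    also have "\<dots> \<le> m / 2 * (v \<bullet> v)" using \<open>N z \<le> m / 2\<close> by (intro mult_right_mono) auto
    also have "\<dots> \<le> (v \<bullet> (g c x0 *v v)) / 2" using m(2)[of v] by simp
    finally have *: "\<bar>v \<bullet> (g c z *v v) - v \<bullet> (g c x0 *v v)\<bar> \<le> (v \<bullet> (g c x0 *v v)) / 2"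
      by (simp add: matrix_vector_mult_diff_rdistrib inner_diff_right)
    have "0 \<le> v \<bullet> (g c x0 *v v)" by (rule pos_def_nonneg[OF metric_pos_def[OF c x0]])
    with * show "v \<bullet> (g c x0 *v v) \<le> 2 * (v \<bullet> (g c z *v v))"
      "v \<bullet> (g c z *v v) \<le> 2 * (v \<bullet> (g c x0 *v v))" by linarith+
  qed
qed

text \<open>The competitor in the infimum is the straight coordinate segment with constant velocity
  v.\<close>

lemma rdist_segment:
  assumes c: "c \<in> A" and seg: "\<And>s. s \<in> {0..1} \<Longrightarrow> x + s *\<^sub>R v \<in> chart_img c"
    and K: "\<And>s. s \<in> {0..1} \<Longrightarrow> v \<bullet> (g c (x + s *\<^sub>R v) *v v) \<le> K^2" "K \<ge> 0"
  shows "rdist (chart_inv c x) (chart_inv c (x + v)) \<le> ennreal K"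
proof -
  let ?l = "\<lambda>s. x + s *\<^sub>R v"
  define \<gamma> where "\<gamma> s = chart_inv c (?l s)" for s
  have lc: "continuous_on S ?l" for S by (intro continuous_intros)
  have ld: "(?l has_vector_derivative v) F" for F
    unfolding has_vector_derivative_def by (auto intro!: derivative_eq_intros)
  have C1: "C1_curve_on A 0 1 \<gamma>" unfolding C1_curve_on_def
  proof (intro conjI ballI)
    show "continuous_on {0..1} \<gamma>" unfolding \<gamma>_def
      by (rule continuous_on_compose2[OF cont_inv[OF c] lc]) (use seg in auto)
    fix d assume d: "d \<in> A"
    let ?T = "transition c d"
    \<comment> \<open>In a second chart the velocity is the image of v under the derivative of the
      transition map, written through partial derivatives because their continuity is known.\<close>
    define D where "D s = (\<Sum>j\<in>UNIV. v $ j *\<^sub>R partial_deriv j ?T (?l s))" for s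
    have ov: "?l s \<in> overlap c d" if "s \<in> {0..1}" "\<gamma> s \<in> chart_dom d" for s
      using that seg[of s] overlap_iff[OF c] by (simp add: \<gamma>_def)
    have cp: "continuous_on (overlap c d) (partial_deriv j ?T)" for j
      using transition_smooth[OF c d, of "Suc 0"] by simp
    have "continuous_on {s\<in>{0..1}. \<gamma> s \<in> chart_dom d} D" unfolding D_def
      by (intro continuous_on_sum continuous_on_scaleR continuous_on_const continuous_on_compose2[OF cp lc])
        (use ov in auto)
    moreover have "((coords d \<circ> \<gamma>) has_vector_derivative D s) (at s within {0..1})"
      if "s \<in> {0..1}" "\<gamma> s \<in> chart_dom d" for s
    proof -
      have "(?T has_derivative (\<lambda>h. \<Sum>j\<in>UNIV. h $ j *\<^sub>R partial_deriv j ?T (?l s))) (at (?l s))"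
        by (rule has_derivative_partials[OF transition_differentiable[OF c d ov[OF that]]])
      from has_derivative_compose[OF ld[unfolded has_vector_derivative_def] this]
      have "((\<lambda>s. ?T (?l s)) has_derivative (\<lambda>h. \<Sum>j\<in>UNIV. (h *\<^sub>R v) $ j *\<^sub>R partial_deriv j ?T (?l s))) (at s within {0..1})" .
      then show ?thesis
        unfolding has_vector_derivative_def D_def
        by (simp add: transition_def \<gamma>_def o_def scaleR_sum_right)
    qed
    ultimately show "\<exists>D. continuous_on {s\<in>{0..1}. \<gamma> s \<in> chart_dom d} D \<and>
        (\<forall>s\<in>{0..1}. \<gamma> s \<in> chart_dom d \<longrightarrow> ((coords d \<circ> \<gamma>) has_vector_derivative D s) (at s within {0..1}))"
      by (intro exI[of _ D]) simp
  qed
  have pw: "pw_C1 A 0 1 \<gamma>" unfolding pw_C1_def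
  proof (intro exI[of _ "{}"] conjI allI impI)
    fix a' b' :: real assume "0 \<le> a' \<and> a' < b' \<and> b' \<le> 1 \<and> {a'<..<b'} \<inter> {} = {}"
    then show "C1_curve_on A a' b' \<gamma>" using C1_curve_on_affine[OF C1, of 0 1 a' b'] by simp
  qed simp
  have speed: "curve_speed A g \<gamma> s \<le> K" if s: "s \<in> {0<..<1}" for s
  proof -
    have s': "s \<in> {0..1}" using s by simp
    have "eventually (\<lambda>s. s \<in> {0<..<1::real}) (nhds s)" using s by (intro eventually_nhds_in_open) auto
    then have ev: "eventually (\<lambda>s. ?l s = (coords c \<circ> \<gamma>) s) (nhds s)"
      by (rule eventually_mono) (use coords_inv[OF c seg] in \<open>auto simp: \<gamma>_def\<close>)
    have "((coords c \<circ> \<gamma>) has_vector_derivative v) (at s)"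
      unfolding has_vector_derivative_def
      by (rule has_derivative_transform_eventually[OF ld[unfolded has_vector_derivative_def]])
        (use ev in \<open>auto simp: eventually_nhds_conv_at\<close>)
    moreover have "\<gamma> s \<in> chart_dom c" using inv_in[OF c seg[OF s']] by (simp add: \<gamma>_def)
    ultimately have "curve_speed A g \<gamma> s = sqrt (v \<bullet> (g c (coords c (\<gamma> s)) *v v))"
      using curve_speed_chart[OF c] C1_curve_interior(1)[OF C1 s] by blast
    also have "coords c (\<gamma> s) = ?l s" using coords_inv[OF c seg[OF s']] by (simp add: \<gamma>_def)
    also have "sqrt (v \<bullet> (g c (?l s) *v v)) \<le> K" using K(1)[OF s'] K(2) by (intro real_le_lsqrt) auto
    finally show ?thesis .
  qed
  have "rdist (chart_inv c x) (chart_inv c (x + v)) \<le> len \<gamma> 0 1"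
    using rdist_le_len[OF pw] by (simp add: \<gamma>_def)
  also have "\<dots> \<le> (\<integral>\<^sup>+t\<in>{0..1::real}. ennreal K \<partial>lborel)"
    unfolding len_def
  proof -
    have "AE t in lborel. t \<notin> {0, 1::real}" by (intro AE_not_in countable_imp_null_set_lborel) auto
    then have "AE t in lborel. ennreal (curve_speed A g \<gamma> t) * indicator {0..1} t \<le> ennreal K * indicator {0..1} t"
      by eventually_elim (use speed in \<open>auto simp: indicator_def intro!: ennreal_leI\<close>)
    then show "(\<integral>\<^sup>+t\<in>{0..1}. ennreal (curve_speed A g \<gamma> t) \<partial>lborel) \<le> (\<integral>\<^sup>+t\<in>{0..1::real}. ennreal K \<partial>lborel)"
      by (rule nn_integral_mono_AE)
  qed
  also have "\<dots> = ennreal K" by (simp add: nn_integral_cmult_indicator)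
  finally show ?thesis .
qed

lemma rdist_refl: "rdist p p = 0"
proof -
  obtain c where c: "c \<in> A" "p \<in> chart_dom c" using charts_cover by blast
  have "rdist (chart_inv c (coords c p)) (chart_inv c (coords c p + 0)) \<le> ennreal 0"
    by (rule rdist_segment[OF c(1)]) (use coords_in[OF c] in auto)
  then show ?thesis using inv_coords[OF c] by simp
qed

text \<open>Pairing the moving point with the total displacement w reduces the estimate to the
  fundamental theorem of calculus for a real function: its derivative is at most |w|/m times the
  speed, and the resulting bound of |w|^2 can be divided by |w|.\<close>

lemma coords_displacement_le:
  assumes c: "c \<in> A" and r: "cball x0 r \<subseteq> chart_img c" and m: "m > 0"
    "\<And>z v. z \<in> cball x0 r \<Longrightarrow> m^2 * (v \<bullet> v) \<le> v \<bullet> (g c z *v v)"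
    and \<gamma>: "pw_C1 A 0 1 \<gamma>" "\<gamma> 0 = chart_inv c x0" and l: "len \<gamma> 0 1 = ennreal l" "0 \<le> l" and "0 \<le> r"
    and t: "t \<in> {0..1}" and stay: "\<And>s. s \<in> {0..t} \<Longrightarrow> \<gamma> s \<in> chart_inv c ` cball x0 r"
  shows "norm (coords c (\<gamma> t) - x0) \<le> l / m"
proof (cases "t = 0")
  case True
  have "x0 \<in> chart_img c" using r \<open>0 \<le> r\<close> by (simp add: subset_iff)
  then show ?thesis using True \<gamma>(2) coords_inv[OF c] l(2) m(1) by auto
next
  case False
  let ?x = "\<lambda>s. coords c (\<gamma> s)"
  have xin: "?x s \<in> cball x0 r" "\<gamma> s \<in> chart_dom c" if s: "s \<in> {0..t}" for s
  proof -
    obtain z where z: "z \<in> cball x0 r" "\<gamma> s = chart_inv c z" using stay[OF s] by blast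
    then have "z \<in> chart_img c" using r by blast
    then show "?x s \<in> cball x0 r" "\<gamma> s \<in> chart_dom c" using z coords_inv[OF c] inv_in[OF c] by auto
  qed
  have "x0 \<in> chart_img c" using r \<open>0 \<le> r\<close> by (simp add: subset_iff)
  then have x00: "?x 0 = x0" using \<gamma>(2) coords_inv[OF c] by simp
  obtain P where P: "finite P"
    "\<And>s. s \<in> {0<..<1} - P \<Longrightarrow> \<exists>a' b'. s \<in> {a'<..<b'} \<and> 0 \<le> a' \<and> b' \<le> 1 \<and> C1_curve_on A a' b' \<gamma>"
    using pw_C1_regular[OF \<gamma>(1)] by metis
  define w where "w = ?x t - x0"
  define S where "S = insert 0 (insert t P)"
  define D where "D s = vector_derivative (coords c \<circ> \<gamma>) (at s)" for s
  \<comment> \<open>At the finitely many exceptional parameters the integrand is set to 0, which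
    keeps it below the speed bound.\<close>
  define f' where "f' s = (if s \<in> S then 0 else D s \<bullet> w)" for s
  have good: "((coords c \<circ> \<gamma>) has_vector_derivative D s) (at s)" "isCont \<gamma> s" if "s \<in> {0<..<t} - S" for s
  proof -
    have "s \<in> {0<..<1} - P" using that t by (auto simp: S_def)
    then obtain a' b' where ab: "s \<in> {a'<..<b'}" "C1_curve_on A a' b' \<gamma>" using P(2) by blast
    show "isCont \<gamma> s" by (rule C1_curve_interior(1)[OF ab(2,1)])
    have "\<gamma> s \<in> chart_dom c" using xin that by auto
    then have "(coords c \<circ> \<gamma>) differentiable (at s)"
      using C1_curve_interior(2)[OF ab(2,1) c] by (auto intro: differentiableI_vector)
    then show "((coords c \<circ> \<gamma>) has_vector_derivative D s) (at s)"
      unfolding D_def by (simp add: vector_derivative_works)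
  qed
  have cont: "continuous_on {0..1} \<gamma>"
    by (rule pw_C1_continuous[OF \<gamma>(1)])
  have cx: "continuous_on {0..t} ?x"
    by (rule continuous_on_compose2[OF cont_coords[OF c] continuous_on_subset[OF cont]]) (use xin t in auto)
  have int: "(f' has_integral ((?x t - x0) \<bullet> w - (?x 0 - x0) \<bullet> w)) {0..t}"
  proof (rule fundamental_theorem_of_calculus_interior_strong[where S = S])
    show "finite S" using P(1) by (simp add: S_def)
    show "continuous_on {0..t} (\<lambda>s. (?x s - x0) \<bullet> w)" by (intro continuous_intros cx)
    fix s assume s: "s \<in> {0<..<t} - S"
    have "((\<lambda>s. (coords c \<circ> \<gamma>) s - x0) has_vector_derivative D s - 0) (at s)"
      by (intro has_vector_derivative_diff good(1)[OF s] has_vector_derivative_const)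
    from bounded_linear.has_vector_derivative[OF bounded_linear_inner_left[of w] this]
    show "((\<lambda>s. (?x s - x0) \<bullet> w) has_vector_derivative f' s) (at s)" using s by (simp add: f'_def)
  qed (use t in auto)
  have pwt: "pw_C1 A 0 t \<gamma>" by (rule pw_C1_sub[OF \<gamma>(1)]) (use t in auto)
  have "len \<gamma> 0 t \<le> ennreal l" using len_glue[OF \<gamma>(1), of t] t l(1) by (metis atLeastAtMost_iff le_iff_add)
  then obtain l' where l': "len \<gamma> 0 t = ennreal l'" "0 \<le> l'" "l' \<le> l" using l(2)
    by (cases "len \<gamma> 0 t") (auto simp: top_unique)
  have "(curve_speed A g \<gamma> has_integral l') {0..t}"
    using curve_speed_measurable[OF pwt] curve_speed_nonneg l'
    by (intro has_integral_nn_integral_on) (auto simp: len_eq)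
  then have int2: "((\<lambda>s. norm w / m * curve_speed A g \<gamma> s) has_integral (norm w / m * l')) {0..t}"
    by (rule has_integral_mult_right)
  have "(?x t - x0) \<bullet> w - (?x 0 - x0) \<bullet> w \<le> norm w / m * l'"
  proof (rule has_integral_le[OF int int2])
    fix s assume s: "s \<in> {0..t}"
    have nn: "0 \<le> norm w / m * curve_speed A g \<gamma> s" using m(1) curve_speed_nonneg by simp
    show "f' s \<le> norm w / m * curve_speed A g \<gamma> s"
    proof (cases "s \<in> S")
      case False
      then have s': "s \<in> {0<..<t} - S" using s by (auto simp: S_def)
      have "(m * norm (D s))^2 \<le> D s \<bullet> (g c (?x s) *v D s)"
        using m(2)[OF xin(1)[OF s], of "D s"] by (simp add: power_mult_distrib dot_square_norm)
      then have "m * norm (D s) \<le> sqrt (D s \<bullet> (g c (?x s) *v D s))" by (intro real_le_rsqrt)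
      also have "\<dots> = curve_speed A g \<gamma> s"
        using curve_speed_chart[OF c xin(2)[OF s] good(2,1)[OF s']] by simp
      finally have "norm (D s) \<le> curve_speed A g \<gamma> s / m" using m(1) by (simp add: field_simps)
      then have "norm (D s) * norm w \<le> curve_speed A g \<gamma> s / m * norm w" by (intro mult_right_mono) auto
      then show ?thesis using False norm_cauchy_schwarz[of "D s" w] by (simp add: f'_def mult_ac)
    qed (use nn in \<open>simp add: f'_def\<close>)
  qed
  then have "norm w * norm w \<le> norm w * (l' / m)" by (simp add: x00 w_def dot_square_norm power2_eq_square)
  moreover have "0 \<le> l' / m" using l'(2) m(1) by simp
  ultimately have "norm w \<le> l' / m"
    using mult_left_le_imp_le[of "norm w" "norm w" "l' / m"] by (cases "norm w = 0") (auto simp del: times_divide_eq_right)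
  also have "\<dots> \<le> l / m" using l'(3) m(1) by (intro divide_right_mono) auto
  finally show ?thesis by (simp add: w_def)
qed

text \<open>A curve of length l < m s cannot leave the coordinate ball. Before its first exit time
  \<tau> it stays in the image of the closed ball of radius l/m < s; this image is compact, hence
  closed in a Hausdorff space, so the point at \<tau> still belongs to it.\<close>

lemma rdist_chart_ball:
  assumes c: "c \<in> A" and r: "cball x0 r \<subseteq> chart_img c" and m: "m > 0"
    "\<And>z v. z \<in> cball x0 r \<Longrightarrow> m^2 * (v \<bullet> v) \<le> v \<bullet> (g c z *v v)"
    and s: "0 < s" "s \<le> r" and q: "rdist (chart_inv c x0) q < ennreal (m * s)"
  shows "q \<in> chart_inv c ` ball x0 s"
proof (rule ccontr)
  assume nq: "q \<notin> chart_inv c ` ball x0 s"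
  let ?B = "chart_inv c ` ball x0 s"
  have sub: "ball x0 s \<subseteq> chart_img c" "cball x0 s \<subseteq> cball x0 r" using r s by auto
  have B: "open ?B" by (rule open_inv_image[OF c _ sub(1)]) simp
  obtain \<gamma> where \<gamma>: "pw_C1 A 0 1 \<gamma>" "\<gamma> 0 = chart_inv c x0" "\<gamma> 1 = q" "len \<gamma> 0 1 < ennreal (m * s)"
    using rdist_lessE[OF q] .
  obtain l where l: "len \<gamma> 0 1 = ennreal l" "0 \<le> l" using \<gamma>(4) by (cases "len \<gamma> 0 1") auto
  have ls: "l / m < s" using \<gamma>(4) l m(1) s(1) by (simp add: ennreal_less_iff field_simps)
  let ?K = "chart_inv c ` cball x0 (l / m)"
  have Ksub: "cball x0 (l / m) \<subseteq> ball x0 s" using ls by auto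
  then have "compact ?K"
    by (intro compact_continuous_image continuous_on_subset[OF cont_inv[OF c]]) (use sub in auto)
  then have K: "closed ?K" by (rule compact_imp_closed)
  have cont: "continuous_on {0..1} \<gamma>" by (rule pw_C1_continuous[OF \<gamma>(1)])
  define T where "T = {0..1} \<inter> \<gamma> -` (- ?B)"
  have T: "closed T" unfolding T_def by (rule continuous_closed_preimage[OF cont]) (use B in auto)
  have T1: "1 \<in> T" using nq \<gamma>(3) by (simp add: T_def)
  have bdd: "bdd_below T" unfolding T_def by (rule bdd_belowI[of _ 0]) auto
  define \<tau> where "\<tau> = Inf T"
  have \<tau>: "\<tau> \<in> T" unfolding \<tau>_def using closed_contains_Inf[OF _ bdd T] T1 by blast
  then have \<tau>01: "\<tau> \<in> {0..1}" "\<gamma> \<tau> \<notin> ?B" by (auto simp: T_def)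
  have below: "\<gamma> t \<in> ?B" if "0 \<le> t" "t < \<tau>" for t
  proof (rule ccontr)
    assume "\<gamma> t \<notin> ?B"
    then have "t \<in> T" using that \<tau>01 by (simp add: T_def)
    then have "\<tau> \<le> t" unfolding \<tau>_def using bdd by (rule cInf_lower)
    then show False using that by simp
  qed
  have "\<gamma> 0 \<in> ?B" using \<gamma>(2) s by auto
  then have \<tau>0: "\<tau> \<noteq> 0" using \<tau>01 by metis
  have inK: "\<gamma> t \<in> ?K" if t: "0 \<le> t" "t < \<tau>" for t
  proof -
    have st: "\<gamma> u \<in> chart_inv c ` cball x0 s" if "u \<in> {0..t}" for u using below[of u] that t by auto
    have "norm (coords c (\<gamma> t) - x0) \<le> l / m"
      by (rule coords_displacement_le[OF c _ m(1) _ \<gamma>(1,2) l, of s])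
        (use sub(2) r m(2) s t \<tau>01 st in auto)
    moreover have "\<gamma> t = chart_inv c (coords c (\<gamma> t))"
    proof -
      obtain z where "z \<in> ball x0 s" "\<gamma> t = chart_inv c z" using below[OF t] by blast
      then show ?thesis using coords_inv[OF c, of z] sub(1) by auto
    qed
    ultimately show ?thesis by (intro image_eqI) (auto simp: dist_norm norm_minus_commute)
  qed
  have "closed ({0..1} \<inter> \<gamma> -` ?K)" by (rule continuous_closed_preimage[OF cont _ K]) simp
  moreover have "{0..<\<tau>} \<subseteq> {0..1} \<inter> \<gamma> -` ?K" using inK \<tau>01 by auto
  ultimately have "closure {0..<\<tau>} \<subseteq> {0..1} \<inter> \<gamma> -` ?K" by (rule closure_minimal[rotated])
  moreover have "closure {0..<\<tau>} = {0..\<tau>}" using \<tau>0 \<tau>01 by (intro closure_atLeastLessThan) auto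
  ultimately have "\<gamma> \<tau> \<in> ?K" using \<tau>01 by auto
  then show False using Ksub \<tau>01 by blast
qed

lemma rdist_chart_comparison:
  assumes c: "c \<in> A" and x0: "x0 \<in> chart_img c"
  obtains r m M where "r > 0" "m > 0" "M > 0" "cball x0 r \<subseteq> chart_img c"
    "\<And>x. x \<in> cball x0 r \<Longrightarrow> rdist (chart_inv c x0) (chart_inv c x) \<le> ennreal (M * dist x0 x)"
    "\<And>q s. 0 < s \<Longrightarrow> s \<le> r \<Longrightarrow> rdist (chart_inv c x0) q < ennreal (m * s) \<Longrightarrow> q \<in> chart_inv c ` ball x0 s"
proof -
  obtain r where r: "r > 0" "cball x0 r \<subseteq> chart_img c"
    "\<And>z v. z \<in> cball x0 r \<Longrightarrow> v \<bullet> (g c x0 *v v) \<le> 2 * (v \<bullet> (g c z *v v))"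
    "\<And>z v. z \<in> cball x0 r \<Longrightarrow> v \<bullet> (g c z *v v) \<le> 2 * (v \<bullet> (g c x0 *v v))"
    using metric_local_bounds[OF c x0] by metis
  obtain m M where mM: "m > 0" "M > 0" "\<And>v. m * (v \<bullet> v) \<le> v \<bullet> (g c x0 *v v)"
    "\<And>v. v \<bullet> (g c x0 *v v) \<le> M * (v \<bullet> v)"
    using pos_def_bounds[OF metric_pos_def[OF c x0]] by metis
  show thesis
  \<comment> \<open>The factor 2 between the metric in the ball and at its centre enters both
    constants under the square root.\<close>
  proof (rule that[of r "sqrt (m / 2)" "sqrt (2 * M)"])
    fix x assume x: "x \<in> cball x0 r"
    have seg: "x0 + s *\<^sub>R (x - x0) \<in> cball x0 r" if "s \<in> {0..1}" for s
    proof -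
      have "norm (s *\<^sub>R (x - x0)) \<le> 1 * norm (x - x0)"
        unfolding norm_scaleR using that by (intro mult_right_mono) auto
      then show ?thesis using x by (simp add: dist_norm norm_minus_commute)
    qed
    have "rdist (chart_inv c x0) (chart_inv c (x0 + (x - x0))) \<le> ennreal (sqrt (2 * M) * dist x0 x)"
    proof (rule rdist_segment[OF c])
      fix s :: real assume "s \<in> {0..1}"
      note z = seg[OF this]
      show "x0 + s *\<^sub>R (x - x0) \<in> chart_img c" using z r(2) by blast
      have "(x - x0) \<bullet> (g c (x0 + s *\<^sub>R (x - x0)) *v (x - x0)) \<le> 2 * (M * ((x - x0) \<bullet> (x - x0)))"
        using r(4)[OF z, of "x - x0"] mM(4)[of "x - x0"] by linarith
      also have "\<dots> = (sqrt (2 * M) * dist x0 x)^2"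
        using mM(2) by (simp add: power_mult_distrib dist_norm norm_minus_commute dot_square_norm)
      finally show "(x - x0) \<bullet> (g c (x0 + s *\<^sub>R (x - x0)) *v (x - x0)) \<le> (sqrt (2 * M) * dist x0 x)^2" .
    qed (use mM in auto)
    then show "rdist (chart_inv c x0) (chart_inv c x) \<le> ennreal (sqrt (2 * M) * dist x0 x)" by simp
  next
    fix q s assume s: "0 < s" "s \<le> r" "rdist (chart_inv c x0) q < ennreal (sqrt (m / 2) * s)"
    show "q \<in> chart_inv c ` ball x0 s"
    proof (rule rdist_chart_ball[OF c r(2) _ _ s])
      fix z v assume z: "z \<in> cball x0 r"
      show "(sqrt (m / 2))^2 * (v \<bullet> v) \<le> v \<bullet> (g c z *v v)"
        using r(3)[OF z, of v] mM(3)[of v] mM(1) by simp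
    qed (use mM in auto)
  qed (use r mM in auto)
qed

section \<open>Distance balls and the topology of the manifold\<close>

lemma rdist_small_nbhd:
  assumes "e > 0"
  obtains U where "open U" "p \<in> U" "\<And>q. q \<in> U \<Longrightarrow> rdist p q < ennreal e"
proof -
  obtain c where c: "c \<in> A" "p \<in> chart_dom c" using charts_cover by blast
  let ?x = "coords c p"
  obtain r m M where r: "r > 0" "M > 0" "cball ?x r \<subseteq> chart_img c"
    "\<And>x. x \<in> cball ?x r \<Longrightarrow> rdist (chart_inv c ?x) (chart_inv c x) \<le> ennreal (M * dist ?x x)"
    using rdist_chart_comparison[OF c(1) coords_in[OF c]] by metis
  define s where "s = min r (e / (2 * M))"
  have s: "0 < s" "s \<le> r" "M * s < e" using r assms by (auto simp: s_def min_def field_simps)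
  show thesis
  proof (rule that[of "chart_inv c ` ball ?x s"])
    have "ball ?x s \<subseteq> cball ?x r" using s by auto
    then show "open (chart_inv c ` ball ?x s)" using r(3) by (intro open_inv_image[OF c(1)]) auto
    show "p \<in> chart_inv c ` ball ?x s" using inv_coords[OF c] s by (intro image_eqI[of p _ ?x]) auto
    fix q assume "q \<in> chart_inv c ` ball ?x s"
    then obtain x where x: "dist ?x x < s" "q = chart_inv c x" by auto
    then have "rdist p q \<le> ennreal (M * dist ?x x)" using r(4)[of x] s inv_coords[OF c] by simp
    also have "\<dots> < ennreal e"
    proof (rule ennreal_lessI[OF assms])
      have "M * dist ?x x \<le> M * s" using x r by (intro mult_left_mono) auto
      then show "M * dist ?x x < e" using s by simp
    qed
    finally show "rdist p q < ennreal e" .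
  qed
qed

lemma open_rdist_less: "open {q. rdist p q < R}"
proof (rule Topological_Spaces.openI)
  fix q assume "q \<in> {q. rdist p q < R}"
  then obtain e where e: "e > 0" "rdist p q + ennreal e < R" using ennreal_gap by blast
  obtain U where U: "open U" "q \<in> U" "\<And>q'. q' \<in> U \<Longrightarrow> rdist q q' < ennreal e"
    using rdist_small_nbhd[OF e(1)] by metis
  have "U \<subseteq> {q. rdist p q < R}"
  proof
    fix q' assume "q' \<in> U"
    have "rdist p q' \<le> rdist p q + rdist q q'" by (rule rdist_triangle)
    also have "\<dots> \<le> rdist p q + ennreal e" using U(3)[OF \<open>q' \<in> U\<close>] by (intro add_left_mono) simp
    also note e(2)
    finally show "q' \<in> {q. rdist p q < R}" by simp
  qed
  then show "\<exists>T. open T \<and> q \<in> T \<and> T \<subseteq> {q. rdist p q < R}" using U by blast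
qed

lemma closed_rdist_le: "closed {q. rdist p q \<le> R}"
  unfolding closed_def
proof (rule Topological_Spaces.openI)
  fix q assume "q \<in> - {q. rdist p q \<le> R}"
  then have "R < rdist p q" by simp
  then obtain e where e: "e > 0" "R + ennreal e < rdist p q" using ennreal_gap by blast
  obtain U where U: "open U" "q \<in> U" "\<And>q'. q' \<in> U \<Longrightarrow> rdist q q' < ennreal e"
    using rdist_small_nbhd[OF e(1)] by metis
  have "U \<subseteq> - {q. rdist p q \<le> R}"
  proof
    fix q' assume "q' \<in> U"
    show "q' \<in> - {q. rdist p q \<le> R}"
    proof (rule ccontr)
      assume "q' \<notin> - {q. rdist p q \<le> R}"
      then have le: "rdist p q' \<le> R" by simp
      have "rdist p q \<le> rdist p q' + rdist q' q" by (rule rdist_triangle)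
      also have "\<dots> \<le> R + ennreal e"
        using le U(3)[OF \<open>q' \<in> U\<close>] rdist_sym[of q q'] by (intro add_mono) auto
      finally show False using e(2) by simp
    qed
  qed
  then show "\<exists>T. open T \<and> q \<in> T \<and> T \<subseteq> - {q. rdist p q \<le> R}" using U by blast
qed

text \<open>A small metric ball is a closed subset of the compact image of a closed coordinate
  ball.\<close>

lemma small_balls_compact: "\<exists>e>0. compact {q. rdist p q \<le> ennreal e}"
proof -
  obtain c where c: "c \<in> A" "p \<in> chart_dom c" using charts_cover by blast
  let ?x = "coords c p"
  obtain r m M where r: "r > 0" "m > 0" "cball ?x r \<subseteq> chart_img c"
    "\<And>q s. 0 < s \<Longrightarrow> s \<le> r \<Longrightarrow> rdist (chart_inv c ?x) q < ennreal (m * s) \<Longrightarrow> q \<in> chart_inv c ` ball ?x s"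
    using rdist_chart_comparison[OF c(1) coords_in[OF c]] by metis
  let ?K = "chart_inv c ` cball ?x r" and ?B = "{q. rdist p q \<le> ennreal (m * r / 2)}"
  have "?B \<subseteq> ?K"
  proof
    fix q assume "q \<in> ?B"
    then have "rdist p q \<le> ennreal (m * r / 2)" by simp
    also have "\<dots> < ennreal (m * r)" using r by (intro ennreal_lessI) auto
    finally have "q \<in> chart_inv c ` ball ?x r" using r inv_coords[OF c] by (intro r(4)) auto
    then show "q \<in> ?K" by auto
  qed
  moreover have "compact ?K"
    by (intro compact_continuous_image continuous_on_subset[OF cont_inv[OF c(1)] r(3)]) simp
  ultimately have "compact ?B" using compact_Int_closed[OF _ closed_rdist_le, of ?K p "ennreal (m * r / 2)"]
    by (simp add: Int_absorb1)
  then show ?thesis using r by (intro exI[of _ "m * r / 2"]) simp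
qed

lemma compact_rdist_mono:
  assumes "compact {q. rdist p q \<le> ennreal r}" "\<And>q. rdist p' q \<le> ennreal r' \<Longrightarrow> rdist p q \<le> ennreal r"
  shows "compact {q. rdist p' q \<le> ennreal r'}"
proof -
  have "{q. rdist p q \<le> ennreal r} \<inter> {q. rdist p' q \<le> ennreal r'} = {q. rdist p' q \<le> ennreal r'}"
    using assms(2) by auto
  then show ?thesis using compact_Int_closed[OF assms(1) closed_rdist_le, of p' "ennreal r'"] by simp
qed

text \<open>A curve from p to y of length less than b is cut where it first leaves the open ball of
  radius a. The cut point has distance exactly a from p, so at least a of the length is spent there
  and at most b - a remains.\<close>

lemma rdist_split:
  assumes py: "rdist p y < ennreal b" "\<not> rdist p y \<le> ennreal a" and a: "0 < a" "a < b"
  obtains q where "rdist p q \<le> ennreal a" "rdist q y \<le> ennreal (b - a)"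
proof -
  obtain \<gamma> where \<gamma>: "pw_C1 A 0 1 \<gamma>" "\<gamma> 0 = p" "\<gamma> 1 = y" "len \<gamma> 0 1 < ennreal b" using rdist_lessE[OF py(1)] .
  have cont: "continuous_on {0..1} \<gamma>" by (rule pw_C1_continuous[OF \<gamma>(1)])
  let ?B = "{q. rdist p q < ennreal a}"
  define T where "T = {0..1} \<inter> \<gamma> -` (- ?B)"
  have T: "closed T" unfolding T_def by (rule continuous_closed_preimage[OF cont]) (use open_rdist_less in auto)
  have T1: "1 \<in> T" using py(2) \<gamma>(3) by (auto simp: T_def)
  have bdd: "bdd_below T" unfolding T_def by (rule bdd_belowI[of _ 0]) auto
  define \<tau> where "\<tau> = Inf T"
  have \<tau>: "\<tau> \<in> T" unfolding \<tau>_def using closed_contains_Inf[OF _ bdd T] T1 by blast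
  then have \<tau>01: "\<tau> \<in> {0..1}" and \<tau>a: "ennreal a \<le> rdist p (\<gamma> \<tau>)" by (auto simp: T_def)
  have below: "rdist p (\<gamma> t) \<le> ennreal a" if "0 \<le> t" "t < \<tau>" for t
  proof (rule ccontr)
    assume "\<not> ?thesis"
    then have "t \<in> T" using that \<tau>01 by (simp add: T_def)
    then have "\<tau> \<le> t" unfolding \<tau>_def using bdd by (rule cInf_lower)
    then show False using that by simp
  qed
  have \<tau>0: "\<tau> \<noteq> 0" using \<tau>a \<gamma>(2) rdist_refl[of p] a by (auto simp: ennreal_eq_0_iff)
  have "closed ({0..1} \<inter> \<gamma> -` {q. rdist p q \<le> ennreal a})"
    by (rule continuous_closed_preimage[OF cont _ closed_rdist_le]) simp
  moreover have "{0..<\<tau>} \<subseteq> {0..1} \<inter> \<gamma> -` {q. rdist p q \<le> ennreal a}" using below \<tau>01 by auto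
  ultimately have "closure {0..<\<tau>} \<subseteq> {0..1} \<inter> \<gamma> -` {q. rdist p q \<le> ennreal a}" by (rule closure_minimal[rotated])
  moreover have "closure {0..<\<tau>} = {0..\<tau>}" using \<tau>0 \<tau>01 by (intro closure_atLeastLessThan) auto
  ultimately have le: "rdist p (\<gamma> \<tau>) \<le> ennreal a" using \<tau>01 by auto
  then have "\<tau> \<noteq> 1" using py(2) \<gamma>(3) by auto
  then have \<tau>1: "0 < \<tau>" "\<tau> < 1" using \<tau>01 \<tau>0 by auto
  have "ennreal a \<le> len \<gamma> 0 \<tau>"
    using \<tau>a rdist_le_len[OF pw_C1_sub[OF \<gamma>(1), of 0 \<tau>]] \<tau>1 \<gamma>(2) by (auto intro: order_trans)
  moreover have "len \<gamma> 0 1 = len \<gamma> 0 \<tau> + len \<gamma> \<tau> 1" using \<tau>1 by (intro len_glue[OF \<gamma>(1)]) auto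
  ultimately have "ennreal a + len \<gamma> \<tau> 1 < ennreal b" using \<gamma>(4) by (metis add_right_mono order_le_less_trans)
  then have "len \<gamma> \<tau> 1 \<le> ennreal (b - a)"
    using a by (cases "len \<gamma> \<tau> 1") (auto simp: ennreal_plus[symmetric] ennreal_less_iff simp del: ennreal_plus intro!: ennreal_leI)
  then have "rdist (\<gamma> \<tau>) y \<le> ennreal (b - a)"
    using rdist_le_len[OF pw_C1_sub[OF \<gamma>(1), of \<tau> 1]] \<tau>1 \<gamma>(3) by (auto intro: order_trans)
  with le show thesis by (rule that)
qed

text \<open>If no closed ball of radius \<open>s\<close> about a point of a compact ball \<open>B(p, a)\<close> failed to be
  compact, then finitely many of them would cover the larger ball \<open>B(p, r)\<close>.\<close>

lemma noncompact_ball_step: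
  assumes nc: "\<not> compact {q. rdist p q \<le> ennreal r}" and a: "compact {q. rdist p q \<le> ennreal a}"
    and "0 < a" "a < r" "r < a + s"
  shows "\<exists>q. rdist p q \<le> ennreal a \<and> \<not> compact {y. rdist q y \<le> ennreal s}"
proof (rule ccontr)
  assume "\<not> ?thesis"
  then have good: "compact {y. rdist q y \<le> ennreal s}" if "rdist p q \<le> ennreal a" for q using that by blast
  let ?K = "{q. rdist p q \<le> ennreal a}"
  \<comment> \<open>Half of the slack a + s - r: some centre of the finite cover is within d of q,
    and q is within r + d - a of y, which adds up to s.\<close>
  define d where "d = (a + s - r) / 2"
  have d: "d > 0" using assms by (simp add: d_def)
  have "?K \<subseteq> (\<Union>q\<in>?K. {y. rdist q y < ennreal d})" using rdist_refl d by auto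
  then obtain F where F: "F \<subseteq> ?K" "finite F" "?K \<subseteq> (\<Union>q\<in>F. {y. rdist q y < ennreal d})"
    using compactE_image[OF a, of ?K "\<lambda>q. {y. rdist q y < ennreal d}"] open_rdist_less by metis
  have sub: "{q. rdist p q \<le> ennreal r} \<subseteq> ?K \<union> (\<Union>q\<in>F. {y. rdist q y \<le> ennreal s})"
  proof
    fix y assume y: "y \<in> {q. rdist p q \<le> ennreal r}"
    show "y \<in> ?K \<union> (\<Union>q\<in>F. {y. rdist q y \<le> ennreal s})"
    proof (cases "y \<in> ?K")
      case False
      have "rdist p y < ennreal (r + d)" using y d assms by (auto intro: order_le_less_trans ennreal_lessI)
      then obtain q where q: "rdist p q \<le> ennreal a" "rdist q y \<le> ennreal (r + d - a)"
        using rdist_split[of p y "r + d" a] False assms d by auto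
      then obtain q' where q': "q' \<in> F" "rdist q' q < ennreal d" using F(3) by blast
      have "rdist q' y \<le> rdist q' q + rdist q y" by (rule rdist_triangle)
      also have "\<dots> \<le> ennreal d + ennreal (r + d - a)" using q q' by (intro add_mono) auto
      also have "\<dots> = ennreal s" using d assms by (subst ennreal_plus[symmetric]) (auto simp: d_def field_simps)
      finally show ?thesis using q' by blast
    qed simp
  qed
  have "compact (?K \<union> (\<Union>q\<in>F. {y. rdist q y \<le> ennreal s}))"
    using F good by (intro compact_Un a compact_UN) auto
  from compact_Int_closed[OF this closed_rdist_le] sub have "compact {q. rdist p q \<le> ennreal r}"
    by (metis Int_absorb1)
  then show False using nc by simp
qed

text \<open>Shrinking the radius by factors 4/5 reaches a compact ball. At the last noncompact
  radius r', \<open>noncompact_ball_step\<close> applies with a = (4/5) r' and s = r'/2, because 4/5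
  + 1/2 > 1; both radii in the conclusion may then be enlarged from r' to r.\<close>

lemma noncompact_ball_halving:
  assumes nc: "\<not> compact {q. rdist p q \<le> ennreal r}" and r: "r > 0"
  shows "\<exists>q. rdist p q \<le> ennreal r \<and> \<not> compact {y. rdist q y \<le> ennreal (r / 2)}"
proof -
  obtain e where e: "e > 0" "compact {q. rdist p q \<le> ennreal e}" using small_balls_compact by blast
  have mono: "compact {q. rdist p q \<le> ennreal u}" if "compact {q. rdist p q \<le> ennreal v}" "u \<le> v" for p u v
    using that by (intro compact_rdist_mono[OF that(1)]) (auto intro: order_trans ennreal_leI)
  define G where "G k \<longleftrightarrow> compact {q. rdist p q \<le> ennreal ((4/5)^k * r)}" for k :: nat
  obtain n where "(4/5::real)^n < e / r" using real_arch_pow_inv[of "e / r" "4/5"] e r by auto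
  then have "(4/5::real)^n * r \<le> e" using r by (simp add: field_simps)
  then have "G n" unfolding G_def by (rule mono[OF e(2)])
  define k where "k = (LEAST k. G k)"
  have Gk: "G k" unfolding k_def using \<open>G n\<close> by (rule LeastI)
  have "k \<noteq> 0"
  proof
    assume "k = 0"
    then show False using Gk nc by (simp add: G_def)
  qed
  then obtain j where j: "k = Suc j" by (cases k) auto
  have nGj: "\<not> G j" using not_less_Least[of j G] j by (simp add: k_def)
  define r' where "r' = (4/5)^j * r"
  have r': "0 < r'" "r' \<le> r" using r power_le_one[of "4/5::real" j] by (auto simp: r'_def)
  have "compact {q. rdist p q \<le> ennreal (4/5 * r')}" using Gk by (simp add: G_def j r'_def mult.assoc)
  then obtain q where q: "rdist p q \<le> ennreal (4/5 * r')" "\<not> compact {y. rdist q y \<le> ennreal (r' / 2)}"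
    using noncompact_ball_step[of p r' "4/5 * r'" "r' / 2"] nGj r' by (auto simp: G_def r'_def)
  have "rdist p q \<le> ennreal r" using q(1) by (rule order_trans) (use r' in \<open>auto intro: ennreal_leI\<close>)
  moreover have "\<not> compact {y. rdist q y \<le> ennreal (r / 2)}" using q(2) mono[of q "r / 2" "r' / 2"] r' by auto
  ultimately show ?thesis by blast
qed

text \<open>If some ball is not compact, repeated halving yields noncompact balls of radius R/2^n
  whose centres form a Cauchy sequence. Around the limit some ball is compact, and it contains the
  late noncompact balls.\<close>

theorem Hopf_Rinow:
  assumes complete: "riemannian_complete A g"
  shows "compact {q. rdist p q \<le> ennreal r}"
proof (rule ccontr)
  assume nc: "\<not> ?thesis"
  \<comment> \<open>Halving needs a positive radius, and enlarging the ball preserves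
    noncompactness.\<close>
  define R where "R = max r 1"
  have R: "R > 0" by (simp add: R_def)
  have "\<not> compact {q. rdist p q \<le> ennreal R}"
  proof
    assume "compact {q. rdist p q \<le> ennreal R}"
    then have "compact {q. rdist p q \<le> ennreal r}"
      by (rule compact_rdist_mono) (auto simp: R_def intro: order_trans ennreal_leI)
    then show False using nc by simp
  qed
  define bad where "bad n q \<longleftrightarrow> \<not> compact {y. rdist q y \<le> ennreal (R / 2^n)}" for n :: nat and q
  have "\<exists>q. bad 0 q" using \<open>\<not> compact {q. rdist p q \<le> ennreal R}\<close> by (auto simp: bad_def)
  moreover have "\<exists>q'. bad (Suc n) q' \<and> rdist q q' \<le> ennreal (R / 2^n)" if "bad n q" for q n
    using noncompact_ball_halving[of q "R / 2^n"] that R by (auto simp: bad_def field_simps)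
  ultimately obtain \<sigma> where \<sigma>: "\<And>n. bad n (\<sigma> n)" "\<And>n. rdist (\<sigma> n) (\<sigma> (Suc n)) \<le> ennreal (R / 2^n)"
    using dependent_nat_choice[of bad "\<lambda>n q q'. rdist q q' \<le> ennreal (R / 2^n)"] by metis
  \<comment> \<open>The exact geometric partial sum is kept as the bound so that the induction
    closes.\<close>
  have step: "rdist (\<sigma> n) (\<sigma> (n + k)) \<le> ennreal (2 * R / 2^n - 2 * R / 2^(n + k))" for n k
  proof (induction k)
    case (Suc k)
    have "rdist (\<sigma> n) (\<sigma> (n + Suc k)) \<le> rdist (\<sigma> n) (\<sigma> (n + k)) + rdist (\<sigma> (n + k)) (\<sigma> (Suc (n + k)))"
      using rdist_triangle by simp
    also have "\<dots> \<le> ennreal (2 * R / 2^n - 2 * R / 2^(n + k)) + ennreal (R / 2^(n + k))"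
      by (intro add_mono Suc \<sigma>)
    also have "\<dots> = ennreal (2 * R / 2^n - 2 * R / 2^(n + k) + R / 2^(n + k))"
    proof (rule ennreal_plus[symmetric])
      have "R / 2^(n + k) \<le> R / 2^n" using R by (intro divide_left_mono) auto
      then show "0 \<le> 2 * R / 2^n - 2 * R / 2^(n + k)" by simp
    qed (use R in simp)
    also have "2 * R / 2^n - 2 * R / 2^(n + k) + R / 2^(n + k) = 2 * R / 2^n - 2 * R / 2^(n + Suc k)"
      by (simp add: field_simps)
    finally show ?case .
  qed (simp add: rdist_refl)
  have close: "rdist (\<sigma> m) (\<sigma> n) \<le> ennreal (2 * R / 2^m)" if "m \<le> n" for m n
  proof -
    have "rdist (\<sigma> m) (\<sigma> (m + (n - m))) \<le> ennreal (2 * R / 2^m - 2 * R / 2^(m + (n - m)))" by (rule step)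
    also have "\<dots> \<le> ennreal (2 * R / 2^m)" using R by (intro ennreal_leI) simp
    finally show ?thesis using that by simp
  qed
  have small: "\<exists>N. \<forall>n\<ge>N. 2 * R / 2^n < e" if "e > 0" for e :: real
  proof -
    have "0 < e / (2 * R)" using \<open>e > 0\<close> R by simp
    then obtain N where N: "(1/2::real)^N < e / (2 * R)" using real_arch_pow_inv[of "e / (2 * R)" "1/2"] by auto
    have "2 * R / 2^n < e" if "n \<ge> N" for n
    proof -
      have "(1/2::real)^n \<le> (1/2)^N" using that by (intro power_decreasing) auto
      then have "(1/2::real)^n < e / (2 * R)" using N by (rule order_le_less_trans)
      then show ?thesis using R by (simp add: power_one_over field_simps)
    qed
    then show ?thesis by blast
  qed
  have "\<exists>x. (\<lambda>n. rdist (\<sigma> n) x) \<longlonglongrightarrow> 0"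
  proof (rule complete[unfolded riemannian_complete_def, rule_format])
    fix e :: ennreal assume "0 < e"
    then obtain e' :: real where e': "0 < e'" "ennreal e' < e" using ennreal_gap[of 0 e] by auto
    obtain N where N: "\<forall>n\<ge>N. 2 * R / 2^n < e'" using small[OF e'(1)] by blast
    have le: "rdist (\<sigma> m) (\<sigma> n) < e" if "m \<ge> N" "m \<le> n" for m n
    proof -
      have "rdist (\<sigma> m) (\<sigma> n) \<le> ennreal e'"
        using close[OF that(2)] N that(1) by (meson ennreal_leI less_imp_le order_trans)
      then show ?thesis using e'(2) by simp
    qed
    have "rdist (\<sigma> m) (\<sigma> n) < e" if "m \<ge> N" "n \<ge> N" for m n
      using le[of m n] le[of n m] that rdist_sym[of "\<sigma> m" "\<sigma> n"] by (cases "m \<le> n") auto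
    then show "\<exists>N. \<forall>m\<ge>N. \<forall>n\<ge>N. rdist (\<sigma> m) (\<sigma> n) < e" by blast
  qed
  then obtain x where x: "(\<lambda>n. rdist (\<sigma> n) x) \<longlonglongrightarrow> 0" by blast
  obtain e where e: "e > 0" "compact {q. rdist x q \<le> ennreal e}" using small_balls_compact by blast
  \<comment> \<open>Half of e is reserved for the distance from the limit to the centre, the other
    half for the radius.\<close>
  obtain N where N: "\<forall>n\<ge>N. 2 * R / 2^n < e / 2" using small[of "e / 2"] e by auto
  have "eventually (\<lambda>n. rdist (\<sigma> n) x < ennreal (e / 2)) sequentially"
    using order_tendstoD(2)[OF x, of "ennreal (e / 2)"] e by simp
  then obtain n where n: "n \<ge> N" "rdist (\<sigma> n) x < ennreal (e / 2)"
    unfolding eventually_sequentially by (metis nle_le)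
  have "compact {y. rdist (\<sigma> n) y \<le> ennreal (R / 2^n)}"
  proof (rule compact_rdist_mono[OF e(2)])
    fix y assume y: "rdist (\<sigma> n) y \<le> ennreal (R / 2^n)"
    have "2 * R / 2^n < e / 2" using N n(1) by blast
    moreover have "R / 2^n \<le> 2 * R / 2^n" using R by (intro divide_right_mono) auto
    ultimately have "R / 2^n \<le> e / 2" by linarith
    then have "rdist (\<sigma> n) y \<le> ennreal (e / 2)" using y by (meson ennreal_leI order_trans)
    moreover have "rdist x (\<sigma> n) \<le> ennreal (e / 2)" using n(2) rdist_sym[of x "\<sigma> n"] by simp
    ultimately have "rdist x (\<sigma> n) + rdist (\<sigma> n) y \<le> ennreal (e / 2) + ennreal (e / 2)"
      by (intro add_mono)
    then have "rdist x y \<le> ennreal (e / 2) + ennreal (e / 2)" using rdist_triangle by (rule order_trans[rotated])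
    also have "\<dots> = ennreal e" using e by (subst ennreal_plus[symmetric]) auto
    finally show "rdist x y \<le> ennreal e" .
  qed
  then show False using \<sigma>(1)[of n] by (simp add: bad_def)
qed

end

section \<open>Integration by parts against Lipschitz functions\<close>

lemma abs_diff_power2_le:
  fixes a b d :: real
  assumes "\<bar>a - b\<bar> \<le> d" "0 \<le> b"
  shows "\<bar>a^2 - b^2\<bar> \<le> d * (2 * b + d)"
proof -
  have "a^2 - b^2 = (a - b) * (2 * b + (a - b))" by (simp add: power2_eq_square algebra_simps)
  then have "\<bar>a^2 - b^2\<bar> = \<bar>a - b\<bar> * \<bar>2 * b + (a - b)\<bar>" by (simp add: abs_mult)
  also have "\<dots> \<le> d * (2 * b + d)" using assms by (intro mult_mono) auto
  finally show ?thesis .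
qed

text \<open>Translation invariance of Lebesgue measure moves the difference quotient from \<open>z\<close> to
  \<open>\<eta>\<^sup>2\<close>, so that \<open>\<eta>\<close> need not be differentiable.\<close>

lemma integral_directional_derivative_bound:
  fixes z \<eta> :: "'a::euclidean_space \<Rightarrow> real" and e :: 'a
  assumes K: "compact K" and U: "open U" and KU: "K \<subseteq> U"
    and z: "\<And>x. (z has_derivative z' x) (at x)" and cz': "continuous_on UNIV (\<lambda>x. z' x e)"
    and z0: "\<And>x. x \<notin> K \<Longrightarrow> z x = 0"
    and \<eta>: "continuous_on U \<eta>" "\<And>x. x \<in> U \<Longrightarrow> 0 \<le> \<eta> x"
    and "0 < \<delta>" "0 \<le> \<Lambda>"
    and lip: "\<And>x t. x \<in> K \<Longrightarrow> 0 < t \<Longrightarrow> t \<le> \<delta> \<Longrightarrow> x + t *\<^sub>R e \<in> U \<and> \<bar>\<eta> (x + t *\<^sub>R e) - \<eta> x\<bar> \<le> \<Lambda> * t"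
  shows "\<bar>\<integral>x. indicator K x * ((\<eta> x)^2 * z' x e) \<partial>lborel\<bar> \<le> 2 * \<Lambda> * (\<integral>x. indicator K x * (\<eta> x * \<bar>z x\<bar>) \<partial>lborel)"
proof -
  \<comment> \<open>f is measurable but may jump at the boundary of U; only z is ever
    differentiated.\<close>
  define f where "f x = indicator U x * (\<eta> x)^2" for x
  have mf: "f \<in> borel_measurable borel"
    unfolding f_def using borel_measurable_continuous_on_indicator[OF borel_open[OF U], of "\<lambda>x. (\<eta> x)^2"] \<eta>(1)
    by (auto intro: continuous_intros)
  have cz: "continuous_on S z" for S
    using z has_derivative_continuous by (intro continuous_at_imp_continuous_on) blast
  have z'0: "z' x e = 0" if "x \<notin> K" for x
  proof -
    have "open (- K)" using compact_imp_closed[OF K] by auto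
    have "(z has_derivative (\<lambda>h. 0)) (at x)"
      by (rule has_derivative_transform_within_open[OF has_derivative_const[of 0] \<open>open (- K)\<close>]) (use that z0 in auto)
    then show ?thesis using has_derivative_unique[OF z] by metis
  qed
  \<comment> \<open>All translates of K by at most \<delta> along e: outside this set both z and its
    shifted copies vanish.\<close>
  define Kd where "Kd = (\<lambda>(x, s). x + s *\<^sub>R e) ` (K \<times> {0..\<delta>})"
  have Kd: "compact Kd" unfolding Kd_def
    by (intro compact_continuous_image compact_Times K compact_Icc)
      (auto simp: case_prod_beta intro!: continuous_intros)
  have KdU: "Kd \<subseteq> U"
  proof
    fix y assume "y \<in> Kd"
    then obtain x s where y: "y = x + s *\<^sub>R e" "x \<in> K" "0 \<le> s" "s \<le> \<delta>" by (auto simp: Kd_def)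
    then show "y \<in> U" using lip[of x s] KU by (cases "s = 0") auto
  qed
  have shift_Kd: "x + t *\<^sub>R e \<in> Kd" if "x \<in> K" "0 \<le> t" "t \<le> \<delta>" for x t
    unfolding Kd_def using that by (intro image_eqI[of _ _ "(x, t)"]) auto
  obtain B where B: "B > 0" "\<And>x. x \<in> K \<Longrightarrow> \<bar>z' x e\<bar> \<le> B"
    using compact_imp_bounded[OF compact_continuous_image[OF continuous_on_subset[OF cz'] K]]
    unfolding bounded_pos by auto
  have B': "\<bar>z' x e\<bar> \<le> B" for x using B z'0[of x] by (cases "x \<in> K") auto
  obtain C where C: "C > 0" "\<And>x. x \<in> Kd \<Longrightarrow> \<bar>f x\<bar> \<le> C"
  proof -
    have "continuous_on Kd (\<lambda>x. (\<eta> x)^2)" using continuous_on_subset[OF \<eta>(1) KdU] by (intro continuous_intros)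
    then have "bounded ((\<lambda>x. (\<eta> x)^2) ` Kd)" by (intro compact_imp_bounded compact_continuous_image Kd)
    then obtain C where "C > 0" "\<forall>y\<in>(\<lambda>x. (\<eta> x)^2) ` Kd. norm y \<le> C" unfolding bounded_pos by blast
    then have "C > 0" "\<And>x. x \<in> Kd \<Longrightarrow> \<bar>(\<eta> x)^2\<bar> \<le> C" by auto
    then show thesis using that KdU by (auto simp: f_def indicator_def)
  qed
  have line: "((\<lambda>s. z (x + s *\<^sub>R e)) has_real_derivative z' (x + s *\<^sub>R e) e) (at s)" for x s
  proof -
    interpret bounded_linear "z' (x + s *\<^sub>R e)" by (rule has_derivative_bounded_linear[OF z])
    have "((\<lambda>s. x + s *\<^sub>R e) has_derivative (\<lambda>h. h *\<^sub>R e)) (at s)" by (auto intro!: derivative_eq_intros)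
    from has_derivative_compose[OF this z] show ?thesis
      by (simp add: has_field_derivative_def scaleR mult_commute_abs)
  qed
  define t where "t n = \<delta> / real (Suc n)" for n
  have t: "0 < t n" "t n \<le> \<delta>" for n using \<open>0 < \<delta>\<close> by (auto simp: t_def divide_le_eq)
  have t0: "t \<longlonglongrightarrow> 0" unfolding t_def by (rule LIMSEQ_Suc[OF lim_const_over_n])
  \<comment> \<open>A backward quotient: after translation by \<open>t n *\<^sub>R e\<close> the
    increment falls on f in the forward direction, for which the Lipschitz condition is
    stated.\<close>
  define Q where "Q n x = (z x - z (x - t n *\<^sub>R e)) / t n" for n x
  have Qb: "\<bar>Q n x\<bar> \<le> B" for n x
  proof -
    have "\<exists>s>- t n. s < 0 \<and> z (x + 0 *\<^sub>R e) - z (x + (- t n) *\<^sub>R e) = (0 - - t n) * z' (x + s *\<^sub>R e) e"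
      by (rule MVT2) (use t line in auto)
    then obtain s where "z x - z (x - t n *\<^sub>R e) = t n * z' (x + s *\<^sub>R e) e" by auto
    then have "Q n x = z' (x + s *\<^sub>R e) e" using t[of n] by (simp add: Q_def)
    then show ?thesis using B' by simp
  qed
  have Qlim: "(\<lambda>n. Q n x) \<longlonglongrightarrow> z' x e" for x
  proof -
    have "((\<lambda>h. (z (x + (0 + h) *\<^sub>R e) - z (x + 0 *\<^sub>R e)) / h) \<longlongrightarrow> z' (x + 0 *\<^sub>R e) e) (at 0)"
      using line[of x 0] unfolding DERIV_def .
    moreover have "filterlim (\<lambda>n. - t n) (at 0) sequentially"
      unfolding filterlim_at using tendsto_minus[OF t0] t by (auto simp: less_imp_neq[symmetric] intro!: always_eventually less_imp_neq)
    ultimately have "(\<lambda>n. (z (x + (0 + - t n) *\<^sub>R e) - z (x + 0 *\<^sub>R e)) / (- t n)) \<longlonglongrightarrow> z' (x + 0 *\<^sub>R e) e"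
      by (rule filterlim_compose)
    moreover have "(z (x + (0 + - t n) *\<^sub>R e) - z (x + 0 *\<^sub>R e)) / (- t n) = Q n x" for n
      using t[of n] by (simp add: Q_def divide_simps)
    ultimately show ?thesis by simp
  qed
  have Qsupp: "Q n x = 0" if "x \<notin> Kd" for n x
  proof -
    have "x \<notin> K" using that shift_Kd[of x 0] \<open>0 < \<delta>\<close> by auto
    moreover have "x - t n *\<^sub>R e \<notin> K" using that shift_Kd[of "x - t n *\<^sub>R e" "t n"] t[of n] by auto
    ultimately show ?thesis using z0 by (simp add: Q_def)
  qed
  have mz: "z \<in> borel_measurable borel" using cz by (rule borel_measurable_continuous_onI)
  have mzs: "(\<lambda>x. z (x - c)) \<in> borel_measurable borel" for c
    by (intro borel_measurable_continuous_onI continuous_on_compose2[OF cz[of UNIV]] continuous_intros) auto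
  have mQ: "Q n \<in> borel_measurable borel" for n unfolding Q_def using mz mzs by simp
  have lim: "(\<lambda>n. \<integral>x. f x * Q n x \<partial>lborel) \<longlonglongrightarrow> (\<integral>x. f x * z' x e \<partial>lborel)"
  proof (rule integral_dominated_convergence[where w = "\<lambda>x. indicator Kd x * (C * B)"])
    show "(\<lambda>x. f x * z' x e) \<in> borel_measurable lborel"
      using mf borel_measurable_continuous_onI[OF cz'] by simp
    show "(\<lambda>x. f x * Q n x) \<in> borel_measurable lborel" for n using mf mQ[of n] by simp
    show "integrable lborel (\<lambda>x. indicator Kd x * (C * B))"
      using borel_integrable_compact[OF Kd continuous_on_const[of _ "C * B"]] by simp
    show "AE x in lborel. (\<lambda>n. f x * Q n x) \<longlonglongrightarrow> f x * z' x e"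
      by (intro AE_I2 tendsto_mult tendsto_const Qlim)
    show "AE x in lborel. norm (f x * Q n x) \<le> indicator Kd x * (C * B)" for n
    proof (rule AE_I2)
      fix x
      show "norm (f x * Q n x) \<le> indicator Kd x * (C * B)"
      proof (cases "x \<in> Kd")
        case True
        then show ?thesis using C Qb[of n x] B(1) by (auto simp: abs_mult intro!: mult_mono)
      qed (simp add: Qsupp)
    qed
  qed
  let ?I = "\<integral>x. indicator K x * (\<eta> x * \<bar>z x\<bar>) \<partial>lborel" and ?J = "\<integral>x. indicator K x * \<bar>z x\<bar> \<partial>lborel"
  have cK: "continuous_on K \<eta>" by (rule continuous_on_subset[OF \<eta>(1) KU])
  have iI: "integrable lborel (\<lambda>x. indicator K x * (\<eta> x * \<bar>z x\<bar>))"
    using borel_integrable_compact[OF K continuous_on_mult[OF cK continuous_on_rabs[OF cz[of K]]]] by simp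
  have iJ: "integrable lborel (\<lambda>x. indicator K x * \<bar>z x\<bar>)"
    using borel_integrable_compact[OF K continuous_on_rabs[OF cz[of K]]] by simp
  \<comment> \<open>The difference of squares factors into the Lipschitz increment and 2 \<eta> plus
    an error of order \<open>t n\<close>, which disappears in the limit.\<close>
  have bound: "\<bar>\<integral>x. f x * Q n x \<partial>lborel\<bar> \<le> 2 * \<Lambda> * ?I + \<Lambda>^2 * t n * ?J" for n
  proof -
    have sub: "f x = (\<eta> x)^2" if "x \<in> U" for x using that by (simp add: f_def)
    have i1: "integrable lborel (\<lambda>x. f x * z x)"
    proof -
      have "integrable lborel (\<lambda>x. indicator K x *\<^sub>R ((\<eta> x)^2 * z x))"
        using cK cz by (intro borel_integrable_compact[OF K]) (auto intro!: continuous_intros)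
      moreover have "(\<lambda>x. indicator K x *\<^sub>R ((\<eta> x)^2 * z x)) = (\<lambda>x. f x * z x)"
        using KU z0 by (auto simp: fun_eq_iff indicator_def f_def)
      ultimately show ?thesis by simp
    qed
    have i2: "integrable lborel (\<lambda>x. f x * z (x - t n *\<^sub>R e))"
    proof -
      have "continuous_on Kd \<eta>" by (rule continuous_on_subset[OF \<eta>(1) KdU])
      moreover have "continuous_on Kd (\<lambda>x. z (x - t n *\<^sub>R e))"
        by (intro continuous_on_compose2[OF cz[of UNIV]] continuous_intros) auto
      ultimately have "integrable lborel (\<lambda>x. indicator Kd x *\<^sub>R ((\<eta> x)^2 * z (x - t n *\<^sub>R e)))"
        by (intro borel_integrable_compact[OF Kd]) (auto intro!: continuous_intros)
      moreover have "(\<lambda>x. indicator Kd x *\<^sub>R ((\<eta> x)^2 * z (x - t n *\<^sub>R e))) = (\<lambda>x. f x * z (x - t n *\<^sub>R e))"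
      proof
        fix x
        show "indicator Kd x *\<^sub>R ((\<eta> x)^2 * z (x - t n *\<^sub>R e)) = f x * z (x - t n *\<^sub>R e)"
        proof (cases "x \<in> Kd")
        case True
        then show ?thesis using KdU sub by auto
      next
        case False
        then have "x - t n *\<^sub>R e \<notin> K" using shift_Kd[of "x - t n *\<^sub>R e" "t n"] t[of n] by auto
        then show ?thesis using False z0 by simp
        qed
      qed
      ultimately show ?thesis by (simp only:)
    qed
    have m2: "(\<lambda>x. f x * z (x - t n *\<^sub>R e)) \<in> borel_measurable borel" using mf mzs by simp
    have shift: "(\<integral>x. f x * z (x - t n *\<^sub>R e) \<partial>lborel) = (\<integral>x. f (t n *\<^sub>R e + x) * z x \<partial>lborel)"
      and i3: "integrable lborel (\<lambda>x. f (t n *\<^sub>R e + x) * z x)"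
    proof -
      have d: "distr lborel borel ((+) (t n *\<^sub>R e)) = lborel" by (rule lborel_distr_plus)
      show "(\<integral>x. f x * z (x - t n *\<^sub>R e) \<partial>lborel) = (\<integral>x. f (t n *\<^sub>R e + x) * z x \<partial>lborel)"
        using integral_distr[of "(+) (t n *\<^sub>R e)" lborel borel "\<lambda>x. f x * z (x - t n *\<^sub>R e)"] m2 unfolding d by simp
      show "integrable lborel (\<lambda>x. f (t n *\<^sub>R e + x) * z x)"
        using integrable_distr_eq[of "(+) (t n *\<^sub>R e)" lborel borel "\<lambda>x. f x * z (x - t n *\<^sub>R e)"] m2 i2 unfolding d by simp
    qed
    have "(\<integral>x. f x * Q n x \<partial>lborel) = (\<integral>x. (f x * z x - f x * z (x - t n *\<^sub>R e)) / t n \<partial>lborel)"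
      by (simp add: Q_def right_diff_distrib)
    also have "\<dots> = ((\<integral>x. f x * z x \<partial>lborel) - (\<integral>x. f (t n *\<^sub>R e + x) * z x \<partial>lborel)) / t n"
      using i1 i2 shift by simp
    also have "\<dots> = (\<integral>x. (f x - f (t n *\<^sub>R e + x)) * z x / t n \<partial>lborel)"
      using i1 i3 by (simp add: left_diff_distrib)
    finally have eq: "(\<integral>x. f x * Q n x \<partial>lborel) = (\<integral>x. (f x - f (t n *\<^sub>R e + x)) * z x / t n \<partial>lborel)" .
    have i4: "integrable lborel (\<lambda>x. (f x - f (t n *\<^sub>R e + x)) * z x / t n)"
      using i1 i3 by (simp add: left_diff_distrib)
    have "\<bar>\<integral>x. f x * Q n x \<partial>lborel\<bar> \<le> (\<integral>x. \<bar>(f x - f (t n *\<^sub>R e + x)) * z x / t n\<bar> \<partial>lborel)"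
      unfolding eq by (rule integral_abs_bound)
    also have "\<dots> \<le> (\<integral>x. 2 * \<Lambda> * (indicator K x * (\<eta> x * \<bar>z x\<bar>)) + \<Lambda>^2 * t n * (indicator K x * \<bar>z x\<bar>) \<partial>lborel)"
    proof (rule integral_mono)
      fix x
      show "\<bar>(f x - f (t n *\<^sub>R e + x)) * z x / t n\<bar>
          \<le> 2 * \<Lambda> * (indicator K x * (\<eta> x * \<bar>z x\<bar>)) + \<Lambda>^2 * t n * (indicator K x * \<bar>z x\<bar>)"
      proof (cases "x \<in> K")
        case True
        have l: "x + t n *\<^sub>R e \<in> U" "\<bar>\<eta> (x + t n *\<^sub>R e) - \<eta> x\<bar> \<le> \<Lambda> * t n" using lip[OF True t] by auto
        have xU: "x \<in> U" using True KU by blast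
        have "\<bar>f x - f (t n *\<^sub>R e + x)\<bar> = \<bar>(\<eta> (x + t n *\<^sub>R e))^2 - (\<eta> x)^2\<bar>"
          using sub l(1) xU by (simp add: add.commute abs_minus_commute)
        also have "\<dots> \<le> \<Lambda> * t n * (2 * \<eta> x + \<Lambda> * t n)" by (rule abs_diff_power2_le[OF l(2) \<eta>(2)[OF xU]])
        finally have "\<bar>f x - f (t n *\<^sub>R e + x)\<bar> / t n \<le> \<Lambda> * (2 * \<eta> x + \<Lambda> * t n)"
          using t[of n] by (simp add: divide_le_eq mult_ac)
        then have "\<bar>f x - f (t n *\<^sub>R e + x)\<bar> / t n * \<bar>z x\<bar> \<le> \<Lambda> * (2 * \<eta> x + \<Lambda> * t n) * \<bar>z x\<bar>"
          by (intro mult_right_mono) auto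
        moreover have "\<bar>(f x - f (t n *\<^sub>R e + x)) * z x / t n\<bar> = \<bar>f x - f (t n *\<^sub>R e + x)\<bar> / t n * \<bar>z x\<bar>"
          using t[of n] by (simp add: abs_mult)
        moreover have "2 * \<Lambda> * (indicator K x * (\<eta> x * \<bar>z x\<bar>)) + \<Lambda>^2 * t n * (indicator K x * \<bar>z x\<bar>)
            = \<Lambda> * (2 * \<eta> x + \<Lambda> * t n) * \<bar>z x\<bar>"
          using True by (simp add: algebra_simps power2_eq_square)
        ultimately show ?thesis by (simp only:)
      qed (simp add: z0)
    next
      show "integrable lborel (\<lambda>x. \<bar>(f x - f (t n *\<^sub>R e + x)) * z x / t n\<bar>)" by (rule integrable_abs[OF i4])
      show "integrable lborel (\<lambda>x. 2 * \<Lambda> * (indicator K x * (\<eta> x * \<bar>z x\<bar>)) + \<Lambda>^2 * t n * (indicator K x * \<bar>z x\<bar>))"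
        using iI iJ by simp
    qed
    also have "\<dots> = 2 * \<Lambda> * ?I + \<Lambda>^2 * t n * ?J" using iI iJ by simp
    finally show ?thesis .
  qed
  have "\<bar>\<integral>x. f x * z' x e \<partial>lborel\<bar> \<le> 2 * \<Lambda> * ?I + \<Lambda>^2 * 0 * ?J"
  proof (rule LIMSEQ_le)
    show "(\<lambda>n. \<bar>\<integral>x. f x * Q n x \<partial>lborel\<bar>) \<longlonglongrightarrow> \<bar>\<integral>x. f x * z' x e \<partial>lborel\<bar>" by (rule tendsto_rabs[OF lim])
    show "(\<lambda>n. 2 * \<Lambda> * ?I + \<Lambda>^2 * t n * ?J) \<longlonglongrightarrow> 2 * \<Lambda> * ?I + \<Lambda>^2 * 0 * ?J"
      by (intro tendsto_intros t0)
    show "\<exists>N. \<forall>n\<ge>N. \<bar>\<integral>x. f x * Q n x \<partial>lborel\<bar> \<le> 2 * \<Lambda> * ?I + \<Lambda>^2 * t n * ?J" using bound by blast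
  qed
  moreover have "f x * z' x e = indicator K x * ((\<eta> x)^2 * z' x e)" for x
    using KU z'0 by (cases "x \<in> K") (auto simp: f_def)
  ultimately show ?thesis by simp
qed

section \<open>Divergence identities in a chart\<close>

lemma partial_deriv_add:
  fixes f h :: "real^'n::finite \<Rightarrow> real"
  assumes "f differentiable (at x)" "h differentiable (at x)"
  shows "partial_deriv i (\<lambda>x. f x + h x) x = partial_deriv i f x + partial_deriv i h x"
proof -
  have "(f has_derivative frechet_derivative f (at x)) (at x)"
    "(h has_derivative frechet_derivative h (at x)) (at x)"
    using assms by (auto simp: frechet_derivative_works[symmetric])
  from partial_deriv_eqI[OF has_derivative_add[OF this]] show ?thesis by (simp add: partial_deriv_def)
qed

lemma partial_deriv_diff:
  fixes f h :: "real^'n::finite \<Rightarrow> real"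
  assumes "f differentiable (at x)" "h differentiable (at x)"
  shows "partial_deriv i (\<lambda>x. f x - h x) x = partial_deriv i f x - partial_deriv i h x"
proof -
  have "(f has_derivative frechet_derivative f (at x)) (at x)"
    "(h has_derivative frechet_derivative h (at x)) (at x)"
    using assms by (auto simp: frechet_derivative_works[symmetric])
  from partial_deriv_eqI[OF has_derivative_diff[OF this]] show ?thesis by (simp add: partial_deriv_def)
qed

lemma partial_deriv_sum:
  fixes f :: "'a \<Rightarrow> real^'n::finite \<Rightarrow> real"
  assumes "\<And>a. a \<in> I \<Longrightarrow> f a differentiable (at x)"
  shows "partial_deriv i (\<lambda>x. \<Sum>a\<in>I. f a x) x = (\<Sum>a\<in>I. partial_deriv i (f a) x)"
proof -
  have "(f a has_derivative frechet_derivative (f a) (at x)) (at x)" if "a \<in> I" for a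
    using assms[OF that] by (simp add: frechet_derivative_works[symmetric])
  from partial_deriv_eqI[OF has_derivative_sum[of I f, OF this]] show ?thesis by (simp add: partial_deriv_def)
qed

lemma Ck_on_differentiable: "(\<And>k. Ck_on k S f) \<Longrightarrow> x \<in> S \<Longrightarrow> f differentiable (at x)"
  using Ck_on.simps(2)[of 0 S f] by blast

lemma Ck_on_partial: "(\<And>k. Ck_on k S f) \<Longrightarrow> Ck_on k S (partial_deriv i f)"
  using Ck_on.simps(2)[of k S f] by blast

text \<open>Cramer's rule; a quotient of determinants makes the smoothness of the inverse metric
  visible.\<close>

lemma matrix_inv_entry:
  fixes A :: "real^'n^'n::finite"
  assumes "invertible A"
  shows "matrix_inv A $ k $ l = det (\<chi> i j. if j = k then axis l 1 $ i else A $ i $ j) * inverse (det A)"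
proof -
  have "A *v (matrix_inv A *v axis l 1) = axis l 1"
    by (simp add: matrix_vector_mul_assoc matrix_inv_right[OF assms])
  then have "matrix_inv A *v axis l 1 = (\<chi> k. det (\<chi> i j. if j = k then axis l 1 $ i else A $ i $ j) / det A)"
    using cramer[of A] assms invertible_det_nz by blast
  then have "(matrix_inv A *v axis l 1) $ k = det (\<chi> i j. if j = k then axis l 1 $ i else A $ i $ j) / det A"
    by simp
  then show ?thesis by (simp add: matrix_vector_mult_basis column_def divide_inverse)
qed

section \<open>Christoffel symbols in one chart\<close>

locale chart_metric =
  fixes S :: "(real^'n::finite) set" and G :: "real^'n \<Rightarrow> real^'n^'n"
  assumes S: "open S" and G_Ck: "\<And>k i j. Ck_on k S (\<lambda>x. G x $ i $ j)"
    and G_pos: "\<And>x. x \<in> S \<Longrightarrow> pos_def (G x)"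
begin

abbreviation Ga :: "'n \<Rightarrow> 'n \<Rightarrow> 'n \<Rightarrow> real^'n \<Rightarrow> real" where "Ga \<equiv> christoffel G"

lemma G_sym: "x \<in> S \<Longrightarrow> G x $ i $ j = G x $ j $ i"
  using G_pos[of x] unfolding pos_def_def by (metis transpose_def vec_lambda_beta)

lemma G_inv_Ck: "Ck_on k S (\<lambda>x. matrix_inv (G x) $ i $ j)"
proof (rule Ck_on_cong[OF S])
  let ?M = "\<lambda>x. (\<chi> r s. if s = i then axis j 1 $ r else G x $ r $ s) :: real^'n^'n"
  have "Ck_on k S (\<lambda>x. ?M x $ r $ s)" for r s by (cases "s = i") (simp_all add: Ck_on_const G_Ck)
  then show "Ck_on k S (\<lambda>x. det (?M x) * inverse (det (G x)))"
    using pos_def_det[OF G_pos]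
    by (intro Ck_on_mult Ck_on_inverse Ck_on_det S G_Ck) (auto simp: less_imp_neq[symmetric])
  show "det (?M x) * inverse (det (G x)) = matrix_inv (G x) $ i $ j" if "x \<in> S" for x
    using matrix_inv_entry[OF pos_def_invertible[OF G_pos[OF that]]] by simp
qed

lemma dG_Ck: "Ck_on k S (partial_deriv l (\<lambda>y. G y $ i $ j))"
  by (rule Ck_on_partial[OF G_Ck])

lemma Ga_Ck: "Ck_on k S (Ga m i j)"
proof -
  have "Ck_on k S (\<lambda>x. christoffel G m i j x)"
    unfolding christoffel_def
    by (intro Ck_on_cmult Ck_on_sum Ck_on_mult Ck_on_diff Ck_on_add S G_inv_Ck dG_Ck)
  then show ?thesis by simp
qed

lemma dG_sym: "x \<in> S \<Longrightarrow> partial_deriv l (\<lambda>y. G y $ i $ j) x = partial_deriv l (\<lambda>y. G y $ j $ i) x"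
  by (rule partial_deriv_cong[OF S]) (auto intro: G_sym)

lemma Ga_sym: "x \<in> S \<Longrightarrow> Ga m i j x = Ga m j i x"
  unfolding christoffel_def using dG_sym[of x _ i j] by (simp add: add.commute)

text \<open>Lowering the index undoes the multiplication by the inverse metric and leaves the
  Christoffel symbol of the first kind, in which only derivatives of the metric occur.\<close>

lemma G_Ga:
  assumes x: "x \<in> S"
  shows "(\<Sum>k\<in>UNIV. G x $ j $ k * Ga k i l x) =
    1/2 * (partial_deriv i (\<lambda>y. G y $ l $ j) x + partial_deriv l (\<lambda>y. G y $ i $ j) x
         - partial_deriv j (\<lambda>y. G y $ i $ l) x)"
proof -
  define b where "b = (\<chi> m. partial_deriv i (\<lambda>y. G y $ l $ m) x + partial_deriv l (\<lambda>y. G y $ i $ m) x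
         - partial_deriv m (\<lambda>y. G y $ i $ l) x)"
  have "(\<chi> k. Ga k i l x) = (1/2) *\<^sub>R (matrix_inv (G x) *v b)"
    by (simp add: christoffel_def vec_eq_iff matrix_vector_mult_def b_def)
  then have "G x *v (\<chi> k. Ga k i l x) = (1/2) *\<^sub>R (G x *v (matrix_inv (G x) *v b))"
    by (simp add: matrix_vector_mult_scaleR)
  also have "\<dots> = (1/2) *\<^sub>R b"
    by (simp add: matrix_vector_mul_assoc matrix_inv_right[OF pos_def_invertible[OF G_pos[OF x]]])
  finally have "(G x *v (\<chi> k. Ga k i l x)) $ j = ((1/2) *\<^sub>R b) $ j" by simp
  then show ?thesis by (simp add: matrix_vector_mult_def b_def)
qed

lemma G_inv_sym: "x \<in> S \<Longrightarrow> matrix_inv (G x) $ i $ j = matrix_inv (G x) $ j $ i"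
proof -
  assume x: "x \<in> S"
  obtain E :: "real^'n^'n" where E: "transpose E ** G x ** E = mat 1" using exists_orthonormal_frame[OF G_pos[OF x]] .
  show ?thesis unfolding frame_inverse(2)[OF E]
    by (simp add: matrix_matrix_mult_def transpose_def mult.commute)
qed

text \<open>Two of the three derivative terms are exchanged by the symmetry of the metric and its
  inverse, and cancel.\<close>

lemma Ga_trace:
  assumes x: "x \<in> S"
  shows "(\<Sum>k\<in>UNIV. Ga k k i x) = 1/2 * (\<Sum>k\<in>UNIV. \<Sum>l\<in>UNIV. matrix_inv (G x) $ k $ l * partial_deriv i (\<lambda>y. G y $ k $ l) x)"
proof -
  let ?H = "matrix_inv (G x)" let ?d = "\<lambda>i k l. partial_deriv i (\<lambda>y. G y $ k $ l) x"
  have "(\<Sum>k\<in>UNIV. \<Sum>l\<in>UNIV. ?H $ k $ l * ?d l k i) = (\<Sum>l\<in>UNIV. \<Sum>k\<in>UNIV. ?H $ k $ l * ?d l k i)"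
    by (rule sum.swap)
  also have "\<dots> = (\<Sum>k\<in>UNIV. \<Sum>l\<in>UNIV. ?H $ k $ l * ?d k i l)"
    by (intro sum.cong refl) (metis G_inv_sym[OF x] dG_sym[OF x])
  finally have "(\<Sum>k\<in>UNIV. \<Sum>l\<in>UNIV. ?H $ k $ l * ?d k i l) - (\<Sum>k\<in>UNIV. \<Sum>l\<in>UNIV. ?H $ k $ l * ?d l k i) = 0" by simp
  then show ?thesis
    unfolding christoffel_def sum_distrib_left[symmetric]
    by (simp add: distrib_left right_diff_distrib sum.distrib sum_subtractf)
qed

text \<open>Jacobi's formula and the square root give half the trace of the inverse metric times the
  derivative of the metric, which is the contracted Christoffel symbol by
  \<open>Ga_trace\<close>.\<close>

lemma sqrt_det_derivative:
  assumes x: "x \<in> S"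
  shows "partial_deriv i (\<lambda>y. sqrt (det (G y))) x = sqrt (det (G x)) * (\<Sum>k\<in>UNIV. Ga k k i x)"
    and "(\<lambda>y. sqrt (det (G y))) differentiable (at x)"
proof -
  let ?D = "\<lambda>k l. frechet_derivative (\<lambda>y. G y $ k $ l) (at x)"
  have "((\<lambda>y. det (G y)) has_derivative
    (\<lambda>h. det (G x) * (\<Sum>k\<in>UNIV. \<Sum>l\<in>UNIV. matrix_inv (G x) $ l $ k * ?D k l h))) (at x)"
    using Ck_on_differentiable[OF G_Ck x]
    by (intro has_derivative_det pos_def_invertible G_pos x) (simp add: frechet_derivative_works[symmetric])
  from has_derivative_real_sqrt[OF pos_def_det[OF G_pos[OF x]] this]
  have d: "((\<lambda>y. sqrt (det (G y))) has_derivative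
    (\<lambda>h. det (G x) * (\<Sum>k\<in>UNIV. \<Sum>l\<in>UNIV. matrix_inv (G x) $ l $ k * ?D k l h) * (inverse (sqrt (det (G x))) / 2))) (at x)" .
  then show "(\<lambda>y. sqrt (det (G y))) differentiable (at x)" unfolding differentiable_def by blast
  have s: "det (G x) * inverse (sqrt (det (G x))) = sqrt (det (G x))"
    using pos_def_det[OF G_pos[OF x]] real_div_sqrt[of "det (G x)"] by (simp add: divide_inverse)
  show "partial_deriv i (\<lambda>y. sqrt (det (G y))) x = sqrt (det (G x)) * (\<Sum>k\<in>UNIV. Ga k k i x)"
  proof -
    let ?T = "\<Sum>k\<in>UNIV. \<Sum>l\<in>UNIV. matrix_inv (G x) $ k $ l * ?D k l (axis i 1)"
    have "(\<Sum>k\<in>UNIV. \<Sum>l\<in>UNIV. matrix_inv (G x) $ l $ k * ?D k l (axis i 1)) = ?T"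
    proof (intro sum.cong refl)
      fix k l
      show "matrix_inv (G x) $ l $ k * ?D k l (axis i 1) = matrix_inv (G x) $ k $ l * ?D k l (axis i 1)"
        using G_inv_sym[OF x, of k l] by simp
    qed
    then have "partial_deriv i (\<lambda>y. sqrt (det (G y))) x = (det (G x) * inverse (sqrt (det (G x)))) * (1/2 * ?T)"
      unfolding partial_deriv_eqI[OF d] by (simp only: mult_ac divide_inverse mult_1_left)
    then show ?thesis unfolding s Ga_trace[OF x] partial_deriv_def .
  qed
qed

end

section \<open>A vector field in one chart: divergence, Lie derivative and squared norm\<close>

locale chart_field = chart_metric S G for S :: "(real^'n::finite) set" and G :: "real^'n \<Rightarrow> real^'n^'n" +
  fixes V :: "real^'n \<Rightarrow> real^'n"
  assumes V_Ck: "\<And>k i. Ck_on k S (\<lambda>x. V x $ i)"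
begin

abbreviation D :: "real^'n \<Rightarrow> real^'n^'n" where "D \<equiv> covariant_derivative G V"

definition Y :: "real^'n \<Rightarrow> real^'n" where "Y x = D x *v V x - trace (D x) *\<^sub>R V x"

lemma D_entry: "D x $ k $ i = partial_deriv i (\<lambda>y. V y $ k) x + (\<Sum>j\<in>UNIV. Ga k i j x * V x $ j)"
  by (simp add: covariant_derivative_def)

lemma dV_Ck: "Ck_on k S (partial_deriv l (\<lambda>y. V y $ i))"
  by (rule Ck_on_partial[OF V_Ck])

lemma D_Ck: "Ck_on k S (\<lambda>x. D x $ i $ j)"
  unfolding D_entry by (intro Ck_on_add Ck_on_sum Ck_on_mult S dV_Ck Ga_Ck V_Ck)

lemma Y_entry: "Y x $ i = (\<Sum>j\<in>UNIV. V x $ j * D x $ i $ j) - V x $ i * (\<Sum>j\<in>UNIV. D x $ j $ j)"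
  by (simp add: Y_def matrix_vector_mult_def trace_def mult.commute)

lemma Y_Ck: "Ck_on k S (\<lambda>x. Y x $ i)"
  unfolding Y_entry by (intro Ck_on_diff Ck_on_sum Ck_on_mult S D_Ck V_Ck)

lemmas V_diff = Ck_on_differentiable[OF V_Ck] and D_diff = Ck_on_differentiable[OF D_Ck]
  and Y_diff = Ck_on_differentiable[OF Y_Ck] and Ga_diff = Ck_on_differentiable[OF Ga_Ck]
  and dV_diff = Ck_on_differentiable[OF dV_Ck] and G_diff = Ck_on_differentiable[OF G_Ck]

text \<open>The second sum is the contribution of the volume density, so the left side is the
  Riemannian divergence of Y. Smoothness identifies the variables of the algebraic identity with
  actual derivatives.\<close>

lemma divergence_Y:
  assumes x: "x \<in> S"
  shows "(\<Sum>i\<in>UNIV. partial_deriv i (\<lambda>y. Y y $ i) x) + (\<Sum>i\<in>UNIV. \<Sum>k\<in>UNIV. Ga k k i x * Y x $ i)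
     = trace (D x ** D x) - (trace (D x))^2 + V x \<bullet> (ricci G x *v V x)"
proof -
  define dv where "dv k i = partial_deriv i (\<lambda>y. V y $ k) x" for k i
  define ddv where "ddv k i l = partial_deriv l (partial_deriv i (\<lambda>y. V y $ k)) x" for k i l
  define d\<Gamma> where "d\<Gamma> k i j l = partial_deriv l (Ga k i j) x" for k i j l
  define dD where "dD k i l = partial_deriv l (\<lambda>y. D y $ k $ i) x" for k i l
  have pY: "partial_deriv i (\<lambda>y. Y y $ i) x = (\<Sum>j\<in>UNIV. dv j i * D x $ i $ j + V x $ j * dD i j i)
             - (dv i i * (\<Sum>j\<in>UNIV. D x $ j $ j) + V x $ i * (\<Sum>j\<in>UNIV. dD j j i))" for i
    unfolding Y_entry dv_def dD_def
    by (simp add: partial_deriv_diff partial_deriv_sum partial_deriv_mult V_diff D_diff x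
        differentiable_mult differentiable_sum add.commute)
  have pD: "dD k i l = ddv k i l + (\<Sum>m\<in>UNIV. d\<Gamma> k i m l * V x $ m + Ga k i m x * dv m l)" for k i l
    unfolding D_entry dv_def dD_def ddv_def d\<Gamma>_def
    by (simp add: partial_deriv_add partial_deriv_sum partial_deriv_mult V_diff dV_diff Ga_diff x
        differentiable_mult differentiable_sum add.commute)
  have "ddv k i l = ddv k l i" for k i l unfolding ddv_def by (rule partial_deriv_commute[OF S x V_Ck])
  moreover have "Ga k i l x = Ga k l i x" for k i l by (rule Ga_sym[OF x])
  moreover have "D x $ k $ i = dv k i + (\<Sum>m\<in>UNIV. Ga k i m x * V x $ m)" for k i by (simp add: D_entry dv_def)
  ultimately have "(\<Sum>i\<in>UNIV. (\<Sum>j\<in>UNIV. dv j i * D x $ i $ j + V x $ j * dD i j i)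
             - (dv i i * (\<Sum>j\<in>UNIV. D x $ j $ j) + V x $ i * (\<Sum>j\<in>UNIV. dD j j i)))
         + (\<Sum>i\<in>UNIV. \<Sum>k\<in>UNIV. Ga k k i x * ((\<Sum>j\<in>UNIV. V x $ j * D x $ i $ j) - V x $ i * (\<Sum>j\<in>UNIV. D x $ j $ j)))
       = (\<Sum>i\<in>UNIV. \<Sum>j\<in>UNIV. D x $ i $ j * D x $ j $ i) - (\<Sum>i\<in>UNIV. D x $ i $ i)^2
         + (\<Sum>j\<in>UNIV. \<Sum>k\<in>UNIV. V x $ j * V x $ k * (\<Sum>i\<in>UNIV. d\<Gamma> i j k i - d\<Gamma> i i k j
              + (\<Sum>p\<in>UNIV. Ga i i p x * Ga p j k x - Ga i j p x * Ga p i k x)))"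
    by (rule ricci_divergence_identity) (rule pD)
  moreover have "V x \<bullet> (ricci G x *v V x) = (\<Sum>j\<in>UNIV. \<Sum>k\<in>UNIV. V x $ j * V x $ k * (\<Sum>i\<in>UNIV. d\<Gamma> i j k i - d\<Gamma> i i k j
              + (\<Sum>p\<in>UNIV. Ga i i p x * Ga p j k x - Ga i j p x * Ga p i k x)))"
    by (simp add: inner_vec_def matrix_vector_mult_def ricci_def riemann_def d\<Gamma>_def sum_distrib_left mult_ac)
  moreover have "trace (D x ** D x) = (\<Sum>i\<in>UNIV. \<Sum>j\<in>UNIV. D x $ i $ j * D x $ j $ i)"
    by (simp add: trace_def matrix_matrix_mult_def)
  ultimately show ?thesis unfolding pY unfolding Y_entry trace_def by simp
qed

text \<open>In the lowered Christoffel symbols the part antisymmetric in i and j drops out under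
  symmetrisation and leaves the derivative of the metric along V.\<close>

lemma lie_derivative_eq:
  assumes x: "x \<in> S"
  shows "lie_derivative V G x = G x ** D x + transpose (G x ** D x)"
proof -
  have GD: "(G x ** D x) $ i $ j = (\<Sum>k\<in>UNIV. G x $ i $ k * partial_deriv j (\<lambda>y. V y $ k) x)
      + (\<Sum>l\<in>UNIV. V x $ l * (1/2 * (partial_deriv j (\<lambda>y. G y $ l $ i) x + partial_deriv l (\<lambda>y. G y $ j $ i) x
         - partial_deriv i (\<lambda>y. G y $ j $ l) x)))" for i j
  proof -
    have "(G x ** D x) $ i $ j = (\<Sum>k\<in>UNIV. G x $ i $ k * partial_deriv j (\<lambda>y. V y $ k) x)
       + (\<Sum>k\<in>UNIV. \<Sum>l\<in>UNIV. G x $ i $ k * (Ga k j l x * V x $ l))"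
      by (simp add: matrix_matrix_mult_def D_entry distrib_left sum.distrib sum_distrib_left)
    also have "(\<Sum>k\<in>UNIV. \<Sum>l\<in>UNIV. G x $ i $ k * (Ga k j l x * V x $ l))
       = (\<Sum>l\<in>UNIV. \<Sum>k\<in>UNIV. G x $ i $ k * (Ga k j l x * V x $ l))" by (rule sum.swap)
    also have "\<dots> = (\<Sum>l\<in>UNIV. V x $ l * (\<Sum>k\<in>UNIV. G x $ i $ k * Ga k j l x))"
      by (simp add: sum_distrib_left mult_ac)
    finally show ?thesis unfolding G_Ga[OF x] .
  qed
  have "lie_derivative V G x $ i $ j = (G x ** D x) $ i $ j + (G x ** D x) $ j $ i" for i j
  proof -
    let ?d = "\<lambda>l i j. partial_deriv l (\<lambda>y. G y $ i $ j) x"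
    have "lie_derivative V G x $ i $ j = (\<Sum>k\<in>UNIV. V x $ k * ?d k i j)
      + (\<Sum>k\<in>UNIV. G x $ j $ k * partial_deriv i (\<lambda>y. V y $ k) x)
      + (\<Sum>k\<in>UNIV. G x $ i $ k * partial_deriv j (\<lambda>y. V y $ k) x)"
      by (simp add: lie_derivative_def sum.distrib G_sym[OF x, of j])
    moreover have "(\<Sum>l\<in>UNIV. V x $ l * (1/2 * (?d j l i + ?d l j i - ?d i j l)))
        + (\<Sum>l\<in>UNIV. V x $ l * (1/2 * (?d i l j + ?d l i j - ?d j i l))) = (\<Sum>k\<in>UNIV. V x $ k * ?d k i j)"
      unfolding sum.distrib[symmetric]
    proof (rule sum.cong[OF refl])
      fix l
      show "V x $ l * (1/2 * (?d j l i + ?d l j i - ?d i j l)) + V x $ l * (1/2 * (?d i l j + ?d l i j - ?d j i l))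
        = V x $ l * ?d l i j"
        using dG_sym[OF x, of j l i] dG_sym[OF x, of l j i] dG_sym[OF x, of i j l] by (simp add: algebra_simps)
    qed
    ultimately show ?thesis unfolding GD by simp
  qed
  then show ?thesis by (simp add: vec_eq_iff transpose_def)
qed

definition u :: "real^'n \<Rightarrow> real" where "u x = V x \<bullet> (G x *v V x)"

text \<open>Metric compatibility of the connection, verified on coordinate directions: the
  Christoffel terms of \<open>D\<close> account for the derivative of the metric in |V|^2.\<close>

lemma u_derivative:
  assumes x: "x \<in> S"
  shows "(u has_derivative (\<lambda>h. 2 * ((D x *v h) \<bullet> (G x *v V x)))) (at x)"
proof -
  have ue: "u = (\<lambda>y. \<Sum>k\<in>UNIV. \<Sum>l\<in>UNIV. V y $ k * (G y $ k $ l * V y $ l))"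
    by (simp add: u_def inner_vec_def matrix_vector_mult_def sum_distrib_left fun_eq_iff)
  have uC: "Ck_on k S u" for k unfolding ue by (intro Ck_on_sum Ck_on_mult S V_Ck G_Ck)
  have pu: "partial_deriv i u x = 2 * ((D x *v axis i 1) \<bullet> (G x *v V x))" for i
  proof -
    let ?dv = "\<lambda>k. partial_deriv i (\<lambda>y. V y $ k) x" and ?d = "\<lambda>l i j. partial_deriv l (\<lambda>y. G y $ i $ j) x"
    have "partial_deriv i u x = (\<Sum>k\<in>UNIV. \<Sum>l\<in>UNIV. V x $ k * (G x $ k $ l * ?dv l + ?d i k l * V x $ l)
        + ?dv k * (G x $ k $ l * V x $ l))"
      unfolding ue
      by (simp add: partial_deriv_sum partial_deriv_mult V_diff G_diff x differentiable_mult differentiable_sum)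
    also have "\<dots> = (\<Sum>k\<in>UNIV. \<Sum>l\<in>UNIV. V x $ k * G x $ k $ l * ?dv l) + (\<Sum>k\<in>UNIV. \<Sum>l\<in>UNIV. V x $ k * ?d i k l * V x $ l)
        + (\<Sum>k\<in>UNIV. \<Sum>l\<in>UNIV. ?dv k * G x $ k $ l * V x $ l)"
      by (simp add: sum.distrib algebra_simps)
    also have "(\<Sum>k\<in>UNIV. \<Sum>l\<in>UNIV. V x $ k * G x $ k $ l * ?dv l) = (\<Sum>k\<in>UNIV. \<Sum>l\<in>UNIV. ?dv k * G x $ k $ l * V x $ l)"
    proof -
      have "(\<Sum>k\<in>UNIV. \<Sum>l\<in>UNIV. V x $ k * G x $ k $ l * ?dv l) = (\<Sum>l\<in>UNIV. \<Sum>k\<in>UNIV. V x $ k * G x $ k $ l * ?dv l)"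
        by (rule sum.swap)
      also have "\<dots> = (\<Sum>k\<in>UNIV. \<Sum>l\<in>UNIV. ?dv k * G x $ k $ l * V x $ l)"
      proof (intro sum.cong refl)
        fix k l
        show "V x $ l * G x $ l $ k * ?dv k = ?dv k * G x $ k $ l * V x $ l" using G_sym[OF x, of k l] by simp
      qed
      finally show ?thesis .
    qed
    finally have 1: "partial_deriv i u x = 2 * (\<Sum>k\<in>UNIV. \<Sum>l\<in>UNIV. ?dv k * G x $ k $ l * V x $ l)
        + (\<Sum>k\<in>UNIV. \<Sum>l\<in>UNIV. V x $ k * ?d i k l * V x $ l)" by simp
    have "(D x *v axis i 1) \<bullet> (G x *v V x) = (\<Sum>k\<in>UNIV. D x $ k $ i * (\<Sum>l\<in>UNIV. G x $ k $ l * V x $ l))"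
      unfolding matrix_vector_mult_basis by (simp add: column_def inner_vec_def matrix_vector_mult_def)
    also have "\<dots> = (\<Sum>k\<in>UNIV. \<Sum>l\<in>UNIV. ?dv k * G x $ k $ l * V x $ l)
       + (\<Sum>k\<in>UNIV. \<Sum>l\<in>UNIV. \<Sum>m\<in>UNIV. G x $ k $ l * Ga k i m x * V x $ m * V x $ l)"
      unfolding sum.distrib[symmetric]
    proof (rule sum.cong[OF refl])
      fix k
      let ?T = "\<Sum>l\<in>UNIV. G x $ k $ l * V x $ l"
      have "D x $ k $ i * ?T = ?dv k * ?T + ?T * (\<Sum>m\<in>UNIV. Ga k i m x * V x $ m)"
        unfolding D_entry distrib_right by (rule arg_cong2[where f = "(+)", OF refl mult.commute])
      also have "?T * (\<Sum>m\<in>UNIV. Ga k i m x * V x $ m) = (\<Sum>l\<in>UNIV. \<Sum>m\<in>UNIV. G x $ k $ l * Ga k i m x * V x $ m * V x $ l)"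
        unfolding sum_product by (simp add: mult_ac)
      also have "?dv k * ?T = (\<Sum>l\<in>UNIV. ?dv k * G x $ k $ l * V x $ l)" by (simp add: sum_distrib_left mult.assoc)
      finally show "D x $ k $ i * ?T = (\<Sum>l\<in>UNIV. ?dv k * G x $ k $ l * V x $ l
        + (\<Sum>m\<in>UNIV. G x $ k $ l * Ga k i m x * V x $ m * V x $ l))" by (simp only: sum.distrib)
    qed
    also have "(\<Sum>k\<in>UNIV. \<Sum>l\<in>UNIV. \<Sum>m\<in>UNIV. G x $ k $ l * Ga k i m x * V x $ m * V x $ l)
       = (\<Sum>l\<in>UNIV. \<Sum>m\<in>UNIV. \<Sum>k\<in>UNIV. G x $ k $ l * Ga k i m x * V x $ m * V x $ l)"
      by (subst sum.swap) (intro sum.cong refl sum.swap)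
    also have "\<dots> = (\<Sum>l\<in>UNIV. \<Sum>m\<in>UNIV. (\<Sum>k\<in>UNIV. G x $ l $ k * Ga k i m x) * V x $ m * V x $ l)"
      unfolding sum_distrib_right
    proof (intro sum.cong refl)
      fix l m k
      show "G x $ k $ l * Ga k i m x * V x $ m * V x $ l = G x $ l $ k * Ga k i m x * V x $ m * V x $ l"
        using G_sym[OF x, of k l] by simp
    qed
    also have "\<dots> = (\<Sum>l\<in>UNIV. \<Sum>m\<in>UNIV. 1/2 * (V x $ l * ?d i m l * V x $ m))
       + 1/2 * ((\<Sum>l\<in>UNIV. \<Sum>m\<in>UNIV. V x $ l * ?d m i l * V x $ m) - (\<Sum>l\<in>UNIV. \<Sum>m\<in>UNIV. V x $ l * ?d l i m * V x $ m))"
      unfolding G_Ga[OF x] by (simp add: sum.distrib sum_subtractf sum_distrib_left algebra_simps)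
    \<comment> \<open>Exchange of l and m: the antisymmetric part of the lowered Christoffel symbol
      vanishes on the pair V, V.\<close>
    also have "(\<Sum>l\<in>UNIV. \<Sum>m\<in>UNIV. V x $ l * ?d m i l * V x $ m) = (\<Sum>l\<in>UNIV. \<Sum>m\<in>UNIV. V x $ l * ?d l i m * V x $ m)"
      by (subst sum.swap) (simp add: mult_ac)
    also have "(\<Sum>l\<in>UNIV. \<Sum>m\<in>UNIV. 1/2 * (V x $ l * ?d i m l * V x $ m)) = 1/2 * (\<Sum>k\<in>UNIV. \<Sum>l\<in>UNIV. V x $ k * ?d i k l * V x $ l)"
      by (subst sum.swap) (simp add: sum_distrib_left mult_ac)
    finally show ?thesis using 1 by simp
  qed
  have "(u has_derivative (\<lambda>h. \<Sum>i\<in>UNIV. h $ i *\<^sub>R partial_deriv i u x)) (at x)"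
    by (rule has_derivative_partials[OF Ck_on_differentiable[OF uC x]])
  moreover have "(\<Sum>i\<in>UNIV. h $ i *\<^sub>R partial_deriv i u x) = 2 * ((D x *v h) \<bullet> (G x *v V x))" for h
  proof -
    have "D x *v h = D x *v (\<Sum>i\<in>UNIV. h $ i *\<^sub>R axis i 1)"
      using basis_expansion[of h] by (simp add: scalar_mult_eq_scaleR)
    also have "\<dots> = (\<Sum>i\<in>UNIV. h $ i *\<^sub>R (D x *v axis i 1))"
      by (simp add: linear_sum[OF matrix_vector_mul_linear] matrix_vector_mult_scaleR)
    finally show ?thesis unfolding pu by (simp add: inner_sum_left sum_distrib_left mult_ac)
  qed
  ultimately show ?thesis by simp
qed

end

section \<open>Cutoff functions and coverings\<close>

lemma Ck_on_Un:
  assumes "open S" "open T" "Ck_on k S f" "Ck_on k T f"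
  shows "Ck_on k (S \<union> T) f"
  using assms(3,4)
proof (induction k arbitrary: f)
  case 0
  then show ?case by (simp add: continuous_on_open_Un assms(1,2))
next
  case (Suc k)
  then show ?case by (simp add: ball_Un)
qed

lemma Ck_on_ident: "Ck_on k S (\<lambda>x. x)"
proof (cases k)
  case (Suc m)
  have "partial_deriv i (\<lambda>x. x) = (\<lambda>x. axis i 1)" for i :: 'a
    using partial_deriv_eqI[OF has_derivative_ident] by fast
  then show ?thesis unfolding Suc by (simp add: Ck_on_const)
qed simp

lemma C1_compose:
  fixes f :: "real^'n::finite \<Rightarrow> real" and \<Phi> :: "real^'m::finite \<Rightarrow> real^'n"
  assumes S: "open S" and f: "Ck_on (Suc 0) T f" and \<Phi>: "Ck_on (Suc 0) S \<Phi>" and im: "\<And>x. x \<in> S \<Longrightarrow> \<Phi> x \<in> T"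
  shows "Ck_on (Suc 0) S (\<lambda>x. f (\<Phi> x))"
proof -
  have d: "((\<lambda>x. f (\<Phi> x)) has_derivative
      (\<lambda>h. \<Sum>j\<in>UNIV. frechet_derivative \<Phi> (at x) h $ j *\<^sub>R partial_deriv j f (\<Phi> x))) (at x)" if "x \<in> S" for x
  proof -
    have "(\<Phi> has_derivative frechet_derivative \<Phi> (at x)) (at x)"
      using \<Phi> that by (simp add: frechet_derivative_works[symmetric])
    moreover have "(f has_derivative (\<lambda>h. \<Sum>j\<in>UNIV. h $ j *\<^sub>R partial_deriv j f (\<Phi> x))) (at (\<Phi> x))"
      using f im[OF that] by (intro has_derivative_partials) simp
    ultimately show ?thesis by (rule has_derivative_compose)
  qed
  have "continuous_on S (partial_deriv i (\<lambda>x. f (\<Phi> x)))" for i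
  proof -
    have "continuous_on S (\<lambda>x. \<Sum>j\<in>UNIV. partial_deriv i \<Phi> x $ j *\<^sub>R partial_deriv j f (\<Phi> x))"
    proof (intro continuous_on_sum continuous_on_scaleR continuous_on_component)
      show "continuous_on S (partial_deriv i \<Phi>)" using \<Phi> by simp
      have c\<Phi>: "continuous_on S \<Phi>" by (rule Ck_on_imp_continuous_on[OF \<Phi>])
      show "continuous_on S (\<lambda>x. partial_deriv j f (\<Phi> x))" for j
        by (rule continuous_on_compose2[OF _ c\<Phi>, of T]) (use f im in auto)
    qed
    moreover have "(\<Sum>j\<in>UNIV. partial_deriv i \<Phi> x $ j *\<^sub>R partial_deriv j f (\<Phi> x)) = partial_deriv i (\<lambda>x. f (\<Phi> x)) x" if "x \<in> S" for x
      using partial_deriv_eqI[OF d[OF that], of i] by (simp add: partial_deriv_def)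
    ultimately show ?thesis by (rule continuous_on_cong[THEN iffD1, OF refl, rotated])
  qed
  then show ?thesis using d by (auto simp: differentiable_def)
qed

text \<open>The square makes the truncation C^1 at the origin, which is enough for weights that are
  differentiated once.\<close>

definition pos_sq :: "real \<Rightarrow> real" where "pos_sq t = (max 0 t)^2"

lemma DERIV_pos_sq: "(pos_sq has_real_derivative 2 * max 0 t) (at t)"
proof -
  consider "t < 0" | "t > 0" | "t = 0" by linarith
  then show ?thesis
  proof cases
    case 1
    have "((\<lambda>s. 0) has_real_derivative 0) (at t)" by simp
    then have "(pos_sq has_real_derivative 0) (at t)"
      by (rule has_field_derivative_transform_within_open[of _ _ _ "{..<0}"]) (use 1 in \<open>auto simp: pos_sq_def\<close>)
    then show ?thesis using 1 by simp
  next
    case 2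
    have "((\<lambda>s. s^2) has_real_derivative 2 * t) (at t)" by (auto intro!: derivative_eq_intros)
    then have "(pos_sq has_real_derivative 2 * t) (at t)"
      by (rule has_field_derivative_transform_within_open[of _ _ _ "{0<..}"]) (use 2 in \<open>auto simp: pos_sq_def\<close>)
    then show ?thesis using 2 by simp
  next
    case 3
    \<comment> \<open>At the origin the difference quotient is \<open>max 0 h\<close>
      itself.\<close>
    have "((\<lambda>h::real. max 0 h) \<longlongrightarrow> max 0 0) (at 0)" by (intro tendsto_intros)
    moreover have "eventually (\<lambda>h::real. max 0 h = (pos_sq (0 + h) - pos_sq 0) / h) (at 0)"
      by (auto simp: eventually_at_filter pos_sq_def max_def power2_eq_square)
    ultimately have "((\<lambda>h. (pos_sq (0 + h) - pos_sq 0) / h) \<longlongrightarrow> max 0 0) (at 0)"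
      by (rule Lim_transform_eventually)
    then show ?thesis using 3 by (simp add: DERIV_def)
  qed
qed

lemma C1_pos_sq:
  fixes f :: "real^'n::finite \<Rightarrow> real"
  assumes "open S" "Ck_on (Suc 0) S f"
  shows "Ck_on (Suc 0) S (\<lambda>x. pos_sq (f x))"
proof -
  have d: "((\<lambda>x. pos_sq (f x)) has_derivative (\<lambda>h. frechet_derivative f (at x) h * (2 * max 0 (f x)))) (at x)"
    if "x \<in> S" for x
    using assms(2) that
    by (intro DERIV_compose_FDERIV[OF DERIV_pos_sq]) (simp add: frechet_derivative_works[symmetric])
  have "continuous_on S (partial_deriv i (\<lambda>x. pos_sq (f x)))" for i
  proof -
    have "continuous_on S (\<lambda>x. partial_deriv i f x * (2 * max 0 (f x)))"
      using assms(2) Ck_on_imp_continuous_on[OF assms(2)]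
      by (intro continuous_on_mult continuous_on_const continuous_on_max) auto
    moreover have "partial_deriv i f x * (2 * max 0 (f x)) = partial_deriv i (\<lambda>x. pos_sq (f x)) x" if "x \<in> S" for x
      using partial_deriv_eqI[OF d[OF that], of i] by (simp add: partial_deriv_def)
    ultimately show ?thesis by (rule continuous_on_cong[THEN iffD1, OF refl, rotated])
  qed
  then show ?thesis using d by (auto simp: differentiable_def)
qed

text \<open>The inner fraction rises from 0 at distance r/2 to 1 at distance r; the two truncations
  make the function constant on either side of this range.\<close>

definition bump :: "real^'n::finite \<Rightarrow> real \<Rightarrow> real^'n \<Rightarrow> real" where
  "bump x0 r x = pos_sq (1 - pos_sq ((4 * ((x - x0) \<bullet> (x - x0)) / r^2 - 1) / 3))"

lemma bump_C1: "Ck_on (Suc 0) UNIV (bump x0 r)" for x0 :: "real^'n::finite"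
proof -
  have "Ck_on (Suc 0) UNIV (\<lambda>x :: real^'n. pos_sq (1 - pos_sq ((4 / r^2 / 3) * (\<Sum>i\<in>UNIV. (x $ i - x0 $ i) * (x $ i - x0 $ i)) - 1 / 3)))"
    by (intro C1_pos_sq Ck_on_diff Ck_on_const Ck_on_cmult Ck_on_sum Ck_on_mult Ck_on_nth Ck_on_ident open_UNIV)
  moreover have eq: "(4 / r^2 / 3) * (\<Sum>i\<in>UNIV. (x $ i - x0 $ i) * (x $ i - x0 $ i)) - 1 / 3
     = (4 * ((x - x0) \<bullet> (x - x0)) / r^2 - 1) / 3" for x
    by (simp add: inner_vec_def diff_divide_distrib mult.commute)
  moreover have "bump x0 r = (\<lambda>x. pos_sq (1 - pos_sq ((4 / r^2 / 3) * (\<Sum>i\<in>UNIV. (x $ i - x0 $ i) * (x $ i - x0 $ i)) - 1 / 3)))"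
    by (rule ext) (simp only: bump_def eq)
  ultimately show ?thesis by (simp only:)
qed

lemma bump_range: "0 \<le> bump x0 r x" "bump x0 r x \<le> 1"
proof -
  have "0 \<le> pos_sq t" for t by (simp add: pos_sq_def)
  moreover have "pos_sq (1 - s) \<le> 1" if "0 \<le> s" for s
    using that power_mono[of "max 0 (1 - s)" 1 2] by (simp add: pos_sq_def)
  ultimately show "0 \<le> bump x0 r x" "bump x0 r x \<le> 1" by (simp_all add: bump_def)
qed

lemma bump_inner:
  assumes "dist x0 x \<le> r / 2" "r > 0"
  shows "bump x0 r x = 1"
proof -
  have "(x - x0) \<bullet> (x - x0) = (dist x0 x)^2" by (simp add: dist_norm norm_minus_commute power2_norm_eq_inner)
  also have "\<dots> \<le> (r / 2)^2" using assms by (intro power_mono) auto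
  finally have "4 * ((x - x0) \<bullet> (x - x0)) / r^2 \<le> 1" using assms(2) by (simp add: power_divide)
  then show ?thesis by (simp add: bump_def pos_sq_def)
qed

lemma bump_outer:
  assumes "r \<le> dist x0 x" "r > 0"
  shows "bump x0 r x = 0"
proof -
  have "r^2 \<le> (dist x0 x)^2" using assms by (intro power_mono) auto
  also have "\<dots> = (x - x0) \<bullet> (x - x0)" by (simp add: dist_norm norm_minus_commute power2_norm_eq_inner)
  finally have "4 \<le> 4 * ((x - x0) \<bullet> (x - x0)) / r^2" using assms(2) by (simp add: pos_le_divide_eq)
  then have "1 \<le> (4 * ((x - x0) \<bullet> (x - x0)) / r^2 - 1) / 3" by simp
  then have "1 \<le> pos_sq ((4 * ((x - x0) \<bullet> (x - x0)) / r^2 - 1) / 3)" by (simp add: pos_sq_def)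
  then show ?thesis by (simp add: bump_def pos_sq_def)
qed

text \<open>Each term takes the share \<beta> of what its predecessors left over, so the remainder
  is a product. Where some factor vanishes the sum is 1: a partition of unity without
  division.\<close>

lemma sum_telescoping_partition:
  fixes \<beta> :: "nat \<Rightarrow> real"
  shows "(\<Sum>i<N. \<beta> i * (\<Prod>j<i. 1 - \<beta> j)) = 1 - (\<Prod>j<N. 1 - \<beta> j)"
  by (induction N) (simp_all add: algebra_simps)

context riemannian
begin

section \<open>Functions of class C^1 on the manifold\<close>

definition C1_fun :: "('m \<Rightarrow> real) \<Rightarrow> bool" where
  "C1_fun f \<longleftrightarrow> (\<forall>c\<in>A. Ck_on (Suc 0) (chart_img c) (\<lambda>x. f (chart_inv c x)))"

lemma C1_funD: "C1_fun f \<Longrightarrow> c \<in> A \<Longrightarrow> Ck_on (Suc 0) (chart_img c) (\<lambda>x. f (chart_inv c x))"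
  by (simp add: C1_fun_def)

lemma C1_fun_const: "C1_fun (\<lambda>p. a)"
  unfolding C1_fun_def by (intro ballI Ck_on_const)

lemma C1_fun_mult: "C1_fun f \<Longrightarrow> C1_fun h \<Longrightarrow> C1_fun (\<lambda>p. f p * h p)"
  unfolding C1_fun_def by (intro ballI Ck_on_mult open_img) auto

lemma C1_fun_diff: "C1_fun f \<Longrightarrow> C1_fun h \<Longrightarrow> C1_fun (\<lambda>p. f p - h p)"
  unfolding C1_fun_def by (intro ballI Ck_on_diff open_img) auto

lemma C1_fun_prod: "(\<And>i. i \<in> I \<Longrightarrow> C1_fun (f i)) \<Longrightarrow> C1_fun (\<lambda>p. \<Prod>i\<in>I. f i p)"
  unfolding C1_fun_def by (intro ballI Ck_on_prod open_img) auto

definition chart_bump :: "('m, 'n) chart \<Rightarrow> real^'n \<Rightarrow> real \<Rightarrow> 'm \<Rightarrow> real" where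
  "chart_bump c x0 r p = (if p \<in> chart_dom c then bump x0 r (coords c p) else 0)"

lemma chart_bump_range: "0 \<le> chart_bump c x0 r p" "chart_bump c x0 r p \<le> 1"
  by (simp_all add: chart_bump_def bump_range)

lemma closed_inv_cball:
  assumes "c \<in> A" "cball x0 r \<subseteq> chart_img c"
  shows "closed (chart_inv c ` cball x0 r)"
  by (intro compact_imp_closed compact_continuous_image continuous_on_subset[OF cont_inv[OF assms(1)] assms(2)]) simp

lemma chart_bump_support:
  assumes c: "c \<in> A" and "r > 0" and p: "p \<notin> chart_inv c ` cball x0 r"
  shows "chart_bump c x0 r p = 0"
proof (cases "p \<in> chart_dom c")
  case True
  have "coords c p \<notin> cball x0 r"
  proof
    assume "coords c p \<in> cball x0 r"
    then have "chart_inv c (coords c p) \<in> chart_inv c ` cball x0 r" by (rule imageI)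
    then show False using p inv_coords[OF c True] by simp
  qed
  then show ?thesis using True bump_outer[of r x0 "coords c p"] \<open>r > 0\<close> by (simp add: chart_bump_def)
qed (simp add: chart_bump_def)

text \<open>Any other chart image is covered by two open sets: the overlap, where the bump is
  composed with the transition map, and the complement of a compact, hence closed, set containing
  its support.\<close>

lemma C1_fun_chart_bump:
  assumes c: "c \<in> A" and r: "r > 0" "cball x0 r \<subseteq> chart_img c"
  shows "C1_fun (chart_bump c x0 r)"
  unfolding C1_fun_def
proof
  fix d assume d: "d \<in> A"
  let ?f = "\<lambda>y. chart_bump c x0 r (chart_inv d y)"
  let ?K = "chart_inv c ` cball x0 r"
  have U1: "Ck_on (Suc 0) (overlap d c) ?f"
  proof (rule Ck_on_cong[OF overlap_open[OF d c]])
    show "Ck_on (Suc 0) (overlap d c) (\<lambda>y. bump x0 r (transition d c y))"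
      by (rule C1_compose[OF overlap_open[OF d c] bump_C1 transition_smooth[OF d c]]) simp
    show "bump x0 r (transition d c y) = ?f y" if "y \<in> overlap d c" for y
      using overlap_iff[OF d, of y c] that by (simp add: chart_bump_def transition_def)
  qed
  define U where "U = chart_img d \<inter> chart_inv d -` (- ?K)"
  have U: "open U" unfolding U_def
    by (rule continuous_open_preimage[OF cont_inv[OF d] open_img[OF d]]) (use closed_inv_cball[OF c r(2)] in auto)
  have U2: "Ck_on (Suc 0) U ?f"
    by (rule Ck_on_cong[OF U Ck_on_const[of _ _ 0]]) (simp add: U_def chart_bump_support[OF c r(1)])
  have "Ck_on (Suc 0) (overlap d c \<union> U) ?f" by (rule Ck_on_Un[OF overlap_open[OF d c] U U1 U2])
  moreover have "chart_img d \<subseteq> overlap d c \<union> U"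
  proof
    fix y assume y: "y \<in> chart_img d"
    show "y \<in> overlap d c \<union> U"
    proof (cases "chart_inv d y \<in> chart_dom c")
      case True
      then show ?thesis using overlap_iff[OF d, of y c] y by simp
    next
      case False
      have "chart_inv c z \<in> chart_dom c" if "z \<in> cball x0 r" for z using r(2) that by (intro inv_in[OF c]) blast
      then have "chart_inv d y \<notin> ?K" using False by auto
      then show ?thesis using y by (simp add: U_def)
    qed
  qed
  ultimately show "Ck_on (Suc 0) (chart_img d) ?f" by (rule Ck_on_subset)
qed

text \<open>The case distinction also catches points at infinite distance, for which
  \<open>enn2real\<close> returns 0 and the formula alone would give 1.\<close>

definition cutoff :: "'m \<Rightarrow> real \<Rightarrow> 'm \<Rightarrow> real" where
  "cutoff p0 R p = (if rdist p0 p \<le> ennreal R then 1 - enn2real (rdist p0 p) / R else 0)"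

text \<open>For s > R the left side is negative, so the bound also holds at points outside the ball;
  the Lipschitz estimate thus needs no separate treatment of the boundary sphere.\<close>

lemma cutoff_finite:
  assumes "R > 0" "rdist p0 p \<le> ennreal s" "0 \<le> s"
  shows "1 - s / R \<le> cutoff p0 R p"
proof (cases "rdist p0 p \<le> ennreal R")
  case True
  have "enn2real (rdist p0 p) \<le> s" using assms by (simp add: enn2real_leI)
  then show ?thesis using True assms(1) by (simp add: cutoff_def divide_right_mono)
next
  case False
  then have "ennreal R < ennreal s" using assms(2) by simp
  then have "R < s" using assms by (simp add: ennreal_less_iff)
  then show ?thesis using False assms(1) by (simp add: cutoff_def)
qed

lemma cutoff_range:
  assumes "R > 0"
  shows "0 \<le> cutoff p0 R p" "cutoff p0 R p \<le> 1"
proof -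
  have "enn2real (rdist p0 p) \<le> R" if "rdist p0 p \<le> ennreal R" using that assms by (intro enn2real_leI) auto
  then show "0 \<le> cutoff p0 R p" "cutoff p0 R p \<le> 1" using assms by (auto simp: cutoff_def)
qed

lemma cutoff_lipschitz:
  assumes R: "R > 0" and e: "rdist p q \<le> ennreal e" "0 \<le> e"
  shows "\<bar>cutoff p0 R p - cutoff p0 R q\<bar> \<le> e / R"
proof -
  \<comment> \<open>Only an upper bound for the difference is proved; exchanging the points gives
    the absolute value.\<close>
  have one: "cutoff p0 R p - cutoff p0 R q \<le> e / R" if pq: "rdist p q \<le> ennreal e" for p q
  proof (cases "rdist p0 p \<le> ennreal R")
    case True
    then obtain a where a: "rdist p0 p = ennreal a" "0 \<le> a" by (cases "rdist p0 p") (auto simp: top_unique)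
    have "rdist p0 q \<le> rdist p0 p + rdist p q" by (rule rdist_triangle)
    also have "\<dots> \<le> ennreal a + ennreal e" using pq a by (intro add_mono) auto
    also have "\<dots> = ennreal (a + e)" using a e by simp
    finally have "1 - (a + e) / R \<le> cutoff p0 R q" using R a e by (intro cutoff_finite) auto
    moreover have "cutoff p0 R p = 1 - a / R" using True a by (simp add: cutoff_def)
    ultimately show ?thesis by (simp add: add_divide_distrib)
  next
    case False
    then have "cutoff p0 R p = 0" by (simp add: cutoff_def)
    moreover have "0 \<le> e / R" using R e by simp
    ultimately show ?thesis using cutoff_range(1)[OF R, of p0 q] by linarith
  qed
  show ?thesis using one[of p q] one[of q p] e(1) rdist_sym[of p q] by (simp add: abs_le_iff)
qed

lemma cutoff_continuous:
  assumes R: "R > 0"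
  shows "continuous_on S (cutoff p0 R)"
proof (intro continuous_at_imp_continuous_on ballI)
  fix p
  show "isCont (cutoff p0 R) p" unfolding isCont_def
  proof (rule tendstoI)
    fix e :: real assume e: "0 < e"
    have "e * R / 2 > 0" using e R by simp
    then obtain U where U: "open U" "p \<in> U" "\<And>q. q \<in> U \<Longrightarrow> rdist p q < ennreal (e * R / 2)"
      using rdist_small_nbhd[of "e * R / 2" p] by metis
    have "dist (cutoff p0 R q) (cutoff p0 R p) < e" if "q \<in> U" for q
    proof -
      have "\<bar>cutoff p0 R p - cutoff p0 R q\<bar> \<le> (e * R / 2) / R"
        by (rule cutoff_lipschitz[OF R]) (use U(3)[OF that] e R in auto)
      then show ?thesis using e R by (simp add: dist_real_def abs_minus_commute)
    qed
    then show "\<forall>\<^sub>F q in at p. dist (cutoff p0 R q) (cutoff p0 R p) < e"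
      using U(1,2) unfolding eventually_at_topological by blast
  qed
qed

text \<open>The metric is controlled on twice the radius, because difference quotients move points
  of the inner ball by up to r.\<close>

definition good_ball :: "('m, 'n) chart \<Rightarrow> real^'n \<Rightarrow> real \<Rightarrow> bool" where
  "good_ball c x0 r \<longleftrightarrow> c \<in> A \<and> r > 0 \<and> cball x0 (2 * r) \<subseteq> chart_img c \<and>
     (\<forall>z\<in>cball x0 (2 * r). \<forall>v. v \<bullet> (g c x0 *v v) \<le> 2 * (v \<bullet> (g c z *v v)) \<and>
        v \<bullet> (g c z *v v) \<le> 2 * (v \<bullet> (g c x0 *v v)))"

lemma exists_good_ball:
  assumes "c \<in> A" "x0 \<in> chart_img c"
  obtains r where "good_ball c x0 r"
proof -
  obtain r where "r > 0" "cball x0 r \<subseteq> chart_img c"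
    "\<And>z v. z \<in> cball x0 r \<Longrightarrow> v \<bullet> (g c x0 *v v) \<le> 2 * (v \<bullet> (g c z *v v))"
    "\<And>z v. z \<in> cball x0 r \<Longrightarrow> v \<bullet> (g c z *v v) \<le> 2 * (v \<bullet> (g c x0 *v v))"
    using metric_local_bounds[OF assms] by metis
  then have "good_ball c x0 (r / 2)" using assms(1) by (simp add: good_ball_def)
  then show thesis by (rule that)
qed

lemma good_ball_sub: "good_ball c x0 r \<Longrightarrow> cball x0 r \<subseteq> chart_img c"
  using subset_cball[of r "2 * r" x0] unfolding good_ball_def by auto

text \<open>Compactness gives finitely many balls. The prescribed one is put at index 0, where the
  telescoping weight is the bump itself, and the halved balls already cover because the bumps are
  known to equal 1 there.\<close>

lemma good_ball_cover:
  assumes K: "compact K" and g0: "good_ball c0 (coords c0 p0) r0"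
  obtains N :: nat and cs xs rs where "0 < N" "cs 0 = c0" "xs 0 = coords c0 p0" "rs 0 = r0"
    "\<And>i. good_ball (cs i) (xs i) (rs i)"
    "\<And>p. p \<in> K \<Longrightarrow> \<exists>i<N. p \<in> chart_inv (cs i) ` ball (xs i) (rs i / 2)"
proof -
  have "\<exists>c r. good_ball c (coords c p) r \<and> p \<in> chart_dom c" for p
  proof -
    obtain c where c: "c \<in> A" "p \<in> chart_dom c" using charts_cover by blast
    obtain r where "good_ball c (coords c p) r" using exists_good_ball[OF c(1) coords_in[OF c]] .
    with c(2) show ?thesis by blast
  qed
  then obtain c1 r1 where c1: "\<And>p. good_ball (c1 p) (coords (c1 p) p) (r1 p)" "\<And>p. p \<in> chart_dom (c1 p)" by metis
  let ?O = "\<lambda>p. chart_inv (c1 p) ` ball (coords (c1 p) p) (r1 p / 2)"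
  have cA: "c1 p \<in> A" "r1 p > 0" for p using c1(1)[of p] by (auto simp: good_ball_def)
  have "open (?O p)" for p
  proof (rule open_inv_image[OF cA(1)])
    have "ball (coords (c1 p) p) (r1 p / 2) \<subseteq> cball (coords (c1 p) p) (r1 p)" using cA(2)[of p] by auto
    then show "ball (coords (c1 p) p) (r1 p / 2) \<subseteq> chart_img (c1 p)" using good_ball_sub[OF c1(1)] by blast
  qed simp
  moreover have "K \<subseteq> (\<Union>p\<in>K. ?O p)"
  proof
    fix p assume "p \<in> K"
    moreover have "p \<in> ?O p"
      using inv_coords[OF cA(1) c1(2)] cA(2)[of p] by (intro image_eqI[of p _ "coords (c1 p) p"]) auto
    ultimately show "p \<in> (\<Union>p\<in>K. ?O p)" by blast
  qed
  ultimately obtain F where F: "F \<subseteq> K" "finite F" "K \<subseteq> (\<Union>p\<in>F. ?O p)"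
    using compactE_image[OF K, of K ?O] by blast
  obtain l where l: "set l = F" using finite_list[OF F(2)] by blast
  \<comment> \<open>Index 0 is left to the prescribed ball. Past the end of the list
    \<open>q i\<close> is unspecified, but every point has a good ball.\<close>
  define q where "q i = l ! (i - 1)" for i :: nat
  show thesis
  proof (rule that[of "Suc (length l)" "\<lambda>i. if i = 0 then c0 else c1 (q i)"
        "\<lambda>i. if i = 0 then coords c0 p0 else coords (c1 (q i)) (q i)" "\<lambda>i. if i = 0 then r0 else r1 (q i)"])
    fix p assume "p \<in> K"
    then obtain y where y: "y \<in> F" "p \<in> ?O y" using F(3) by blast
    then obtain j where j: "j < length l" "y = l ! j" using l by (metis in_set_conv_nth)
    show "\<exists>i<Suc (length l). p \<in> chart_inv (if i = 0 then c0 else c1 (q i)) `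
        ball (if i = 0 then coords c0 p0 else coords (c1 (q i)) (q i)) ((if i = 0 then r0 else r1 (q i)) / 2)"
      using y j by (intro exI[of _ "Suc j"]) (simp add: q_def)
  qed (use g0 c1(1) in auto)
qed

end

section \<open>Almost Yamabe solitons\<close>

locale almost_yamabe = riemannian A g
  for A :: "('m::{t2_space,second_countable_topology}, 'n::finite) chart set" and g :: "('m, 'n) tensor2" +
  fixes X :: "('m, 'n) vfield" and \<rho> :: "'m \<Rightarrow> real"
  assumes soliton: "almost_yamabe_soliton A g X \<rho>" and ricci_nonpos: "ricci_nonpositive A g"
    and dim: "CARD('n) \<ge> 2"
begin

definition \<phi> :: "('m, 'n) chart \<Rightarrow> real^'n \<Rightarrow> real" where
  "\<phi> c x = scalar_curvature (g c) x - \<rho> (chart_inv c x)"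

abbreviation cov :: "('m, 'n) chart \<Rightarrow> real^'n \<Rightarrow> real^'n^'n" where
  "cov c \<equiv> covariant_derivative (g c) (X c)"

abbreviation energy :: "('m, 'n) chart \<Rightarrow> real^'n \<Rightarrow> real" where
  "energy c \<equiv> chart_field.u (g c) (X c)"

abbreviation flux :: "('m, 'n) vfield" where
  "flux c \<equiv> chart_field.Y (g c) (X c)"

abbreviation cov_sq :: "('m, 'n) chart \<Rightarrow> real^'n \<Rightarrow> real" where
  "cov_sq c x \<equiv> conformal_norm_sq (cov c x)"

lemma field_Ck:
  assumes c: "c \<in> A" shows "Ck_on k (chart_img c) (X c)"
proof -
  have "smooth_vector_field A X" using soliton by (simp add: almost_yamabe_soliton_def)
  then show ?thesis using c unfolding smooth_vector_field_def smooth_on_def by blast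
qed

lemma chart_field: "c \<in> A \<Longrightarrow> chart_field (chart_img c) (g c) (X c)"
  by unfold_locales (auto intro: open_img metric_entry_Ck metric_pos_def Ck_on_nth field_Ck)

lemma field_transform:
  assumes "c \<in> A" "d \<in> A" "p \<in> chart_dom c" "p \<in> chart_dom d"
  shows "X d (coords d p) = jac c d (coords c p) *v X c (coords c p)"
proof -
  have "smooth_vector_field A X" using soliton by (simp add: almost_yamabe_soliton_def)
  note conjunct2[OF this[unfolded smooth_vector_field_def]]
  from this[rule_format, OF assms(1,2) IntI[OF assms(3,4)]] show ?thesis .
qed

lemma energy_def: "c \<in> A \<Longrightarrow> energy c x = X c x \<bullet> (g c x *v X c x)"
  using chart_field.u_def[OF chart_field] .

lemma flux_def: "c \<in> A \<Longrightarrow> flux c x = cov c x *v X c x - trace (cov c x) *\<^sub>R X c x"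
  using chart_field.Y_def[OF chart_field] .

lemma conformal:
  assumes c: "c \<in> A" and x: "x \<in> chart_img c"
  shows "g c x ** cov c x + transpose (g c x ** cov c x) = (2 * \<phi> c x) *\<^sub>R g c x"
proof -
  have "(1/2) *\<^sub>R lie_derivative (X c) (g c) x = \<phi> c x *\<^sub>R g c x"
    using soliton c x by (simp add: almost_yamabe_soliton_def \<phi>_def)
  then have "2 *\<^sub>R ((1/2) *\<^sub>R lie_derivative (X c) (g c) x) = 2 *\<^sub>R (\<phi> c x *\<^sub>R g c x)" by simp
  then have "lie_derivative (X c) (g c) x = (2 * \<phi> c x) *\<^sub>R g c x" by simp
  then show ?thesis using chart_field.lie_derivative_eq[OF chart_field[OF c] x] by simp
qed

lemmas cov_matrix = conformal_matrix[OF metric_pos_def conformal]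

lemma cov_sq_nonneg: "c \<in> A \<Longrightarrow> x \<in> chart_img c \<Longrightarrow> 0 \<le> cov_sq c x"
  using cov_matrix(2) by blast

lemma energy_nonneg: "c \<in> A \<Longrightarrow> x \<in> chart_img c \<Longrightarrow> 0 \<le> energy c x"
  unfolding energy_def using pos_def_nonneg[OF metric_pos_def] by blast

lemma divergence_flux_le:
  assumes c: "c \<in> A" and x: "x \<in> chart_img c"
  shows "(\<Sum>i\<in>UNIV. partial_deriv i (\<lambda>y. flux c y $ i) x)
     + (\<Sum>i\<in>UNIV. \<Sum>k\<in>UNIV. christoffel (g c) k k i x * flux c x $ i) \<le> - cov_sq c x"
proof -
  have "X c x \<bullet> (ricci (g c) x *v X c x) \<le> 0" using ricci_nonpos c x by (simp add: ricci_nonpositive_def)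
  then show ?thesis
    unfolding chart_field.divergence_Y[OF chart_field[OF c] x] using cov_matrix(4)[OF c x c x dim] by linarith
qed

lemma flux_norm_le:
  assumes c: "c \<in> A" and x: "x \<in> chart_img c"
  shows "flux c x \<bullet> (g c x *v flux c x) \<le> 2 * (1 + real CARD('n)) * cov_sq c x * energy c x"
  unfolding energy_def[OF c] by (rule cov_matrix(5)[OF c x c x flux_def[OF c]])

text \<open>The adjoint of \<nabla>X is 2 \<phi> - \<nabla>X, so the differential of |X|^2 can be
  rewritten with \<nabla>_X X, the first part of the flux.\<close>

lemma energy_derivative:
  assumes c: "c \<in> A" and x: "x \<in> chart_img c"
  shows "(energy c has_derivative frechet_derivative (energy c) (at x)) (at x)"
    and "frechet_derivative (energy c) (at x) h
      = 4 * \<phi> c x * (h \<bullet> (g c x *v X c x)) - 2 * (h \<bullet> (g c x *v (cov c x *v X c x)))"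
proof -
  note d = chart_field.u_derivative[OF chart_field[OF c] x]
  then show "(energy c has_derivative frechet_derivative (energy c) (at x)) (at x)"
    unfolding frechet_derivative_works[symmetric] differentiable_def by blast
  have tr: "transpose (g c x ** cov c x) = (2 * \<phi> c x) *\<^sub>R g c x - g c x ** cov c x"
    using conformal[OF c x] by (simp add: eq_diff_eq add.commute)
  have gs: "transpose (g c x) = g c x" using metric_pos_def[OF c x] by (simp add: pos_def_def)
  have "(cov c x *v h) \<bullet> (g c x *v X c x) = h \<bullet> (transpose (g c x ** cov c x) *v X c x)"
    unfolding inner_matrix_transpose by (simp add: matrix_vector_mul_assoc matrix_transpose_mul gs)
  also have "\<dots> = 2 * \<phi> c x * (h \<bullet> (g c x *v X c x)) - h \<bullet> (g c x *v (cov c x *v X c x))"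
    unfolding tr
    by (simp add: matrix_vector_mult_diff_rdistrib scaleR_matrix_vector_assoc[symmetric] inner_diff_right
        matrix_vector_mul_assoc)
  finally show "frechet_derivative (energy c) (at x) h
      = 4 * \<phi> c x * (h \<bullet> (g c x *v X c x)) - 2 * (h \<bullet> (g c x *v (cov c x *v X c x)))"
    unfolding frechet_derivative_at[OF d, symmetric] by simp
qed

text \<open>This expresses \<open>flux\<close> through \<open>|X|\<^sup>2\<close> and \<open>\<phi> X\<close> only, so that its invariance needs no
  transformation law for Christoffel symbols.\<close>

lemma flux_inner:
  assumes c: "c \<in> A" and x: "x \<in> chart_img c"
  shows "v \<bullet> (g c x *v flux c x) = (2 - real CARD('n)) * (\<phi> c x * (v \<bullet> (g c x *v X c x)))
     - 1/2 * frechet_derivative (energy c) (at x) v"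
  unfolding energy_derivative(2)[OF c x] flux_def[OF c] cov_matrix(1)[OF c x c x]
  by (simp add: matrix_vector_mult_diff_distrib matrix_vector_mult_scaleR inner_diff_right algebra_simps)

text \<open>Comparing the two expressions for the differential of |X|^2 in the direction X
  determines \<phi>, wherever X does not vanish, by chart independent quantities.\<close>

lemma energy_derivative_self:
  assumes c: "c \<in> A" and x: "x \<in> chart_img c"
  shows "frechet_derivative (energy c) (at x) (X c x) = 2 * \<phi> c x * energy c x"
proof -
  note d = chart_field.u_derivative[OF chart_field[OF c] x]
  have "(cov c x *v X c x) \<bullet> (g c x *v X c x) = X c x \<bullet> (g c x *v (cov c x *v X c x))"
    by (rule pos_def_inner_commute[OF metric_pos_def[OF c x]])
  then have "frechet_derivative (energy c) (at x) (X c x) = 2 * (X c x \<bullet> (g c x *v (cov c x *v X c x)))"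
    unfolding frechet_derivative_at[OF d, symmetric] by simp
  then show ?thesis using energy_derivative(2)[OF c x, of "X c x"] energy_def[OF c, of x] by simp
qed

section \<open>Independence of the chart\<close>

lemma energy_transform:
  assumes c: "c \<in> A" and d: "d \<in> A" and x: "x \<in> overlap c d"
  shows "energy d (transition c d x) = energy c x"
proof -
  obtain p where p: "p \<in> chart_dom c" "p \<in> chart_dom d" "x = coords c p" using x by blast
  show ?thesis
    using norm_metric_transform[OF c d p(1,2)] field_transform[OF c d p(1,2)]
    by (simp add: energy_def[OF c] energy_def[OF d] p(3) transition_coords[OF c p(1)])
qed

lemma transition_img: "c \<in> A \<Longrightarrow> d \<in> A \<Longrightarrow> x \<in> overlap c d \<Longrightarrow> transition c d x \<in> chart_img d"
  using transition_in overlap_iff by blast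

lemma pullback_derivative:
  assumes c: "c \<in> A" and d: "d \<in> A" and x: "x \<in> overlap c d"
    and f: "f differentiable (at (transition c d x))"
    and eq: "\<And>y. y \<in> overlap c d \<Longrightarrow> f (transition c d y) = h y"
  shows "frechet_derivative h (at x) v = frechet_derivative f (at (transition c d x)) (jac c d x *v v)"
proof -
  have "(f has_derivative frechet_derivative f (at (transition c d x))) (at (transition c d x))"
    using f frechet_derivative_works by blast
  from has_derivative_compose[OF transition_has_derivative[OF c d x] this]
  have "(h has_derivative (\<lambda>v. frechet_derivative f (at (transition c d x)) (jac c d x *v v))) (at x)"
    by (rule has_derivative_transform_within_open[OF _ overlap_open[OF c d] x]) (rule eq)
  from frechet_derivative_at[OF this] show ?thesis by metis
qed

lemma energy_derivative_transform:
  assumes c: "c \<in> A" and d: "d \<in> A" and x: "x \<in> overlap c d"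
  shows "frechet_derivative (energy c) (at x) v
     = frechet_derivative (energy d) (at (transition c d x)) (jac c d x *v v)"
  by (rule pullback_derivative[OF c d x])
    (use energy_derivative(1)[OF d transition_img[OF c d x]] energy_transform[OF c d] in
      \<open>auto simp: differentiable_def\<close>)

text \<open>The transformation law of the volume density excludes a vanishing Jacobian determinant,
  since densities are positive.\<close>

lemma jac_surj:
  assumes c: "c \<in> A" and d: "d \<in> A" and x: "x \<in> overlap c d"
  obtains v where "jac c d x *v v = w"
proof -
  have "x \<in> chart_img c" using x overlap_iff[OF c] by blast
  then have "det (jac c d x) \<noteq> 0"
    using vol_density_transform[OF c d x] vol_density_pos[OF c] by fastforce
  then have "invertible (jac c d x)" by (simp add: invertible_det_nz)
  then have "jac c d x *v (matrix_inv (jac c d x) *v w) = w"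
    by (simp add: matrix_vector_mul_assoc matrix_inv_right)
  then show thesis by (rule that)
qed

text \<open>By nondegeneracy it suffices to pair with arbitrary vectors. In
  \<open>flux_inner\<close> the energy term is the differential of an invariant function; for \<phi>
  X, either X vanishes or \<open>energy_derivative_self\<close> shows that \<phi> agrees in both
  charts.\<close>

lemma flux_transform:
  assumes c: "c \<in> A" and d: "d \<in> A" and p: "p \<in> chart_dom c" "p \<in> chart_dom d"
  shows "flux d (coords d p) = jac c d (coords c p) *v flux c (coords c p)"
proof -
  let ?x = "coords c p" and ?y = "coords d p" and ?J = "jac c d (coords c p)"
  have x: "?x \<in> overlap c d" using p by blast
  have xi: "?x \<in> chart_img c" and yi: "?y \<in> chart_img d" using coords_in c d p by auto
  have T: "transition c d ?x = ?y" by (rule transition_coords[OF c p(1)])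
  note nm = norm_metric_transform[OF c d p] and ft = field_transform[OF c d p]
  have ph: "\<phi> d ?y * ((?J *v v) \<bullet> (g d ?y *v X d ?y)) = \<phi> c ?x * (v \<bullet> (g c ?x *v X c ?x))" for v
  proof (cases "X c ?x = 0")
    case True
    then show ?thesis by (simp add: ft)
  next
    case False
    have "2 * \<phi> c ?x * energy c ?x = 2 * \<phi> d ?y * energy d ?y"
      using energy_derivative_self[OF c xi] energy_derivative_self[OF d yi]
        energy_derivative_transform[OF c d x, of "X c ?x"] T ft by simp
    moreover have "energy d ?y = energy c ?x" using energy_transform[OF c d x] T by simp
    moreover have "energy c ?x > 0" using False metric_pos_def[OF c xi] by (simp add: energy_def[OF c] pos_def_def)
    ultimately have "\<phi> c ?x = \<phi> d ?y" by simp
    then show ?thesis by (simp add: ft nm)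
  qed
  have eq: "(?J *v v) \<bullet> (g d ?y *v flux d ?y) = (?J *v v) \<bullet> (g d ?y *v (?J *v flux c ?x))" for v
    unfolding nm flux_inner[OF c xi] flux_inner[OF d yi] ph
    using energy_derivative_transform[OF c d x, of v] T by simp
  \<comment> \<open>The image of v is the difference of the two candidates, which makes the norm of
    that difference zero.\<close>
  obtain v where v: "?J *v v = flux d ?y - ?J *v flux c ?x" using jac_surj[OF c d x] .
  have "(?J *v v) \<bullet> (g d ?y *v (?J *v v)) = 0"
    using eq[of v] by (simp add: v matrix_vector_mult_diff_distrib inner_diff_right)
  then have "?J *v v = 0" using metric_pos_def[OF d yi] unfolding pos_def_def by (metis less_irrefl)
  then show ?thesis using v by simp
qed

text \<open>As a function on the manifold, the derivative along the flux can be summed over all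
  weights before integrating; in separate charts this cancellation would be invisible.\<close>

definition dY :: "('m \<Rightarrow> real) \<Rightarrow> 'm \<Rightarrow> real" where
  "dY \<psi> p = (let c = chart_at A p in
     frechet_derivative (\<lambda>y. \<psi> (chart_inv c y)) (at (coords c p)) (flux c (coords c p)))"

lemma C1_fun_differentiable:
  "C1_fun \<psi> \<Longrightarrow> c \<in> A \<Longrightarrow> x \<in> chart_img c \<Longrightarrow> (\<lambda>y. \<psi> (chart_inv c y)) differentiable (at x)"
  using C1_funD[of \<psi> c] by simp

lemma dY_chart:
  assumes \<psi>: "C1_fun \<psi>" and c: "c \<in> A" and p: "p \<in> chart_dom c"
  shows "dY \<psi> p = frechet_derivative (\<lambda>y. \<psi> (chart_inv c y)) (at (coords c p)) (flux c (coords c p))"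
proof -
  let ?d = "chart_at A p"
  note d = chart_at[of p]
  have x: "coords c p \<in> overlap c ?d" using p d by blast
  have "frechet_derivative (\<lambda>y. \<psi> (chart_inv c y)) (at (coords c p)) (flux c (coords c p))
     = frechet_derivative (\<lambda>y. \<psi> (chart_inv ?d y)) (at (transition c ?d (coords c p))) (jac c ?d (coords c p) *v flux c (coords c p))"
    by (rule pullback_derivative[OF c d(1) x])
      (use C1_fun_differentiable[OF \<psi> d(1) transition_img[OF c d(1) x]] inv_transition[OF c d(1)] in auto)
  then show ?thesis
    using flux_transform[OF c d(1) p d(2)] transition_coords[OF c p] by (simp add: dY_def Let_def)
qed

lemma dY_locally_const:
  assumes "open U" "p \<in> U" "\<And>q. q \<in> U \<Longrightarrow> \<psi> q = a"
  shows "dY \<psi> p = 0"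
proof -
  let ?c = "chart_at A p"
  note c = chart_at[of p]
  have "open (coords ?c ` (U \<inter> chart_dom ?c))" using assms(1) open_dom[OF c(1)] by (intro open_coords_image[OF c(1)]) auto
  then have "((\<lambda>y. \<psi> (chart_inv ?c y)) has_derivative (\<lambda>h. 0)) (at (coords ?c p))"
    by (rule has_derivative_transform_within_open[OF has_derivative_const[of a]])
      (use assms(2,3) c inv_coords[OF c(1)] in auto)
  from frechet_derivative_at[OF this] show ?thesis by (simp add: dY_def Let_def) (metis (no_types))
qed

lemma dY_sum:
  assumes "\<And>i. i \<in> I \<Longrightarrow> C1_fun (\<psi> i)"
  shows "dY (\<lambda>p. \<Sum>i\<in>I. \<psi> i p) p = (\<Sum>i\<in>I. dY (\<psi> i) p)"
proof -
  let ?c = "chart_at A p"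
  note c = chart_at[of p]
  have "((\<lambda>y. \<Sum>i\<in>I. \<psi> i (chart_inv ?c y)) has_derivative
     (\<lambda>h. \<Sum>i\<in>I. frechet_derivative (\<lambda>y. \<psi> i (chart_inv ?c y)) (at (coords ?c p)) h)) (at (coords ?c p))"
    using C1_fun_differentiable[OF assms c(1) coords_in[OF c]]
    by (intro has_derivative_sum) (simp add: frechet_derivative_works[symmetric])
  from frechet_derivative_at[OF this, symmetric] show ?thesis by (simp add: dY_def Let_def)
qed

lemma flux_Ck: "c \<in> A \<Longrightarrow> Ck_on k (chart_img c) (\<lambda>x. flux c x $ i)"
  by (rule chart_field.Y_Ck[OF chart_field])

lemma vol_density_C1:
  assumes c: "c \<in> A"
  shows "Ck_on (Suc 0) (chart_img c) (vol_density c)"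
    and "x \<in> chart_img c \<Longrightarrow> partial_deriv i (vol_density c) x = vol_density c x * (\<Sum>k\<in>UNIV. christoffel (g c) k k i x)"
proof -
  have cm: "chart_metric (chart_img c) (g c)" using chart_field[OF c] by (simp add: chart_field_def)
  have pd: "partial_deriv i (vol_density c) x = vol_density c x * (\<Sum>k\<in>UNIV. christoffel (g c) k k i x)"
    if "x \<in> chart_img c" for i x
    using chart_metric.sqrt_det_derivative(1)[OF cm that, of i] by (simp add: vol_density_def[abs_def])
  have df: "vol_density c differentiable (at x)" if "x \<in> chart_img c" for x
    using chart_metric.sqrt_det_derivative(2)[OF cm that] by (simp add: vol_density_def[abs_def])
  have "continuous_on (chart_img c) (partial_deriv i (vol_density c))" for i
  proof -
    have "continuous_on (chart_img c) (\<lambda>x. vol_density c x * (\<Sum>k\<in>UNIV. christoffel (g c) k k i x))"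
      by (intro continuous_on_mult continuous_on_sum vol_density_continuous[OF c]
          Ck_on_imp_continuous_on[OF chart_metric.Ga_Ck[OF cm, of 0]])
    then show ?thesis by (rule continuous_on_cong[THEN iffD1, OF refl, rotated]) (simp add: pd)
  qed
  then show "Ck_on (Suc 0) (chart_img c) (vol_density c)" using df by simp
  show "x \<in> chart_img c \<Longrightarrow> partial_deriv i (vol_density c) x = vol_density c x * (\<Sum>k\<in>UNIV. christoffel (g c) k k i x)"
    by (rule pd)
qed

lemma cov_sq_continuous: "c \<in> A \<Longrightarrow> continuous_on (chart_img c) (cov_sq c)"
proof -
  assume c: "c \<in> A"
  have e: "continuous_on (chart_img c) (\<lambda>x. cov c x $ i $ j)" for i j
    by (rule Ck_on_imp_continuous_on[OF chart_field.D_Ck[OF chart_field[OF c], of 0]])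
  show ?thesis
    unfolding conformal_norm_sq_def trace_def matrix_matrix_mult_def
    by (auto intro!: continuous_intros e)
qed

lemma flux_continuous: "c \<in> A \<Longrightarrow> continuous_on (chart_img c) (\<lambda>x. flux c x $ i)"
  by (rule Ck_on_imp_continuous_on[OF flux_Ck[of _ 0]])

lemma energy_continuous: "c \<in> A \<Longrightarrow> continuous_on (chart_img c) (energy c)"
proof -
  assume c: "c \<in> A"
  have "isCont (energy c) x" if "x \<in> chart_img c" for x
    using energy_derivative(1)[OF c that] has_derivative_continuous by blast
  then show ?thesis by (intro continuous_at_imp_continuous_on) blast
qed

lemma test_derivative:
  assumes "C1_fun \<psi>" "c \<in> A" "x \<in> chart_img c"
  shows "frechet_derivative (\<lambda>y. \<psi> (chart_inv c y)) (at x) (flux c x)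
     = (\<Sum>j\<in>UNIV. partial_deriv j (\<lambda>y. \<psi> (chart_inv c y)) x * flux c x $ j)"
  using frechet_derivative_at[OF has_derivative_partials[OF C1_fun_differentiable[OF assms]], symmetric]
  by (simp add: mult.commute)

lemma test_derivative_continuous:
  assumes \<psi>: "C1_fun \<psi>" and c: "c \<in> A"
  shows "continuous_on (chart_img c) (\<lambda>x. frechet_derivative (\<lambda>y. \<psi> (chart_inv c y)) (at x) (flux c x))"
proof -
  have "continuous_on (chart_img c) (\<lambda>x. \<Sum>j\<in>UNIV. partial_deriv j (\<lambda>y. \<psi> (chart_inv c y)) x * flux c x $ j)"
    using C1_funD[OF \<psi> c] by (intro continuous_on_sum continuous_on_mult flux_continuous[OF c]) auto
  then show ?thesis
    by (rule continuous_on_cong[THEN iffD1, OF refl, rotated]) (simp add: test_derivative[OF \<psi> c])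
qed

end

section \<open>The energy estimate\<close>

lemma integrable_cball:
  fixes f :: "'a::euclidean_space \<Rightarrow> real"
  assumes "continuous_on (cball x r) f"
  shows "integrable lborel (\<lambda>y. indicator (cball x r) y * f y)"
  using borel_integrable_compact[OF compact_cball assms] by simp

text \<open>The product is split into \<eta> sqrt h and a sqrt (b u). The coefficient 1 of
  \<open>\<eta>^2 * h\<close> against the 2 on the left allows half of the energy to be
  absorbed.\<close>

lemma young_bound:
  fixes N h u \<eta> a b :: real
  assumes "N^2 \<le> b * h * u" "0 \<le> h" "0 \<le> u" "0 \<le> \<eta>" "0 \<le> a" "0 \<le> b"
  shows "2 * (a * (\<eta> * N)) \<le> \<eta>^2 * h + a^2 * b * u"
proof -
  have "N \<le> sqrt (b * h * u)" using assms(1) by (rule real_le_rsqrt)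
  also have "\<dots> = sqrt h * sqrt (b * u)" by (simp add: real_sqrt_mult)
  finally have "a * (\<eta> * N) \<le> a * (\<eta> * (sqrt h * sqrt (b * u)))" using assms by (intro mult_left_mono) auto
  also have "2 * \<dots> = 2 * (\<eta> * sqrt h) * (a * sqrt (b * u))" by simp
  also have "\<dots> \<le> (\<eta> * sqrt h)^2 + (a * sqrt (b * u))^2" by (rule sum_squares_bound)
  also have "\<dots> = \<eta>^2 * h + a^2 * b * u" using assms by (simp add: power_mult_distrib)
  finally show ?thesis by simp
qed

context almost_yamabe
begin

text \<open>The divergence inequality is integrated against \<eta>^2 \<psi> in one chart. The
  derivative falling on \<eta>^2 is bounded through difference quotients and absorbed at the cost of
  half of the left side, whence the factor 2 on the term with the derivative of \<psi>.\<close>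

lemma local_energy:
  assumes good: "good_ball c x0 r" and \<psi>: "C1_fun \<psi>" "\<And>p. 0 \<le> \<psi> p"
    and supp: "\<And>p. p \<notin> chart_inv c ` cball x0 r \<Longrightarrow> \<psi> p = 0"
    and \<eta>: "continuous_on UNIV \<eta>" "\<And>p. 0 \<le> \<eta> p"
    and L: "0 \<le> L" "\<And>p q e. rdist p q \<le> ennreal e \<Longrightarrow> 0 \<le> e \<Longrightarrow> \<bar>\<eta> p - \<eta> q\<bar> \<le> L * e"
  shows "(\<integral>x. indicator (cball x0 r) x * ((\<eta> (chart_inv c x))^2 * (\<psi> (chart_inv c x) * (vol_density c x * cov_sq c x))) \<partial>lborel)
    \<le> 32 * real CARD('n)^2 * (1 + real CARD('n)) * L^2
        * (\<integral>x. indicator (cball x0 r) x * (\<psi> (chart_inv c x) * (vol_density c x * energy c x)) \<partial>lborel)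
      + 2 * (\<integral>x. indicator (cball x0 r) x * ((\<eta> (chart_inv c x))^2
          * (vol_density c x * frechet_derivative (\<lambda>y. \<psi> (chart_inv c y)) (at x) (flux c x))) \<partial>lborel)"
    (is "?I \<le> _ * ?E + 2 * ?P")
proof -
  have c: "c \<in> A" and r: "r > 0" and sub2: "cball x0 (2 * r) \<subseteq> chart_img c"
    and cmp: "\<And>z v. z \<in> cball x0 (2 * r) \<Longrightarrow> v \<bullet> (g c x0 *v v) \<le> 2 * (v \<bullet> (g c z *v v))"
      "\<And>z v. z \<in> cball x0 (2 * r) \<Longrightarrow> v \<bullet> (g c z *v v) \<le> 2 * (v \<bullet> (g c x0 *v v))"
    using good by (auto simp: good_ball_def)
  let ?n = "real CARD('n)" let ?U = "chart_img c" let ?K = "cball x0 r"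
  have U: "open ?U" by (rule open_img[OF c])
  have KU: "?K \<subseteq> ?U" by (rule good_ball_sub[OF good])
  have x0: "x0 \<in> ?U" using KU r by auto
  define f where "f x = \<psi> (chart_inv c x)" for x
  define w where "w = vol_density c"
  define \<theta> where "\<theta> x = \<eta> (chart_inv c x)" for x
  define N where "N x = sqrt (flux c x \<bullet> (g c x *v flux c x))" for x
  define df where "df x = frechet_derivative f (at x) (flux c x)" for x
  have f0: "f x = 0" if "x \<in> ?U" "x \<notin> ?K" for x
  proof -
    have "chart_inv c x \<notin> chart_inv c ` ?K"
    proof
      assume "chart_inv c x \<in> chart_inv c ` ?K"
      then obtain z where z: "z \<in> ?K" "chart_inv c x = chart_inv c z" by blast
      then have "x = z" using coords_inv[OF c that(1)] coords_inv[OF c, of z] KU by auto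
      then show False using z that by simp
    qed
    then show ?thesis by (simp add: f_def supp)
  qed
  have fnn: "0 \<le> f x" and \<theta>nn: "0 \<le> \<theta> x" for x by (simp_all add: f_def \<theta>_def \<psi>(2) \<eta>(2))
  have wpos: "0 < w x" if "x \<in> ?U" for x unfolding w_def by (rule vol_density_pos[OF c that])
  have fC: "Ck_on (Suc 0) ?U f" unfolding f_def by (rule C1_funD[OF \<psi>(1) c])
  have wC: "Ck_on (Suc 0) ?U w" unfolding w_def by (rule vol_density_C1(1)[OF c])
  have c\<theta>: "continuous_on ?U \<theta>" unfolding \<theta>_def
    by (rule continuous_on_compose2[OF \<eta>(1) cont_inv[OF c]]) simp
  obtain E :: "real^'n^'n" where E: "transpose E ** g c x0 ** E = mat 1"
    using exists_orthonormal_frame[OF metric_pos_def[OF c x0]] .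
  \<comment> \<open>The e a are orthonormal for the metric at the centre, and the columns of b form
    the dual frame; constants then depend on n only.\<close>
  define e where "e a = column a E" for a
  define b where "b = g c x0 ** E"
  have ee: "e a \<bullet> (g c x0 *v e a) = 1" for a
    using frame_norm[OF E, of "axis a 1"] by (simp add: e_def matrix_vector_mult_basis inner_axis_axis)
  have bE: "(\<Sum>a\<in>UNIV. b $ i $ a * E $ j $ a) = (if i = j then 1 else 0)" for i j
  proof -
    have "b ** transpose E = mat 1"
      unfolding b_def using frame_inverse(2,5)[OF E] by (simp add: matrix_mul_assoc[symmetric])
    then have "(b ** transpose E) $ i $ j = mat 1 $ i $ j" by simp
    then show ?thesis by (simp add: matrix_matrix_mult_def transpose_def mat_def)
  qed
  \<comment> \<open>The field \<psi> Y times the volume density, extended by zero: its coordinate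
    divergence is the density times the Riemannian divergence of \<psi> Y. The z a are its
    components in the frame.\<close>
  define Z where "Z i x = (if x \<in> ?U then f x * (w x * flux c x $ i) else 0)" for i x
  define z where "z a x = (\<Sum>i\<in>UNIV. b $ i $ a * Z i x)" for a x
  have ZC: "Ck_on (Suc 0) UNIV (Z i)" for i
  proof -
    have 1: "Ck_on (Suc 0) ?U (Z i)"
      by (rule Ck_on_cong[OF U Ck_on_mult[OF U fC Ck_on_mult[OF U wC flux_Ck[OF c, of _ i]]]])
        (simp add: Z_def)
    have K': "open (- ?K)" by (simp add: open_Compl)
    have 2: "Ck_on (Suc 0) (- ?K) (Z i)"
      by (rule Ck_on_cong[OF K' Ck_on_const[of _ _ 0]]) (simp add: Z_def f0)
    have "?U \<union> - ?K = UNIV" using KU by blast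
    then show ?thesis using Ck_on_Un[OF U K' 1 2] by simp
  qed
  have zC: "Ck_on (Suc 0) UNIV (z a)" for a
    unfolding z_def by (intro Ck_on_sum Ck_on_cmult ZC open_UNIV)
  have dZ: "Z i differentiable (at x)" for i x using ZC[of i] by simp
  define z' where "z' a x h = (\<Sum>j\<in>UNIV. h $ j * partial_deriv j (z a) x)" for a x h
  have dz: "(z a has_derivative z' a x) (at x)" for a x
    using has_derivative_partials[of "z a" x] zC[of a] unfolding z'_def by simp
  have cz': "continuous_on UNIV (\<lambda>x. z' a x v)" for a v
    unfolding z'_def using zC[of a] by (intro continuous_on_sum continuous_on_mult continuous_on_const) auto
  have z0: "z a x = 0" if "x \<notin> ?K" for a x
  proof -
    have "Z i x = 0" for i using f0[of x] that by (cases "x \<in> ?U") (simp_all add: Z_def)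
    then show ?thesis by (simp add: z_def)
  qed
  have pz: "partial_deriv j (z a) x = (\<Sum>i\<in>UNIV. b $ i $ a * partial_deriv j (Z i) x)" for j a x
    unfolding z_def
    by (simp add: partial_deriv_sum partial_deriv_mult dZ differentiable_mult
        partial_deriv_eqI[OF has_derivative_const])
  \<comment> \<open>A constant frame and its dual compute the same divergence as the coordinate
    axes.\<close>
  have div: "(\<Sum>a\<in>UNIV. z' a x (e a)) = (\<Sum>j\<in>UNIV. partial_deriv j (Z j) x)" for x
  proof -
    have "(\<Sum>a\<in>UNIV. z' a x (e a)) = (\<Sum>a\<in>UNIV. \<Sum>j\<in>UNIV. \<Sum>i\<in>UNIV. b $ i $ a * E $ j $ a * partial_deriv j (Z i) x)"
      by (simp add: z'_def pz e_def column_def sum_distrib_left mult_ac)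
    also have "\<dots> = (\<Sum>j\<in>UNIV. \<Sum>a\<in>UNIV. \<Sum>i\<in>UNIV. b $ i $ a * E $ j $ a * partial_deriv j (Z i) x)"
      by (rule sum.swap)
    also have "\<dots> = (\<Sum>j\<in>UNIV. \<Sum>i\<in>UNIV. \<Sum>a\<in>UNIV. b $ i $ a * E $ j $ a * partial_deriv j (Z i) x)"
      by (intro sum.cong[OF refl] sum.swap)
    also have "\<dots> = (\<Sum>j\<in>UNIV. \<Sum>i\<in>UNIV. (if i = j then 1 else 0) * partial_deriv j (Z i) x)"
      unfolding bE[symmetric] sum_distrib_right ..
    also have "\<dots> = (\<Sum>j\<in>UNIV. partial_deriv j (Z j) x)"
      by (intro sum.cong[OF refl]) (simp add: if_distrib[of "\<lambda>t. t * _"] sum.delta cong: if_cong)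
    finally show ?thesis .
  qed
  \<comment> \<open>The derivative of the density w supplies the contracted Christoffel symbols that
    complete the partial derivatives to the divergence of the flux.\<close>
  have div_le: "(\<Sum>a\<in>UNIV. z' a x (e a)) \<le> w x * df x - f x * (w x * cov_sq c x)" if x: "x \<in> ?U" for x
  proof -
    have d: "f differentiable (at x)" "w differentiable (at x)" "(\<lambda>y. flux c y $ j) differentiable (at x)" for j
      using fC wC flux_Ck[OF c, of "Suc 0" j] x by auto
    have "partial_deriv j (Z j) x = partial_deriv j (\<lambda>y. f y * (w y * flux c y $ j)) x" for j
      by (rule partial_deriv_cong[OF U x]) (simp add: Z_def)
    also have "\<dots> j = f x * (w x * partial_deriv j (\<lambda>y. flux c y $ j) x + partial_deriv j w x * flux c x $ j)
        + partial_deriv j f x * (w x * flux c x $ j)" for j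
      using d by (simp add: partial_deriv_mult differentiable_mult)
    finally have "partial_deriv j (Z j) x
       = f x * (w x * (partial_deriv j (\<lambda>y. flux c y $ j) x + (\<Sum>k\<in>UNIV. christoffel (g c) k k j x * flux c x $ j)))
         + w x * (partial_deriv j f x * flux c x $ j)" for j
      using vol_density_C1(2)[OF c x] by (simp add: w_def algebra_simps sum_distrib_left sum_distrib_right)
    then have "(\<Sum>j\<in>UNIV. partial_deriv j (Z j) x)
       = f x * (w x * ((\<Sum>i\<in>UNIV. partial_deriv i (\<lambda>y. flux c y $ i) x)
          + (\<Sum>i\<in>UNIV. \<Sum>k\<in>UNIV. christoffel (g c) k k i x * flux c x $ i)))
         + w x * (\<Sum>j\<in>UNIV. partial_deriv j f x * flux c x $ j)"
      by (simp add: sum.distrib flip: sum_distrib_left)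
    also have "(\<Sum>j\<in>UNIV. partial_deriv j f x * flux c x $ j) = df x"
      unfolding df_def f_def using test_derivative[OF \<psi>(1) c x] by simp
    also have "f x * (w x * ((\<Sum>i\<in>UNIV. partial_deriv i (\<lambda>y. flux c y $ i) x)
          + (\<Sum>i\<in>UNIV. \<Sum>k\<in>UNIV. christoffel (g c) k k i x * flux c x $ i))) \<le> f x * (w x * - cov_sq c x)"
      using fnn[of x] wpos[OF x] by (intro mult_left_mono divergence_flux_le[OF c x]) auto
    finally show ?thesis unfolding div by simp
  qed
  \<comment> \<open>Components in the frame are bounded by the norm for the metric at
    \<open>x0\<close>; exchanging it for the metric at x costs sqrt 2.\<close>
  have z_le: "\<bar>z a x\<bar> \<le> sqrt 2 * (f x * (w x * N x))" if x: "x \<in> ?K" for a x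
  proof -
    have xU: "x \<in> ?U" and x2: "x \<in> cball x0 (2 * r)" using x KU r by auto
    define y where "y = (transpose E ** g c x0) *v flux c x"
    have fl: "flux c x = E *v y" unfolding y_def by (simp add: matrix_vector_mul_assoc frame_inverse(1)[OF E])
    have "y $ a = (\<Sum>i\<in>UNIV. b $ i $ a * flux c x $ i)"
    proof -
      have "transpose E ** g c x0 = transpose b"
        using metric_pos_def[OF c x0] by (simp add: b_def matrix_transpose_mul pos_def_def)
      then show ?thesis by (simp add: y_def matrix_vector_mult_def transpose_def)
    qed
    then have "z a x = f x * (w x * y $ a)"
      using xU by (simp add: z_def Z_def sum_distrib_left mult_ac)
    moreover have "\<bar>y $ a\<bar> \<le> sqrt 2 * N x"
    proof -
      have "\<bar>y $ a\<bar> \<le> norm y" by (rule component_le_norm_cart)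
      also have "\<dots> = sqrt (flux c x \<bullet> (g c x0 *v flux c x))" unfolding fl frame_norm[OF E] by (rule norm_eq_sqrt_inner)
      also have "\<dots> \<le> sqrt (2 * (flux c x \<bullet> (g c x *v flux c x)))" by (intro real_sqrt_le_mono cmp(1)[OF x2])
      finally show ?thesis by (simp add: N_def real_sqrt_mult)
    qed
    ultimately have "\<bar>z a x\<bar> \<le> f x * (w x * (sqrt 2 * N x))"
      using fnn[of x] wpos[OF xU] by (simp add: abs_mult) (intro mult_left_mono; simp)
    then show ?thesis by (simp add: mult_ac)
  qed
  have cN: "continuous_on ?U N"
  proof -
    have gC: "continuous_on ?U (\<lambda>x. g c x $ i $ j)" for i j by (rule Ck_on_imp_continuous_on[OF metric_entry_Ck[OF c, of 0]])
    show ?thesis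
      unfolding N_def inner_vec_def matrix_vector_mult_def
      by (auto intro!: continuous_intros gC flux_continuous[OF c])
  qed
  have cf: "continuous_on ?K f" and cw: "continuous_on ?K w" and cN: "continuous_on ?K N" and c\<theta>K: "continuous_on ?K \<theta>"
    and ch: "continuous_on ?K (cov_sq c)" and cu: "continuous_on ?K (energy c)" and cdf: "continuous_on ?K df"
    using Ck_on_imp_continuous_on[OF fC] Ck_on_imp_continuous_on[OF wC] cN c\<theta> cov_sq_continuous[OF c]
      energy_continuous[OF c] test_derivative_continuous[OF \<psi>(1) c, folded f_def[abs_def]]
    unfolding df_def[abs_def] by (auto intro: continuous_on_subset[OF _ KU])
  have cz: "continuous_on ?K (z a)" for a using Ck_on_imp_continuous_on[OF zC] by (rule continuous_on_subset) simp
  have cz'K: "continuous_on ?K (\<lambda>x. z' a x v)" for a v using cz' by (rule continuous_on_subset) simp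
  define J where "J = (\<integral>x. indicator ?K x * (\<theta> x * (f x * (w x * N x))) \<partial>lborel)"
  have iJ: "integrable lborel (\<lambda>x. indicator ?K x * (\<theta> x * (f x * (w x * N x))))"
    by (intro integrable_cball continuous_on_mult c\<theta>K cf cw cN)
  have iI: "integrable lborel (\<lambda>x. indicator ?K x * ((\<theta> x)^2 * (f x * (w x * cov_sq c x))))"
    by (intro integrable_cball continuous_on_mult continuous_on_power c\<theta>K cf cw ch)
  have iP: "integrable lborel (\<lambda>x. indicator ?K x * ((\<theta> x)^2 * (w x * df x)))"
    by (intro integrable_cball continuous_on_mult continuous_on_power c\<theta>K cw cdf)
  have iE: "integrable lborel (\<lambda>x. indicator ?K x * (f x * (w x * energy c x)))"
    by (intro integrable_cball continuous_on_mult cf cw cu)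
  have iz: "integrable lborel (\<lambda>x. indicator ?K x * ((\<theta> x)^2 * z' a x (e a)))" for a
    by (intro integrable_cball continuous_on_mult continuous_on_power c\<theta>K cz'K)
  have iza: "integrable lborel (\<lambda>x. indicator ?K x * (\<theta> x * \<bar>z a x\<bar>))" for a
    by (intro integrable_cball continuous_on_mult continuous_on_rabs c\<theta>K cz)
  \<comment> \<open>Up to \<delta> times a frame vector has Euclidean length at most r; the summand
    1 keeps the denominator positive.\<close>
  define \<delta> where "\<delta> = r / (1 + (\<Sum>a\<in>UNIV. norm (e a)))"
  have sum_nn: "0 \<le> (\<Sum>a\<in>UNIV. norm (e a))" by (simp add: sum_nonneg)
  have \<delta>: "\<delta> > 0" using r sum_nn by (simp add: \<delta>_def)
  have \<delta>e: "\<delta> * norm (e a) \<le> r" for a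
  proof -
    have "norm (e a) \<le> (\<Sum>a\<in>UNIV. norm (e a))" by (intro member_le_sum) auto
    then have "r * norm (e a) \<le> r * (1 + (\<Sum>a\<in>UNIV. norm (e a)))" using r by (intro mult_left_mono) auto
    then show ?thesis using sum_nn by (simp add: \<delta>_def divide_le_eq add_pos_nonneg)
  qed
  \<comment> \<open>One sqrt 2 comes from the length of segments in direction e a, the other from
    \<open>z_le\<close>; with the 2 produced by the squared cutoff they give 4.\<close>
  have ibp: "\<bar>\<integral>x. indicator ?K x * ((\<theta> x)^2 * z' a x (e a)) \<partial>lborel\<bar> \<le> 4 * L * J" for a
  proof -
    have "\<bar>\<integral>x. indicator ?K x * ((\<theta> x)^2 * z' a x (e a)) \<partial>lborel\<bar>
       \<le> 2 * (sqrt 2 * L) * (\<integral>x. indicator ?K x * (\<theta> x * \<bar>z a x\<bar>) \<partial>lborel)"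
    proof (rule integral_directional_derivative_bound[OF compact_cball U KU dz cz' z0 c\<theta> \<theta>nn \<delta>])
      show "0 \<le> sqrt 2 * L" using L(1) by simp
      fix x t assume x: "x \<in> ?K" and t: "0 < t" "t \<le> \<delta>"
      have seg: "x + s *\<^sub>R (t *\<^sub>R e a) \<in> cball x0 (2 * r)" if "s \<in> {0..1}" for s
      proof -
        have "norm (s *\<^sub>R (t *\<^sub>R e a)) = s * (t * norm (e a))" using that t by simp
        also have "\<dots> \<le> 1 * (\<delta> * norm (e a))" using that t by (intro mult_mono) auto
        also have "\<dots> \<le> r" using \<delta>e by simp
        finally have "norm (s *\<^sub>R (t *\<^sub>R e a)) \<le> r" .
        moreover have "dist x0 (x + s *\<^sub>R (t *\<^sub>R e a)) \<le> dist x0 x + norm (s *\<^sub>R (t *\<^sub>R e a))"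
          by (metis dist_triangle dist_add_cancel dist_0_norm add.right_neutral)
        ultimately show ?thesis using x by simp
      qed
      have "rdist (chart_inv c x) (chart_inv c (x + t *\<^sub>R e a)) \<le> ennreal (sqrt 2 * t)"
      proof (rule rdist_segment[OF c])
        fix s :: real assume "s \<in> {0..1}"
        note q = seg[OF this]
        show "x + s *\<^sub>R t *\<^sub>R e a \<in> ?U" using q sub2 by blast
        have "(t *\<^sub>R e a) \<bullet> (g c x0 *v (t *\<^sub>R e a)) = t^2"
          by (simp add: matrix_vector_mult_scaleR ee power2_eq_square)
        then show "(t *\<^sub>R e a) \<bullet> (g c (x + s *\<^sub>R t *\<^sub>R e a) *v (t *\<^sub>R e a)) \<le> (sqrt 2 * t)^2"
          using cmp(2)[OF q, of "t *\<^sub>R e a"] by (simp add: power_mult_distrib)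
      qed (use t in simp)
      from L(2)[OF this] have "\<bar>\<theta> x - \<theta> (x + t *\<^sub>R e a)\<bar> \<le> L * (sqrt 2 * t)" using t by (simp add: \<theta>_def)
      moreover have "x + t *\<^sub>R e a \<in> ?U" using seg[of 1] sub2 by auto
      ultimately show "x + t *\<^sub>R e a \<in> ?U \<and> \<bar>\<theta> (x + t *\<^sub>R e a) - \<theta> x\<bar> \<le> sqrt 2 * L * t"
        by (simp add: abs_minus_commute mult_ac)
    qed
    also have "(\<integral>x. indicator ?K x * (\<theta> x * \<bar>z a x\<bar>) \<partial>lborel) \<le> (\<integral>x. sqrt 2 * (indicator ?K x * (\<theta> x * (f x * (w x * N x)))) \<partial>lborel)"
    proof (rule integral_mono[OF iza])
      show "integrable lborel (\<lambda>x. sqrt 2 * (indicator ?K x * (\<theta> x * (f x * (w x * N x)))))" using iJ by simp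
      show "indicator ?K x * (\<theta> x * \<bar>z a x\<bar>) \<le> sqrt 2 * (indicator ?K x * (\<theta> x * (f x * (w x * N x))))" for x
      proof (cases "x \<in> ?K")
        case True
        then show ?thesis using mult_left_mono[OF z_le[OF True, of a] \<theta>nn[of x]] by (simp add: mult_ac)
      qed simp
    qed
    also have "\<dots> = sqrt 2 * J" using iJ by (simp add: J_def)
    finally have "\<bar>\<integral>x. indicator ?K x * ((\<theta> x)^2 * z' a x (e a)) \<partial>lborel\<bar> \<le> 2 * (sqrt 2 * L) * (sqrt 2 * J)"
      using L(1) by (simp add: mult_left_mono)
    also have "2 * (sqrt 2 * L) * (sqrt 2 * J) = 4 * L * J" by simp
    finally show ?thesis .
  qed
  have I: "?I = (\<integral>x. indicator ?K x * ((\<theta> x)^2 * (f x * (w x * cov_sq c x))) \<partial>lborel)"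
    and Eq: "?E = (\<integral>x. indicator ?K x * (f x * (w x * energy c x)) \<partial>lborel)"
    and P: "?P = (\<integral>x. indicator ?K x * ((\<theta> x)^2 * (w x * df x)) \<partial>lborel)"
    by (simp_all add: \<theta>_def f_def[abs_def] w_def df_def[abs_def])
  have "(\<Sum>a\<in>UNIV. \<integral>x. indicator ?K x * ((\<theta> x)^2 * z' a x (e a)) \<partial>lborel)
     = (\<integral>x. (\<Sum>a\<in>UNIV. indicator ?K x * ((\<theta> x)^2 * z' a x (e a))) \<partial>lborel)"
    using iz by (intro Bochner_Integration.integral_sum[symmetric]) auto
  also have "\<dots> \<le> (\<integral>x. indicator ?K x * ((\<theta> x)^2 * (w x * df x))
       - indicator ?K x * ((\<theta> x)^2 * (f x * (w x * cov_sq c x))) \<partial>lborel)"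
  proof (rule integral_mono)
    show "integrable lborel (\<lambda>x. \<Sum>a\<in>UNIV. indicator ?K x * ((\<theta> x)^2 * z' a x (e a)))" using iz by (intro Bochner_Integration.integrable_sum) auto
    show "integrable lborel (\<lambda>x. indicator ?K x * ((\<theta> x)^2 * (w x * df x))
       - indicator ?K x * ((\<theta> x)^2 * (f x * (w x * cov_sq c x))))" using iP iI by simp
    show "(\<Sum>a\<in>UNIV. indicator ?K x * ((\<theta> x)^2 * z' a x (e a))) \<le> indicator ?K x * ((\<theta> x)^2 * (w x * df x))
       - indicator ?K x * ((\<theta> x)^2 * (f x * (w x * cov_sq c x)))" for x
    proof (cases "x \<in> ?K")
      case True
      then have "(\<theta> x)^2 * (\<Sum>a\<in>UNIV. z' a x (e a)) \<le> (\<theta> x)^2 * (w x * df x - f x * (w x * cov_sq c x))"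
        using KU by (intro mult_left_mono div_le) auto
      then show ?thesis using True by (simp add: sum_distrib_left right_diff_distrib)
    qed simp
  qed
  also have "\<dots> = ?P - ?I" unfolding I P using iP iI by simp
  finally have "?I \<le> ?P - (\<Sum>a\<in>UNIV. \<integral>x. indicator ?K x * ((\<theta> x)^2 * z' a x (e a)) \<partial>lborel)" by simp
  also have "\<dots> \<le> ?P + (\<Sum>a\<in>(UNIV::'n set). 4 * L * J)"
  proof -
    have "(\<Sum>a\<in>(UNIV::'n set). - (4 * L * J)) \<le> (\<Sum>a\<in>UNIV. \<integral>x. indicator ?K x * ((\<theta> x)^2 * z' a x (e a)) \<partial>lborel)"
      using ibp by (intro sum_mono) (simp add: abs_le_iff minus_le_iff)
    then show ?thesis by (simp add: sum_negf)
  qed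
  also have "(\<Sum>a\<in>(UNIV::'n set). 4 * L * J) = 4 * ?n * L * J" by simp
  finally have main: "?I \<le> ?P + 4 * ?n * L * J" .
  \<comment> \<open>Young's inequality with a = 4 n L and, from \<open>flux_norm_le\<close>, b = 2
    (1 + n); this explains the constant a^2 b = 32 n^2 (1 + n) L^2.\<close>
  have "2 * (4 * ?n * L * J) = (\<integral>x. 2 * (4 * ?n * L) * (indicator ?K x * (\<theta> x * (f x * (w x * N x)))) \<partial>lborel)"
    using iJ by (simp add: J_def)
  also have "\<dots> \<le> (\<integral>x. indicator ?K x * ((\<theta> x)^2 * (f x * (w x * cov_sq c x)))
      + 32 * ?n^2 * (1 + ?n) * L^2 * (indicator ?K x * (f x * (w x * energy c x))) \<partial>lborel)"
  proof (rule integral_mono)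
    show "integrable lborel (\<lambda>x. 2 * (4 * ?n * L) * (indicator ?K x * (\<theta> x * (f x * (w x * N x)))))" using iJ by simp
    show "integrable lborel (\<lambda>x. indicator ?K x * ((\<theta> x)^2 * (f x * (w x * cov_sq c x)))
      + 32 * ?n^2 * (1 + ?n) * L^2 * (indicator ?K x * (f x * (w x * energy c x))))" using iI iE by simp
    show "2 * (4 * ?n * L) * (indicator ?K x * (\<theta> x * (f x * (w x * N x))))
      \<le> indicator ?K x * ((\<theta> x)^2 * (f x * (w x * cov_sq c x)))
      + 32 * ?n^2 * (1 + ?n) * L^2 * (indicator ?K x * (f x * (w x * energy c x)))" for x
    proof (cases "x \<in> ?K")
      case True
      then have xU: "x \<in> ?U" using KU by blast
      have "(N x)^2 \<le> 2 * (1 + ?n) * cov_sq c x * energy c x"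
        using flux_norm_le[OF c xU] pos_def_nonneg[OF metric_pos_def[OF c xU], of "flux c x"] by (simp add: N_def)
      then have "2 * (4 * ?n * L * (\<theta> x * N x)) \<le> (\<theta> x)^2 * cov_sq c x + (4 * ?n * L)^2 * (2 * (1 + ?n)) * energy c x"
        using cov_sq_nonneg[OF c xU] energy_nonneg[OF c xU] \<theta>nn[of x] L(1) by (intro young_bound) auto
      then have "(f x * w x) * (2 * (4 * ?n * L * (\<theta> x * N x)))
        \<le> (f x * w x) * ((\<theta> x)^2 * cov_sq c x + (4 * ?n * L)^2 * (2 * (1 + ?n)) * energy c x)"
        using fnn[of x] wpos[OF xU] by (intro mult_left_mono) auto
      moreover have "(f x * w x) * (2 * (4 * ?n * L * (\<theta> x * N x))) = 2 * (4 * ?n * L) * (\<theta> x * (f x * (w x * N x)))"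
        by (simp add: mult_ac)
      moreover have "(f x * w x) * ((\<theta> x)^2 * cov_sq c x + (4 * ?n * L)^2 * (2 * (1 + ?n)) * energy c x)
        = (\<theta> x)^2 * (f x * (w x * cov_sq c x)) + 32 * ?n^2 * (1 + ?n) * L^2 * (f x * (w x * energy c x))"
        by (simp add: power_mult_distrib algebra_simps)
      ultimately have "2 * (4 * ?n * L) * (\<theta> x * (f x * (w x * N x)))
        \<le> (\<theta> x)^2 * (f x * (w x * cov_sq c x)) + 32 * ?n^2 * (1 + ?n) * L^2 * (f x * (w x * energy c x))"
        by (simp only:)
      then show ?thesis using True by simp
    qed simp
  qed
  also have "\<dots> = ?I + 32 * ?n^2 * (1 + ?n) * L^2 * ?E" unfolding I Eq using iI iE by simp
  finally show ?thesis using main by linarith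
qed

end

section \<open>Continuous functions and integrals through charts\<close>

context riemannian
begin

lemma continuous_on_charts:
  fixes F :: "'m \<Rightarrow> real"
  assumes "\<And>c. c \<in> A \<Longrightarrow> \<exists>G. continuous_on (chart_img c) G \<and> (\<forall>p\<in>chart_dom c. F p = G (coords c p))"
  shows "continuous_on UNIV F"
proof (intro continuous_at_imp_continuous_on ballI)
  fix p
  obtain c where c: "c \<in> A" "p \<in> chart_dom c" using charts_cover by blast
  obtain G where G: "continuous_on (chart_img c) G" "\<And>p. p \<in> chart_dom c \<Longrightarrow> F p = G (coords c p)"
    using assms[OF c(1)] by blast
  have "continuous_on (chart_dom c) (\<lambda>p. G (coords c p))"
    by (rule continuous_on_compose2[OF G(1) cont_coords[OF c(1)]]) (use coords_in[OF c(1)] in blast)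
  then have "continuous_on (chart_dom c) F" by (rule continuous_on_cong[THEN iffD1, OF refl, rotated]) (simp add: G(2))
  then show "isCont F p" using open_dom[OF c(1)] c(2) by (simp add: continuous_on_eq_continuous_at)
qed

lemma C1_fun_continuous:
  assumes "C1_fun \<psi>" shows "continuous_on UNIV \<psi>"
proof (rule continuous_on_charts)
  fix c assume c: "c \<in> A"
  show "\<exists>G. continuous_on (chart_img c) G \<and> (\<forall>p\<in>chart_dom c. \<psi> p = G (coords c p))"
    using Ck_on_imp_continuous_on[OF C1_funD[OF assms c]] inv_coords[OF c]
    by (intro exI[of _ "\<lambda>x. \<psi> (chart_inv c x)"]) simp
qed

lemma volume_integral_supported:
  fixes F :: "'m \<Rightarrow> real"
  assumes c: "c \<in> A" and K: "K \<subseteq> chart_img c" and F: "F \<in> borel_measurable borel"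
    and supp: "\<And>p. p \<notin> chart_inv c ` K \<Longrightarrow> F p = 0"
  shows "integrable (riemannian_volume A g) F \<longleftrightarrow>
      integrable lborel (\<lambda>x. indicator K x * (vol_density c x * F (chart_inv c x)))"
    and "(\<integral>p. F p \<partial>riemannian_volume A g) = (\<integral>x. indicator K x * (vol_density c x * F (chart_inv c x)) \<partial>lborel)"
proof -
  have "F p = indicator (chart_dom c) p * F p" for p
  proof (cases "p \<in> chart_dom c")
    case False
    have "p \<notin> chart_inv c ` K"
    proof
      assume "p \<in> chart_inv c ` K"
      then obtain x where "x \<in> K" "p = chart_inv c x" by blast
      then show False using inv_in[OF c, of x] K False by auto
    qed
    then show ?thesis using supp by simp
  qed simp
  then have 1: "F = (\<lambda>p. indicator (chart_dom c) p * F p)" by (rule ext)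
  have 2: "(\<lambda>x. indicator (chart_img c) x * vol_density c x * F (chart_inv c x))
     = (\<lambda>x. indicator K x * (vol_density c x * F (chart_inv c x)))"
  proof
    fix x
    show "indicator (chart_img c) x * vol_density c x * F (chart_inv c x)
      = indicator K x * (vol_density c x * F (chart_inv c x))"
    proof (cases "x \<in> K")
      case True
      then show ?thesis using K by auto
    next
      case False
      have "F (chart_inv c x) = 0" if x: "x \<in> chart_img c"
      proof (rule supp)
        show "chart_inv c x \<notin> chart_inv c ` K"
        proof
          assume "chart_inv c x \<in> chart_inv c ` K"
          then obtain y where y: "y \<in> K" "chart_inv c x = chart_inv c y" by blast
          then have "x = y" using coords_inv[OF c x] coords_inv[OF c, of y] K by auto
          then show False using y False by simp
        qed
      qed
      then show ?thesis using False by (cases "x \<in> chart_img c") auto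
    qed
  qed
  show "integrable (riemannian_volume A g) F \<longleftrightarrow>
      integrable lborel (\<lambda>x. indicator K x * (vol_density c x * F (chart_inv c x)))"
    using volume_integral_chart(1)[OF c F] unfolding 1[symmetric] 2 .
  show "(\<integral>p. F p \<partial>riemannian_volume A g) = (\<integral>x. indicator K x * (vol_density c x * F (chart_inv c x)) \<partial>lborel)"
    using volume_integral_chart(2)[OF c F] unfolding 1[symmetric] 2 .
qed

end

context almost_yamabe
begin

lemma dY_continuous:
  assumes "C1_fun \<psi>" shows "continuous_on UNIV (dY \<psi>)"
proof (rule continuous_on_charts)
  fix c assume c: "c \<in> A"
  show "\<exists>G. continuous_on (chart_img c) G \<and> (\<forall>p\<in>chart_dom c. dY \<psi> p = G (coords c p))"
    using test_derivative_continuous[OF assms c] dY_chart[OF assms c] by blast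
qed

lemma vfield_norm_sq:
  assumes c: "c \<in> A" and p: "p \<in> chart_dom c"
  shows "(vfield_norm A g X p)^2 = energy c (coords c p)"
proof -
  let ?d = "chart_at A p"
  note d = chart_at[of p]
  have "coords c p \<in> overlap c ?d" using p d by blast
  from energy_transform[OF c d(1) this] have "energy ?d (coords ?d p) = energy c (coords c p)"
    by (simp add: transition_coords[OF c p])
  moreover have "vfield_norm A g X p = sqrt (energy ?d (coords ?d p))"
    by (simp add: vfield_norm_def Let_def energy_def[OF d(1)])
  ultimately show ?thesis using energy_nonneg[OF c coords_in[OF c p]] by simp
qed

text \<open>The local estimates are added over weights that sum to 1 on the compact ball of radius
  R. The derivatives of the weights then cancel, and of the nonnegative left sides only the one of
  the given ball is kept.\<close>

lemma energy_estimate: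
  assumes complete: "riemannian_complete A g" and L2: "norm_in_L2 A g X"
    and good: "good_ball c0 (coords c0 p0) r0" and R: "R > 0"
  shows "(\<integral>x. indicator (cball (coords c0 p0) r0) x * ((cutoff p0 R (chart_inv c0 x))^2
      * (chart_bump c0 (coords c0 p0) r0 (chart_inv c0 x) * (vol_density c0 x * cov_sq c0 x))) \<partial>lborel)
    \<le> 32 * real CARD('n)^2 * (1 + real CARD('n)) * (1 / R)^2 * (\<integral>p. (vfield_norm A g X p)^2 \<partial>riemannian_volume A g)"
proof -
  let ?vol = "riemannian_volume A g" and ?nX = "\<lambda>p. (vfield_norm A g X p)^2" and ?\<eta> = "cutoff p0 R"
  let ?C = "32 * real CARD('n)^2 * (1 + real CARD('n)) * (1 / R)^2"
  have K: "compact {q. rdist p0 q \<le> ennreal R}" by (rule Hopf_Rinow[OF complete])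
  obtain N :: nat and cs xs rs where N: "0 < N" and cs0: "cs 0 = c0" "xs 0 = coords c0 p0" "rs 0 = r0"
    and gb: "\<And>i. good_ball (cs i) (xs i) (rs i)"
    and cover: "\<And>p. p \<in> {q. rdist p0 q \<le> ennreal R} \<Longrightarrow> \<exists>i<N. p \<in> chart_inv (cs i) ` ball (xs i) (rs i / 2)"
  proof (rule good_ball_cover[OF K good])
    fix N :: nat and cs xs rs
    assume a: "0 < N" "cs 0 = c0" "xs 0 = coords c0 p0" "rs 0 = r0"
      and b: "\<And>i. good_ball (cs i) (xs i) (rs i)"
        "\<And>p. p \<in> {q. rdist p0 q \<le> ennreal R} \<Longrightarrow> \<exists>i<N. p \<in> chart_inv (cs i) ` ball (xs i) (rs i / 2)"
    show thesis by (rule that[OF a b])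
  qed
  have cA: "cs i \<in> A" "rs i > 0" "cball (xs i) (rs i) \<subseteq> chart_img (cs i)" for i
    using gb[of i] good_ball_sub by (auto simp: good_ball_def)
  define \<beta> where "\<beta> i = chart_bump (cs i) (xs i) (rs i)" for i
  define \<psi> where "\<psi> i p = \<beta> i p * (\<Prod>j<i. 1 - \<beta> j p)" for i p
  have \<beta>01: "0 \<le> \<beta> i p" "\<beta> i p \<le> 1" for i p by (simp_all add: \<beta>_def chart_bump_range)
  have \<beta>C: "C1_fun (\<beta> i)" for i unfolding \<beta>_def by (rule C1_fun_chart_bump[OF cA])
  have \<psi>C: "C1_fun (\<psi> i)" for i
    unfolding \<psi>_def by (intro C1_fun_mult C1_fun_prod C1_fun_diff C1_fun_const \<beta>C)
  have \<psi>nn: "0 \<le> \<psi> i p" for i p using \<beta>01 by (simp add: \<psi>_def prod_nonneg)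
  have \<psi>supp: "\<psi> i p = 0" if "p \<notin> chart_inv (cs i) ` cball (xs i) (rs i)" for i p
    using chart_bump_support[OF cA(1,2) that] by (simp add: \<psi>_def \<beta>_def)
  have sum: "(\<Sum>i<N. \<psi> i p) = 1 - (\<Prod>j<N. 1 - \<beta> j p)" for p
    unfolding \<psi>_def by (rule sum_telescoping_partition)
  have sum_le: "(\<Sum>i<N. \<psi> i p) \<le> 1" for p unfolding sum using \<beta>01 by (simp add: prod_nonneg)
  \<comment> \<open>An open set is required: the vanishing of the summed derivative at p needs the
    sum to be constant near p.\<close>
  define W where "W = (\<Union>i<N. chart_inv (cs i) ` ball (xs i) (rs i / 2))"
  have "open W" unfolding W_def
  proof (intro open_UN ballI)
    fix i
    have "ball (xs i) (rs i / 2) \<subseteq> cball (xs i) (rs i)" using cA(2)[of i] by auto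
    then show "open (chart_inv (cs i) ` ball (xs i) (rs i / 2))"
      using cA(3)[of i] by (intro open_inv_image[OF cA(1)]) auto
  qed
  have sum_W: "(\<Sum>i<N. \<psi> i p) = 1" if "p \<in> W" for p
  proof -
    obtain i x where i: "i < N" "x \<in> ball (xs i) (rs i / 2)" "p = chart_inv (cs i) x" using \<open>p \<in> W\<close> unfolding W_def by blast
    have "ball (xs i) (rs i / 2) \<subseteq> cball (xs i) (rs i)" using cA(2)[of i] by auto
    then have x: "x \<in> chart_img (cs i)" using i(2) cA(3)[of i] by blast
    have "\<beta> i p = 1"
      using i(2,3) bump_inner[of "xs i" x "rs i"] cA(2)[of i] coords_inv[OF cA(1) x] inv_in[OF cA(1) x]
      by (simp add: \<beta>_def chart_bump_def)
    then have "(\<Prod>j<N. 1 - \<beta> j p) = 0" using i(1) by (intro prod_zero) auto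
    then show ?thesis unfolding sum by simp
  qed
  have \<eta>m: "?\<eta> \<in> borel_measurable borel" by (intro borel_measurable_continuous_onI cutoff_continuous[OF R])
  have \<psi>m: "\<psi> i \<in> borel_measurable borel" for i by (intro borel_measurable_continuous_onI C1_fun_continuous[OF \<psi>C])
  have dm: "dY (\<psi> i) \<in> borel_measurable borel" for i by (intro borel_measurable_continuous_onI dY_continuous[OF \<psi>C])
  have nXm: "?nX \<in> borel_measurable borel" and nXi: "integrable ?vol ?nX"
    using L2 by (auto simp: norm_in_L2_def borel_measurable_volume)
  have dsupp: "dY (\<psi> i) p = 0" if "p \<notin> chart_inv (cs i) ` cball (xs i) (rs i)" for i p
    by (rule dY_locally_const[of "- chart_inv (cs i) ` cball (xs i) (rs i)" p _ 0])
      (use closed_inv_cball[OF cA(1,3)] that \<psi>supp in auto)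
  define I where "I i = (\<integral>x. indicator (cball (xs i) (rs i)) x * ((?\<eta> (chart_inv (cs i) x))^2
      * (\<psi> i (chart_inv (cs i) x) * (vol_density (cs i) x * cov_sq (cs i) x))) \<partial>lborel)" for i
  have loc: "I i \<le> ?C * (\<integral>p. \<psi> i p * ?nX p \<partial>?vol) + 2 * (\<integral>p. (?\<eta> p)^2 * dY (\<psi> i) p \<partial>?vol)"
    and iP: "integrable ?vol (\<lambda>p. (?\<eta> p)^2 * dY (\<psi> i) p)" for i
  proof -
    have e1: "indicator (cball (xs i) (rs i)) x * (vol_density (cs i) x * (\<psi> i (chart_inv (cs i) x) * ?nX (chart_inv (cs i) x)))
       = indicator (cball (xs i) (rs i)) x * (\<psi> i (chart_inv (cs i) x) * (vol_density (cs i) x * energy (cs i) x))" for x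
    proof (cases "x \<in> cball (xs i) (rs i)")
      case True
      then have x: "x \<in> chart_img (cs i)" using cA(3) by blast
      show ?thesis using vfield_norm_sq[OF cA(1) inv_in[OF cA(1) x]] coords_inv[OF cA(1) x] by simp
    qed simp
    have m1: "(\<lambda>p. \<psi> i p * ?nX p) \<in> borel_measurable borel" using \<psi>m nXm by simp
    have E: "(\<integral>p. \<psi> i p * ?nX p \<partial>?vol) = (\<integral>x. indicator (cball (xs i) (rs i)) x
        * (\<psi> i (chart_inv (cs i) x) * (vol_density (cs i) x * energy (cs i) x)) \<partial>lborel)"
      unfolding e1[symmetric] by (rule volume_integral_supported(2)[OF cA(1,3) m1]) (simp add: \<psi>supp)
    have e2: "indicator (cball (xs i) (rs i)) x * (vol_density (cs i) x * ((?\<eta> (chart_inv (cs i) x))^2 * dY (\<psi> i) (chart_inv (cs i) x)))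
       = indicator (cball (xs i) (rs i)) x * ((?\<eta> (chart_inv (cs i) x))^2
          * (vol_density (cs i) x * frechet_derivative (\<lambda>y. \<psi> i (chart_inv (cs i) y)) (at x) (flux (cs i) x)))" for x
    proof (cases "x \<in> cball (xs i) (rs i)")
      case True
      then have x: "x \<in> chart_img (cs i)" using cA(3) by blast
      show ?thesis using dY_chart[OF \<psi>C cA(1) inv_in[OF cA(1) x], of i] coords_inv[OF cA(1) x] by simp
    qed simp
    have m2: "(\<lambda>p. (?\<eta> p)^2 * dY (\<psi> i) p) \<in> borel_measurable borel" using \<eta>m dm by simp
    note tv = volume_integral_supported[OF cA(1)[of i] cA(3)[of i] m2, unfolded e2]
    have P: "(\<integral>p. (?\<eta> p)^2 * dY (\<psi> i) p \<partial>?vol) = (\<integral>x. indicator (cball (xs i) (rs i)) x * ((?\<eta> (chart_inv (cs i) x))^2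
          * (vol_density (cs i) x * frechet_derivative (\<lambda>y. \<psi> i (chart_inv (cs i) y)) (at x) (flux (cs i) x))) \<partial>lborel)"
      by (rule tv(2)) (simp add: dsupp)
    show "I i \<le> ?C * (\<integral>p. \<psi> i p * ?nX p \<partial>?vol) + 2 * (\<integral>p. (?\<eta> p)^2 * dY (\<psi> i) p \<partial>?vol)"
      unfolding I_def E P
    proof (rule local_energy[OF gb \<psi>C \<psi>nn \<psi>supp cutoff_continuous[OF R] cutoff_range(1)[OF R]])
      show "\<bar>?\<eta> p - ?\<eta> q\<bar> \<le> 1 / R * e" if "rdist p q \<le> ennreal e" "0 \<le> e" for p q e
        using cutoff_lipschitz[OF R that] by simp
    qed (use R in auto)
    have cont: "continuous_on (cball (xs i) (rs i)) (\<lambda>x. (?\<eta> (chart_inv (cs i) x))^2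
          * (vol_density (cs i) x * frechet_derivative (\<lambda>y. \<psi> i (chart_inv (cs i) y)) (at x) (flux (cs i) x)))"
    proof (rule continuous_on_subset[OF _ cA(3)], intro continuous_on_mult continuous_on_power)
      show "continuous_on (chart_img (cs i)) (\<lambda>x. ?\<eta> (chart_inv (cs i) x))"
        by (rule continuous_on_compose2[OF cutoff_continuous[OF R, of UNIV] cont_inv[OF cA(1)]]) simp
    qed (rule vol_density_continuous[OF cA(1)] test_derivative_continuous[OF \<psi>C cA(1)])+
    show "integrable ?vol (\<lambda>p. (?\<eta> p)^2 * dY (\<psi> i) p)"
      by (rule iffD2[OF tv(1) integrable_cball[OF cont]]) (simp add: dsupp)
  qed
  have iE: "integrable ?vol (\<lambda>p. \<psi> i p * ?nX p)" for i
  proof (rule Bochner_Integration.integrable_bound[OF nXi])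
    show "(\<lambda>p. \<psi> i p * ?nX p) \<in> borel_measurable ?vol" using \<psi>m nXm by (simp add: borel_measurable_volume)
    have "\<psi> i p \<le> 1" for p unfolding \<psi>_def using \<beta>01 by (intro mult_le_one prod_nonneg prod_le_1) auto
    then show "AE p in ?vol. norm (\<psi> i p * ?nX p) \<le> norm (?nX p)"
      using \<psi>nn by (intro AE_I2) (simp add: abs_mult mult_left_le_one_le)
  qed
  have Inn: "0 \<le> I i" for i
    unfolding I_def
  proof (rule integral_nonneg_AE, rule AE_I2)
    fix x
    show "0 \<le> indicator (cball (xs i) (rs i)) x * ((?\<eta> (chart_inv (cs i) x))^2
      * (\<psi> i (chart_inv (cs i) x) * (vol_density (cs i) x * cov_sq (cs i) x)))"
    proof (cases "x \<in> cball (xs i) (rs i)")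
      case True
      then have x: "x \<in> chart_img (cs i)" using cA(3) by blast
      show ?thesis using vol_density_pos[OF cA(1) x] cov_sq_nonneg[OF cA(1) x] \<psi>nn by simp
    qed simp
  qed
  have "I 0 \<le> (\<Sum>i<N. I i)" using N Inn by (intro member_le_sum) auto
  also have "\<dots> \<le> (\<Sum>i<N. ?C * (\<integral>p. \<psi> i p * ?nX p \<partial>?vol) + 2 * (\<integral>p. (?\<eta> p)^2 * dY (\<psi> i) p \<partial>?vol))"
    by (intro sum_mono loc)
  also have "\<dots> = ?C * (\<Sum>i<N. \<integral>p. \<psi> i p * ?nX p \<partial>?vol) + 2 * (\<Sum>i<N. \<integral>p. (?\<eta> p)^2 * dY (\<psi> i) p \<partial>?vol)"
    by (simp only: sum.distrib sum_distrib_left)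
  also have "(\<Sum>i<N. \<integral>p. (?\<eta> p)^2 * dY (\<psi> i) p \<partial>?vol) = (\<integral>p. (\<Sum>i<N. (?\<eta> p)^2 * dY (\<psi> i) p) \<partial>?vol)"
    using iP by (intro Bochner_Integration.integral_sum[symmetric]) auto
  \<comment> \<open>Outside the ball the cutoff vanishes; in the ball, which W contains, the weights
    sum to a constant.\<close>
  also have "(\<lambda>p. \<Sum>i<N. (?\<eta> p)^2 * dY (\<psi> i) p) = (\<lambda>p. 0)"
  proof
    fix p
    have "(\<Sum>i<N. (?\<eta> p)^2 * dY (\<psi> i) p) = (?\<eta> p)^2 * dY (\<lambda>p. \<Sum>i<N. \<psi> i p) p"
      by (simp add: sum_distrib_left dY_sum[OF \<psi>C])
    also have "\<dots> = 0"
    proof (cases "rdist p0 p \<le> ennreal R")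
      case True
      then have "p \<in> W" using cover unfolding W_def by blast
      then show ?thesis using dY_locally_const[OF \<open>open W\<close> _ sum_W] by simp
    qed (simp add: cutoff_def)
    finally show "(\<Sum>i<N. (?\<eta> p)^2 * dY (\<psi> i) p) = 0" .
  qed
  also have "(\<Sum>i<N. \<integral>p. \<psi> i p * ?nX p \<partial>?vol) = (\<integral>p. (\<Sum>i<N. \<psi> i p * ?nX p) \<partial>?vol)"
    using iE by (intro Bochner_Integration.integral_sum[symmetric]) auto
  also have "?C * \<dots> + 2 * (\<integral>p. 0 \<partial>?vol) \<le> ?C * (\<integral>p. ?nX p \<partial>?vol)"
  proof -
    have "(\<integral>p. (\<Sum>i<N. \<psi> i p * ?nX p) \<partial>?vol) \<le> (\<integral>p. ?nX p \<partial>?vol)"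
    proof (rule integral_mono)
      show "integrable ?vol (\<lambda>p. \<Sum>i<N. \<psi> i p * ?nX p)" using iE by (intro Bochner_Integration.integrable_sum) auto
      show "(\<Sum>i<N. \<psi> i p * ?nX p) \<le> ?nX p" for p
        using mult_right_mono[OF sum_le[of p], of "?nX p"] by (simp add: sum_distrib_right)
    qed (rule nXi)
    then show ?thesis by (simp add: mult_left_mono)
  qed
  \<comment> \<open>At index 0 the product over predecessors is empty, so \<open>\<psi> 0\<close> is
    the bump of the prescribed ball.\<close>
  finally show ?thesis by (simp add: I_def cs0 \<psi>_def \<beta>_def)
qed

text \<open>If \<nabla>X were nonzero at \<open>x0\<close>, the weighted integral of |\<nabla>X|^2
  near \<open>x0\<close> would have a positive lower bound v independent of large R, while the
  estimate centred at \<open>x0\<close> bounds it by C/R^2.\<close>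

lemma cov_eq_0:
  assumes complete: "riemannian_complete A g" and L2: "norm_in_L2 A g X"
    and c: "c \<in> A" and x0: "x0 \<in> chart_img c"
  shows "cov c x0 = 0"
proof (rule ccontr)
  assume ne: "cov c x0 \<noteq> 0"
  define p0 where "p0 = chart_inv c x0"
  have cp0: "coords c p0 = x0" using coords_inv[OF c x0] by (simp add: p0_def)
  obtain r where r: "good_ball c x0 r" using exists_good_ball[OF c x0] .
  have r0: "r > 0" and KU: "cball x0 r \<subseteq> chart_img c" using r good_ball_sub[OF r] by (auto simp: good_ball_def)
  define h where "h x = vol_density c x * cov_sq c x" for x
  have hC: "continuous_on (chart_img c) h"
    unfolding h_def by (intro continuous_on_mult vol_density_continuous[OF c] cov_sq_continuous[OF c])
  have hnn: "0 \<le> h x" if "x \<in> chart_img c" for x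
    using vol_density_pos[OF c that] cov_sq_nonneg[OF c that] by (simp add: h_def)
  have "cov_sq c x0 \<noteq> 0" using ne cov_matrix(3)[OF c x0 c x0] by blast
  then have h0: "h x0 > 0" using vol_density_pos[OF c x0] cov_sq_nonneg[OF c x0] by (simp add: h_def)
  have "isCont h x0" using hC open_img[OF c] x0 by (simp add: continuous_on_eq_continuous_at)
  then obtain d where d: "d > 0" "\<And>x. dist x x0 < d \<Longrightarrow> \<bar>h x - h x0\<bar> < h x0 / 2"
    using h0 unfolding continuous_at_eps_delta dist_real_def by (meson half_gt_zero)
  obtain r1 M where r1: "r1 > 0" "M > 0"
    "\<And>x. x \<in> cball x0 r1 \<Longrightarrow> rdist p0 (chart_inv c x) \<le> ennreal (M * dist x0 x)"
    using rdist_chart_comparison[OF c x0] unfolding p0_def by metis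
  \<comment> \<open>Within distance s the function h stays above half its central value, the bump
    equals 1, and the comparison of distances applies.\<close>
  define s where "s = min (d / 2) (min (r / 2) r1)"
  have s: "s > 0" "s \<le> d / 2" "s \<le> r / 2" "s \<le> r1" using d r0 r1 by (auto simp: s_def)
  \<comment> \<open>1/8 is the product of 1/2 for h and (1/2)^2 for the squared cutoff.\<close>
  define v where "v = h x0 / 8 * measure lborel (cball x0 s)"
  have v: "v > 0" using h0 s(1) by (simp add: v_def)
  define C where "C = 32 * real CARD('n)^2 * (1 + real CARD('n)) * (\<integral>p. (vfield_norm A g X p)^2 \<partial>riemannian_volume A g)"
  have C: "C \<ge> 0" unfolding C_def by (intro mult_nonneg_nonneg integral_nonneg_AE) auto
  \<comment> \<open>The first summand keeps the cutoff at least 1/2 on the ball of radius s, the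
    second makes C/R at most v, and the last makes this strict and ensures R \<ge> 1.\<close>
  define R where "R = 2 * M * s + C / v + 1"
  have "0 \<le> 2 * M * s" "0 \<le> C / v" using r1 s v C by simp_all
  then have R1: "R \<ge> 1" and R2: "R \<ge> 2 * M * s" and R3: "R > C / v" unfolding R_def by linarith+
  have Rp: "R > 0" using R1 by simp
  let ?F = "\<lambda>x. (cutoff p0 R (chart_inv c x))^2 * (chart_bump c x0 r (chart_inv c x) * (vol_density c x * cov_sq c x))"
  have Fnn: "0 \<le> ?F x" if "x \<in> chart_img c" for x
    using hnn[OF that] chart_bump_range(1) by (simp add: h_def)
  have FC: "continuous_on (cball x0 r) ?F"
  proof (rule continuous_on_subset[OF _ KU], intro continuous_on_mult continuous_on_power)
    show "continuous_on (chart_img c) (\<lambda>x. cutoff p0 R (chart_inv c x))"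
      by (rule continuous_on_compose2[OF cutoff_continuous[OF Rp, of UNIV] cont_inv[OF c]]) simp
    show "continuous_on (chart_img c) (\<lambda>x. chart_bump c x0 r (chart_inv c x))"
      by (rule Ck_on_imp_continuous_on[OF C1_funD[OF C1_fun_chart_bump[OF c r0 KU] c]])
  qed (rule vol_density_continuous[OF c] cov_sq_continuous[OF c])+
  have low: "indicator (cball x0 s) x * (h x0 / 8) \<le> indicator (cball x0 r) x * ?F x" for x
  proof (cases "x \<in> cball x0 s")
    case True
    then have xs: "dist x0 x \<le> s" by simp
    then have xr: "x \<in> cball x0 r" using s r0 by simp
    then have xU: "x \<in> chart_img c" using KU by blast
    have "chart_bump c x0 r (chart_inv c x) = 1"
      using bump_inner[of x0 x r] xs s r0 inv_in[OF c xU] coords_inv[OF c xU] by (simp add: chart_bump_def)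
    moreover have "h x0 / 2 \<le> vol_density c x * cov_sq c x"
    proof -
      have "\<bar>h x - h x0\<bar> < h x0 / 2" using d(2)[of x] xs s d(1) by (simp add: dist_commute)
      then have "h x0 / 2 \<le> h x" by linarith
      then show ?thesis unfolding h_def[of x] .
    qed
    moreover have "(1/2)^2 \<le> (cutoff p0 R (chart_inv c x))^2"
    proof (rule power_mono)
      have "rdist p0 (chart_inv c x) \<le> ennreal (M * dist x0 x)" using r1(3)[of x] xs s by simp
      also have "\<dots> \<le> ennreal (M * s)" using xs r1 by (intro ennreal_leI mult_left_mono) auto
      finally have "1 - M * s / R \<le> cutoff p0 R (chart_inv c x)" using Rp r1 s by (intro cutoff_finite) auto
      moreover have "M * s / R \<le> 1 / 2" using R2 Rp by (simp add: divide_le_eq)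
      ultimately show "1 / 2 \<le> cutoff p0 R (chart_inv c x)" by linarith
    qed simp
    moreover have "0 \<le> h x0 / 2" using h0 by simp
    ultimately have "(1/2)^2 * (h x0 / 2) \<le> ?F x" by (simp only: mult_1_left mult_mono zero_le_power2)
    then show ?thesis using True xr by (simp add: power2_eq_square)
  next
    case False
    have "0 \<le> indicator (cball x0 r) x * ?F x" using Fnn KU by (cases "x \<in> cball x0 r") auto
    then show ?thesis using False by simp
  qed
  have "v = (\<integral>x. indicator (cball x0 s) x * (h x0 / 8) \<partial>lborel)" by (simp add: v_def)
  also have "\<dots> \<le> (\<integral>x. indicator (cball x0 r) x * ?F x \<partial>lborel)"
    by (rule integral_mono[OF integrable_cball[OF continuous_on_const] integrable_cball[OF FC] low])
  also have "\<dots> \<le> C * (1 / R)^2"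
    using energy_estimate[OF complete L2, of c p0 r R] r Rp unfolding cp0 by (simp add: C_def mult_ac)
  also have "\<dots> \<le> C * (1 / R)"
  proof (rule mult_left_mono[OF _ C])
    show "(1 / R)^2 \<le> 1 / R" using R1 by (simp add: power2_eq_square divide_simps)
  qed
  also have "\<dots> < v" using R3 Rp v by (simp add: divide_less_eq mult.commute)
  finally show False by simp
qed

end

theorem theorem1p2:
  fixes A :: "('m::{t2_space,second_countable_topology}, 'n::finite) chart set"
    and g :: "('m, 'n) tensor2"
    and X :: "('m, 'n) vfield"
    and \<rho> :: "'m \<Rightarrow> real"
  assumes "CARD('n) \<ge> 3"
    and "almost_yamabe_soliton A g X \<rho>"
    and "riemannian_complete A g"
    and "\<not> compact (UNIV :: 'm set)"
    and "ricci_nonpositive A g"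
    and "norm_in_L2 A g X"
  shows "parallel_field A g X \<and> killing_field A g X"
proof -
  interpret almost_yamabe A g X \<rho>
  proof unfold_locales
    show "riemannian_manifold A g" using assms(2) by (simp only: almost_yamabe_soliton_def)
    show "CARD('n) \<ge> 2" using assms(1) by linarith
  qed (rule assms)+
  have zero: "cov c x = 0" if "c \<in> A" "x \<in> chart_img c" for c x
    by (rule cov_eq_0[OF assms(3,6) that])
  \<comment> \<open>The Lie derivative of the metric is the symmetrised lowered \<nabla>X and
    vanishes with it.\<close>
  then have "lie_derivative (X c) (g c) x = 0" if "c \<in> A" "x \<in> chart_img c" for c x
    using chart_field.lie_derivative_eq[OF chart_field[OF that(1)] that(2)] that
    by (simp add: matrix_matrix_mult_def transpose_def vec_eq_iff)
  then show ?thesis using zero by (auto simp: parallel_field_def killing_field_def)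
qed

end
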